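(* The three weak Jacobi forms $\varphi^{D_8}_{-4,1}$, $\varphi^{D_8}_{-2,1}$, $\varphi^{D_8}_{0,1}$ of index $1$ for the lattice $D_8$ satisfy the system of modular differential equations $$\left\{\begin{aligned} 3H_{-4}(\varphi^{D_8}_{-4,1})&=\varphi^{D_8}_{-2,1},\\ 2H_{-2}(\varphi^{D_8}_{-2,1})-E_4\,\varphi^{D_8}_{-4,1}&=32\,\varphi^{D_8}_{0,1},\\ E_6\,\varphi^{D_8}_{-4,1}+E_4\,\varphi^{D_8}_{-2,1}&=48\,H_0(\varphi^{D_8}_{0,1}). \end{aligned}\right.$$
   Context: $D_8=\{x\in\mathbb{Z}^8:\sum x_i\equiv0\bmod 2\}$ with the Euclidean inner product, dual lattice $D_8^\vee$; $\tau$ is in the upper half-plane, $q=e^{2\pi i\tau}$, $\mathfrak{z}=(z_1,\dots,z_8)\in D_8\otimes\mathbb{C}$ in standard coordinates, $\zeta_j=e^{2\pi i z_j}$, $\zeta^l=e^{2\pi i(\mathfrak{z},l)}$. A weak Jacobi form of weight $k$ and index $1$ for $D_8$ is a holomorphic function $\varphi(\tau,\mathfrak{z})$ with $\varphi\left(\frac{a\tau+b}{c\tau+d},\frac{\mathfrak{z}}{c\tau+d}\right)=(c\tau+d)^k e^{\pi i\frac{c(\mathfrak{z},\mathfrak{z})}{c\tau+d}}\varphi(\tau,\mathfrak{z})$ for all $\begin{pmatrix}a&b\\c&d\end{pmatrix}\in SL_2(\mathbb{Z})$, $\varphi(\tau,\mathfrak{z}+\lambda\tau+\mu)=e^{-2\pi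 i(\lambda,\mathfrak{z})-\pi i(\lambda,\lambda)\tau}\varphi(\tau,\mathfrak{z})$ for all $\lambda,\mu\in D_8$, and Fourier expansion $\sum_{n\ge0,\,l\in D_8^\vee}a(n,l)q^n\zeta^l$. For such $\varphi$ of weight $k$, the modular differential operator is $$H_k(\varphi)=\frac{1}{2\pi i}\frac{\partial\varphi}{\partial\tau}+\frac{1}{8\pi^2}\sum_{i=1}^8\frac{\partial^2\varphi}{\partial z_i^2}+(2k-8)G_2\varphi=\sum_{n,l}\left(n-\tfrac12(l,l)\right)a(n,l)q^n\zeta^l+(2k-8)G_2\varphi,$$ with $G_2(\tau)=-\frac1{24}+\sum_{n\ge1}\sigma_1(n)q^n$, where $\sigma_k(n)=\sum_{d\mid n}d^k$; it maps weight $k$ to weight $k+2$ and preserves the index. $E_4=1+240\sum_{n\ge1}\sigma_3(n)q^n$, $E_6=1-504\sum_{n\ge1}\sigma_5(n)q^n$, $\eta(\tau)=q^{1/24}\prod_{n\ge1}(1-q^n)$, $\Delta=\eta^{24}$, $\vartheta(\tau,z)=q^{1/8}\sum_{n\in\mathbb{Z}}(-1)^nq^{n(n+1)/2}e^{2\pi i(n+1/2)z}$. For an even unimodular lattice $L$ put $\Theta_L(\tau,\mathfrak{z})=\sum_{l\in L}q^{(l,l)/2}\zeta^l$. Let $E_8=\langle D_8,\frac12(1,\dots,1)\rangle$, $D_{16}^+=\langle D_{16},\frac12(1,\dots,1)\rangle$ (where $D_{16}=\{x\in\mathbb{Z}^{16}:\sum x_i\equiv0\bmod2\}$), and let $\Theta_{D_{16}^+}|_{D_8}$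 be the restriction to $z_9=\dots=z_{16}=0$. Let $\omega^{D_8}_{-8,1}=\eta^{-24}\prod_{i=1}^8\vartheta(\tau,z_i)$. The forms are defined by $$\varphi^{D_8}_{-4,1}=2\Delta^{-1}\left(E_4\Theta_{E_8}-\Theta_{D_{16}^+}|_{D_8}\right)-E_4\,\omega^{D_8}_{-8,1}=256-32\sum_{j=1}^8(\zeta_j+\zeta_j^{-1})+\sum\zeta_1^{\pm1/2}\cdots\zeta_8^{\pm1/2}+q(\dots)$$ (the last sum over all $2^8$ choices of signs), $$\varphi^{D_8}_{-2,1}=3H_{-4}(\varphi^{D_8}_{-4,1})=512-16\sum_{j=1}^8(\zeta_j+\zeta_j^{-1})-\sum\zeta_1^{\pm1/2}\cdots\zeta_8^{\pm1/2}+q(\dots),$$ and, with $\Theta_{D_8}(\tau,\mathfrak{z})=\prod_{i=1}^8\vartheta(\tau,z_i)$ and $(\Theta_{D_8}|T_-(2))(\tau,\mathfrak{z})=\frac12\left[16\,\Theta_{D_8}(2\tau,2\mathfrak{z})+\Theta_{D_8}(\tfrac{\tau}{2},\mathfrak{z})+\Theta_{D_8}(\tfrac{\tau+1}{2},\mathfrak{z})\right]$, $$\varphi^{D_8}_{0,1}=-\frac{\Theta_{D_8}|T_-(2)}{\Theta_{D_8}}=8+\sum_{j=1}^8(\zeta_j+\zeta_j^{-1})+q(\dots).$$ These are weak Jacobi forms of index $1$ and weights $-4,-2,0$, invariant under the full integral orthogonal group $O(D_8)$.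
   Formalization: In the third equation the constant 48 is replaced by 288, because the q^0-terms are 768 − 48 Σ(ζ_j + ζ_j^{-1}) on the left and 8/3 − (1/6) Σ(ζ_j + ζ_j^{-1}) for H_0(φ_{0,1}), so the equation printed with 48 is false. *)

theory Defs
  imports
    "HOL-Analysis.Analysis"
    "HOL-Computational_Algebra.Group_Closure"
begin

text \<open>Fractional powers are always \<open>q\<^sup>x = exp (2\<pi>i x \<tau>)\<close>, never a branch of a power of the number \<open>q\<close>.\<close>

definition e2pi :: "complex \<Rightarrow> complex" where
  "e2pi w = exp (2 * complex_of_real pi * \<i> * w)"

definition divisor_sum :: "nat \<Rightarrow> nat \<Rightarrow> nat" where
  "divisor_sum k n = (\<Sum>d | d dvd n. d ^ k)"

definition eis_G2 :: "complex \<Rightarrow> complex" where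
  "eis_G2 \<tau> = - 1 / 24 + (\<Sum>n. of_nat (divisor_sum 1 (Suc n)) * e2pi \<tau> ^ Suc n)"

definition eis_E4 :: "complex \<Rightarrow> complex" where
  "eis_E4 \<tau> = 1 + 240 * (\<Sum>n. of_nat (divisor_sum 3 (Suc n)) * e2pi \<tau> ^ Suc n)"

definition eis_E6 :: "complex \<Rightarrow> complex" where
  "eis_E6 \<tau> = 1 - 504 * (\<Sum>n. of_nat (divisor_sum 5 (Suc n)) * e2pi \<tau> ^ Suc n)"

definition dedekind_eta :: "complex \<Rightarrow> complex" where
  "dedekind_eta \<tau> = e2pi (\<tau> / 24) * (\<Prod>n. 1 - e2pi \<tau> ^ Suc n)"

definition mod_Delta :: "complex \<Rightarrow> complex" where
  "mod_Delta \<tau> = dedekind_eta \<tau> ^ 24"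

definition jtheta :: "complex \<Rightarrow> complex \<Rightarrow> complex" where
  "jtheta \<tau> z = e2pi (\<tau> / 8) *
     (\<Sum>\<^sub>\<infinity>n\<in>(UNIV :: int set).
        (- 1) powi n * e2pi (of_int (n * (n + 1)) / 2 * \<tau>) * e2pi ((of_int n + 1 / 2) * z))"

definition D_lattice :: "(real ^ 'n) set" where
  "D_lattice = {x. \<exists>m :: 'n \<Rightarrow> int. (\<forall>i. x $ i = of_int (m i)) \<and> even (\<Sum>i\<in>UNIV. m i)}"

definition D_plus_lattice :: "(real ^ 'n) set" where
  "D_plus_lattice = group_closure (insert (\<chi> i. 1 / 2) D_lattice)"

definition lattice_theta :: "(real ^ 'n) set \<Rightarrow> complex \<Rightarrow> complex ^ 'n \<Rightarrow> complex" where
  "lattice_theta L \<tau> z =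
     (\<Sum>\<^sub>\<infinity>l\<in>L. e2pi (of_real (l \<bullet> l) / 2 * \<tau>) * e2pi (\<Sum>i\<in>UNIV. z $ i * of_real (l $ i)))"

definition theta_E8 :: "complex \<Rightarrow> complex ^ 8 \<Rightarrow> complex" where
  "theta_E8 = lattice_theta D_plus_lattice"

text \<open>The sixteen coordinates are indexed by the sum type \<open>8 + 8\<close>; the left summand carries
  \<open>z\<^sub>1, \<dots>, z\<^sub>8\<close> and the right one \<open>z\<^sub>9 = \<dots> = z\<^sub>1\<^sub>6 = 0\<close>.\<close>

definition theta_D16_plus_restricted :: "complex \<Rightarrow> complex ^ 8 \<Rightarrow> complex" where
  "theta_D16_plus_restricted \<tau> z =
     lattice_theta (D_plus_lattice :: (real ^ (8 + 8)) set) \<tau>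
       (\<chi> i. case i of Inl j \<Rightarrow> z $ j | Inr _ \<Rightarrow> 0)"

definition theta_D8 :: "complex \<Rightarrow> complex ^ 8 \<Rightarrow> complex" where
  "theta_D8 \<tau> z = (\<Prod>i\<in>UNIV. jtheta \<tau> (z $ i))"

definition omega_m8 :: "complex \<Rightarrow> complex ^ 8 \<Rightarrow> complex" where
  "omega_m8 \<tau> z = inverse (dedekind_eta \<tau> ^ 24) * (\<Prod>i\<in>UNIV. jtheta \<tau> (z $ i))"

definition theta_D8_T2 :: "complex \<Rightarrow> complex ^ 8 \<Rightarrow> complex" where
  "theta_D8_T2 \<tau> z =
     1 / 2 * (16 * theta_D8 (2 * \<tau>) (2 *s z) + theta_D8 (\<tau> / 2) z + theta_D8 ((\<tau> + 1) / 2) z)"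

definition heat_op :: "int \<Rightarrow> (complex \<Rightarrow> complex ^ 8 \<Rightarrow> complex) \<Rightarrow> complex \<Rightarrow> complex ^ 8 \<Rightarrow> complex" where
  "heat_op k \<phi> \<tau> z =
     1 / (2 * of_real pi * \<i>) * deriv (\<lambda>t. \<phi> t z) \<tau>
     + 1 / (8 * of_real pi ^ 2) *
         (\<Sum>i\<in>UNIV. (deriv ^^ 2) (\<lambda>w. \<phi> \<tau> (\<chi> j. if j = i then w else z $ j)) (z $ i))
     + of_int (2 * k - 8) * eis_G2 \<tau> * \<phi> \<tau> z"

definition phi_m4 :: "complex \<Rightarrow> complex ^ 8 \<Rightarrow> complex" where
  "phi_m4 \<tau> z =
     2 * inverse (mod_Delta \<tau>) * (eis_E4 \<tau> * theta_E8 \<tau> z - theta_D16_plus_restricted \<tau> z)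
     - eis_E4 \<tau> * omega_m8 \<tau> z"

definition phi_m2 :: "complex \<Rightarrow> complex ^ 8 \<Rightarrow> complex" where
  "phi_m2 \<tau> z = 3 * heat_op (- 4) phi_m4 \<tau> z"

text \<open>The quotient defining \<open>\<phi>\<^sub>0\<^sub>,\<^sub>1\<close> is a holomorphic function: on the zero divisor of the
  denominator (some \<open>z\<^sub>i \<in> \<int> + \<tau>\<int>\<close>) it denotes the holomorphic extension, whereas \<open>x / 0 = 0\<close> in HOL.
  The extension is the limit along the points where the denominator does not vanish, which are
  dense; off the divisor this limit is the quotient itself.\<close>

definition phi_0 :: "complex \<Rightarrow> complex ^ 8 \<Rightarrow> complex" where
  "phi_0 \<tau> z =
     Lim (at z within {w. theta_D8 \<tau> w \<noteq> 0}) (\<lambda>w. - (theta_D8_T2 \<tau> w / theta_D8 \<tau> w))"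

text \<open>Constant in the third differential equation. With the normalisations above, the
  \<open>q\<^sup>0\<close>-terms, where \<open>S = \<Sum>\<^sub>j (\<zeta>\<^sub>j + \<zeta>\<^sub>j\<^sup>-\<^sup>1)\<close>, are \<open>768 - 48 S\<close> for
  \<open>E\<^sub>6 \<phi>\<^sub>-\<^sub>4 + E\<^sub>4 \<phi>\<^sub>-\<^sub>2\<close> and \<open>8/3 - S/6\<close> for \<open>H\<^sub>0(\<phi>\<^sub>0)\<close>.
  The constant is therefore \<open>288 = 6 * 48\<close>, and not \<open>48\<close> as printed in the source.\<close>

end

theory Submission
  imports Defs "HOL-Complex_Analysis.Complex_Analysis"
begin

text \<open>
  Why the system holds. The three forms are combinations, with coefficients depending on \<open>\<tau>\<close> alone,
  of the products \<open>P\<^sub>j(\<tau>, z) = \<Prod>\<^sub>i \<theta>\<^sub>j(\<tau>, z\<^sub>i)\<close> of the classical theta functions with \<open>j = 2, 3, 4\<close>.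
  A theta function in one variable solves the heat equation, so the heat operator annihilates \<open>P\<^sub>j\<close>,
  and \<open>H\<^sub>k\<close> acts on \<open>\<Sum> h\<^sub>j P\<^sub>j\<close> through the Serre derivative \<open>h \<mapsto> D h - (k - 4)/12 E\<^sub>2 h\<close> of the
  coefficients, where \<open>D = q d/dq\<close> (\<open>heat_op_theta_combination\<close>). Only identities between modular
  forms in \<open>\<tau>\<close> remain.

  Let \<open>x, w, y\<close> be the fourth powers of the theta constants \<open>\<theta>\<^sub>2, \<theta>\<^sub>3, \<theta>\<^sub>4\<close>, so that \<open>w = x + y\<close>. The theta
  series of \<open>E\<^sub>8\<close> and \<open>D\<^sub>1\<^sub>6\<^sup>+\<close> are half-sums of such products, weighted by the eighth powers of the theta
  constants in the second case; the product \<open>P\<^sub>1\<close> of the odd functions \<open>\<theta>\<^sub>1\<close> cancels against \<open>\<omega>\<close>, and \<open>E\<^sub>4 = x\<^sup>2 + x y + y\<^sup>2\<close>, \<open>\<Delta> = (x y w)\<^sup>2 / 256\<close> give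
  \<open>\<phi>\<^sub>-\<^sub>4 = 256/(x y w) (P\<^sub>2/x + P\<^sub>4/y - P\<^sub>3/w)\<close> (\<open>phi_m4_eq\<close>). The duplication formulas for \<open>\<theta>\<^sub>1\<close> give
  \<open>\<phi>\<^sub>0 = -8/(x y w) (x P\<^sub>2 + y P\<^sub>4 - w P\<^sub>3)\<close> (\<open>phi_0_eq\<close>). With
  \<open>D log x = (E\<^sub>2 + w + y)/6\<close>, \<open>D log w = (E\<^sub>2 + x - y)/6\<close>, \<open>D log y = (E\<^sub>2 - x - w)/6\<close>
  and \<open>E\<^sub>6 = (x + w)(w + y)(y - x)/2\<close>
  each equation of the system is, coefficient by coefficient, an identity of rational functions in
  \<open>x, y, E\<^sub>2\<close>.

  These facts about theta constants come without the theory of modular forms. Rotating the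
  square lattice in a double series gives the duplication formulas, Jacobi's quartic identity and
  \<open>D log (\<theta>\<^sub>3/\<theta>\<^sub>4) = x/8\<close>. The Taylor coefficients of \<open>\<theta>\<^sub>1\<close> at \<open>z = 0\<close> have two descriptions: by the
  heat equation they are derivatives of \<open>\<theta>\<^sub>1'\<close> in \<open>\<tau>\<close>, and by the Jacobi triple product, whose logarithmic
  derivative is a Lambert series, they are \<open>\<eta>\<^sup>3\<close> times polynomials in \<open>E\<^sub>2, E\<^sub>4, E\<^sub>6\<close>
  (\<open>jtheta_mom_eis\<close>). Comparing them yields \<open>D log \<theta>\<^sub>1' = E\<^sub>2/8\<close> and Ramanujan's equations for \<open>D E\<^sub>2\<close>
  and \<open>D E\<^sub>4\<close>. Jacobi's formula \<open>2 \<theta>\<^sub>1' = \<theta>\<^sub>2 \<theta>\<^sub>3 \<theta>\<^sub>4\<close> holds because the quotient of the two sides is invariant under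
  \<open>\<tau> \<mapsto> 2 \<tau>\<close> and tends to \<open>1\<close> at the cusp. Finally \<open>E\<^sub>4\<close> is read off from the coefficient of degree \<open>5\<close> in
  \<open>\<theta>\<^sub>1(2z) \<theta>\<^sub>2 \<theta>\<^sub>3 \<theta>\<^sub>4 = 2 \<theta>\<^sub>1(z) \<theta>\<^sub>2(z) \<theta>\<^sub>3(z) \<theta>\<^sub>4(z)\<close>, and \<open>E\<^sub>6\<close> from \<open>D E\<^sub>4\<close>.
\<close>

section \<open>Termwise differentiation and theta moments\<close>

text \<open>Weierstrass' theorem for unordered sums: a summable bound on the terms
  is enough, since Cauchy's formula controls their derivatives.\<close>

lemma has_field_derivative_infsum:
  fixes f f' :: "'a \<Rightarrow> complex \<Rightarrow> complex"
  assumes r: "r > 0"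
    and deriv: "\<And>x w. x \<in> X \<Longrightarrow> w \<in> cball z r \<Longrightarrow> (f x has_field_derivative f' x w) (at w)"
    and bound: "\<And>x w. x \<in> X \<Longrightarrow> w \<in> cball z r \<Longrightarrow> norm (f x w) \<le> M x"
    and M: "M summable_on X"
  shows "((\<lambda>w. \<Sum>\<^sub>\<infinity>x\<in>X. f x w) has_field_derivative (\<Sum>\<^sub>\<infinity>x\<in>X. f' x z)) (at z)"
    and "(\<lambda>x. f' x z) summable_on X"
proof -
  let ?F = "finite_subsets_at_top X"
  have ev: "eventually (\<lambda>A. finite A \<and> A \<subseteq> X) ?F"
    by (simp add: eventually_finite_subsets_at_top_weakI)
  have cont: "eventually (\<lambda>A. continuous_on (cball z r) (\<lambda>w. \<Sum>x\<in>A. f x w) \<and>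
      (\<forall>w\<in>ball z r. ((\<lambda>w. \<Sum>x\<in>A. f x w) has_field_derivative (\<Sum>x\<in>A. f' x w)) (at w))) ?F"
    using ev
  proof eventually_elim
    case (elim A)
    have d: "((\<lambda>w. \<Sum>x\<in>A. f x w) has_field_derivative (\<Sum>x\<in>A. f' x w)) (at w)" if "w \<in> cball z r" for w
      using that elim deriv by (intro DERIV_sum) blast
    then have "continuous_on (cball z r) (\<lambda>w. \<Sum>x\<in>A. f x w)"
      by (intro continuous_at_imp_continuous_on ballI) (blast intro: DERIV_isCont)
    then show ?case using d by (meson ball_subset_cball subsetD)
  qed
  have ul: "uniform_limit (cball z r) (\<lambda>A w. \<Sum>x\<in>A. f x w) (\<lambda>w. \<Sum>\<^sub>\<infinity>x\<in>X. f x w) ?F"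
    by (rule Weierstrass_m_test_general[OF bound M])
  obtain g' where g': "\<And>w. w \<in> ball z r \<Longrightarrow>
      ((\<lambda>w. \<Sum>\<^sub>\<infinity>x\<in>X. f x w) has_field_derivative (g' w)) (at w) \<and>
      ((\<lambda>A. \<Sum>x\<in>A. f' x w) \<longlongrightarrow> g' w) ?F"
    using has_complex_derivative_uniform_limit[OF cont ul finite_subsets_at_top_neq_bot r] by blast
  have z: "z \<in> ball z r" using r by simp
  have hs: "((\<lambda>x. f' x z) has_sum g' z) X"
    using g'[OF z] by (simp add: has_sum_def)
  then show "(\<lambda>x. f' x z) summable_on X" by (rule has_sum_imp_summable)
  show "((\<lambda>w. \<Sum>\<^sub>\<infinity>x\<in>X. f x w) has_field_derivative (\<Sum>\<^sub>\<infinity>x\<in>X. f' x z)) (at z)"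
    using g'[OF z] infsumI[OF hs] by simp
qed

lemma summable_on_exp_abs_int: "(\<lambda>n::int. exp (- real_of_int \<bar>n\<bar>)) summable_on UNIV"
proof -
  have s: "summable (\<lambda>n::nat. exp (-1::real) ^ n)"
    by (rule summable_geometric) simp
  then have n: "(\<lambda>n::nat. exp (- real n)) summable_on UNIV"
    by (subst summable_on_UNIV_nonneg_real_iff) (auto simp: exp_of_nat_mult[symmetric] mult.commute)
  have a: "(\<lambda>n::int. exp (- real_of_int \<bar>n\<bar>)) summable_on (int ` UNIV)"
    by (subst summable_on_reindex) (auto simp: o_def n)
  have b: "(\<lambda>n::int. exp (- real_of_int \<bar>n\<bar>)) summable_on ((\<lambda>k. - int k) ` UNIV)"
    by (subst summable_on_reindex) (auto simp: o_def n inj_on_def)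
  have "(UNIV :: int set) = int ` UNIV \<union> (\<lambda>k. - int k) ` UNIV"
  proof -
    have "x \<in> int ` UNIV \<union> (\<lambda>k. - int k) ` UNIV" for x
      by (cases x rule: int_cases2) auto
    then show ?thesis by blast
  qed
  then show ?thesis using summable_on_union[OF a b] by simp
qed

lemma e2pi_add: "e2pi (a + b) = e2pi a * e2pi b"
  by (simp add: e2pi_def distrib_left exp_add)

lemma e2pi_0 [simp]: "e2pi 0 = 1"
  by (simp add: e2pi_def)

lemma e2pi_nonzero [simp]: "e2pi a \<noteq> 0"
  by (simp add: e2pi_def)

lemma e2pi_minus: "e2pi (- a) = inverse (e2pi a)"
  by (simp add: e2pi_def exp_minus)

lemma e2pi_power: "e2pi a ^ n = e2pi (of_nat n * a)"
  by (simp add: e2pi_def exp_of_nat_mult[symmetric] algebra_simps)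

lemma e2pi_power_int: "e2pi a powi n = e2pi (of_int n * a)"
  by (simp add: e2pi_def exp_power_int mult_ac)

lemma e2pi_1 [simp]: "e2pi 1 = 1"
  by (simp add: e2pi_def)

lemma e2pi_int [simp]: "e2pi (of_int n) = 1"
  using e2pi_power_int[of 1 n] by simp

lemma e2pi_half [simp]: "e2pi (1 / 2) = -1"
  by (simp add: e2pi_def)

lemma e2pi_half_int: "e2pi (of_int n / 2) = (-1) powi n"
  using e2pi_power_int[of "1 / 2" n] by simp

lemma e2pi_quarter [simp]: "e2pi (1 / 4) = \<i>"
proof -
  have "e2pi (1/4) = exp (\<i> * of_real (pi/2))"
    by (simp add: e2pi_def algebra_simps)
  then show ?thesis by (simp only: cis_conv_exp[symmetric] cis_pi_half)
qed

lemma norm_e2pi: "norm (e2pi w) = exp (- 2 * pi * Im w)"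
  by (simp add: e2pi_def)

lemma e2pi_has_field_derivative [derivative_intros]:
  assumes "(f has_field_derivative f') (at x within A)"
  shows "((\<lambda>x. e2pi (f x)) has_field_derivative (2 * of_real pi * \<i> * f' * e2pi (f x))) (at x within A)"
  unfolding e2pi_def by (auto intro!: derivative_eq_intros assms)

definition theta_term :: "nat \<Rightarrow> complex \<Rightarrow> complex \<Rightarrow> real \<Rightarrow> complex" where
  "theta_term k \<tau> z x = of_real x ^ k * e2pi (of_real (x\<^sup>2) / 2 * \<tau> + of_real x * z)"

text \<open>The weights \<open>(n + a)\<^sup>k\<close> make the family closed under both derivatives: \<open>\<partial>/\<partial>z\<close> raises \<open>k\<close> by one and
  \<open>\<partial>/\<partial>\<tau>\<close> raises it by two. This is the heat equation, and it is why the values at a point of the functions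
  with all \<open>k\<close> serve as Taylor coefficients below.\<close>

definition theta_mom :: "real \<Rightarrow> nat \<Rightarrow> complex \<Rightarrow> complex \<Rightarrow> complex" where
  "theta_mom a k \<tau> z = (\<Sum>\<^sub>\<infinity>n\<in>(UNIV :: int set). theta_term k \<tau> z (of_int n + a))"

text \<open>With \<open>x = n + a\<close>, the Gaussian \<open>exp (- \<pi> \<delta> x\<^sup>2)\<close> absorbs \<open>exp ((2 \<pi> R + 2) \<bar>x\<bar>)\<close> by completing the square;
  of the two extra exponentials one pays for \<open>\<bar>x\<bar>\<^sup>k \<le> k! exp \<bar>x\<bar>\<close> and the other leaves a summable bound
  that is uniform for \<open>Im \<tau> \<ge> \<delta>\<close> and \<open>\<bar>Im z\<bar> \<le> R\<close>.\<close>

definition theta_bound :: "nat \<Rightarrow> real \<Rightarrow> real \<Rightarrow> real \<Rightarrow> int \<Rightarrow> real" where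
  "theta_bound k \<delta> R a n =
     fact k * exp ((2 * pi * R + 2)\<^sup>2 / (4 * pi * \<delta>)) * exp \<bar>a\<bar> * exp (- real_of_int \<bar>n\<bar>)"

lemma theta_bound_summable: "theta_bound k \<delta> R a summable_on UNIV"
  unfolding theta_bound_def by (intro summable_on_cmult_right summable_on_exp_abs_int)

lemma power_le_fact_exp: "x ^ k \<le> fact k * exp (x::real)" if "x \<ge> 0"
proof -
  have "(\<lambda>n. x ^ n /\<^sub>R fact n) sums exp x" by (rule exp_converges)
  then have "x ^ k /\<^sub>R fact k \<le> exp x"
    using that sum_le_suminf[of "\<lambda>n. x ^ n /\<^sub>R fact n" "{k}"] by (auto simp: sums_iff)
  then show ?thesis by (simp add: field_simps)
qed

lemma norm_theta_term_le:
  assumes "\<delta> > 0" "Im \<tau> \<ge> \<delta>" "\<bar>Im z\<bar> \<le> R"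
  shows "norm (theta_term k \<tau> z (of_int n + a)) \<le> theta_bound k \<delta> R a n"
proof -
  define x where "x = of_int n + a"
  have "norm (theta_term k \<tau> z x) = \<bar>x\<bar> ^ k * exp (- pi * x\<^sup>2 * Im \<tau> - 2 * pi * x * Im z)"
    by (simp add: theta_term_def norm_mult norm_power norm_e2pi algebra_simps power_abs flip: of_real_power)
  also have "\<dots> \<le> (fact k * exp \<bar>x\<bar>) * exp ((2 * pi * R + 2)\<^sup>2 / (4 * pi * \<delta>) - 2 * \<bar>x\<bar>)"
  proof (intro mult_mono power_le_fact_exp)
    have "x\<^sup>2 * Im \<tau> \<ge> x\<^sup>2 * \<delta>" using assms by (intro mult_left_mono) auto
    then have 1: "pi * (x\<^sup>2 * Im \<tau>) \<ge> pi * (x\<^sup>2 * \<delta>)" by simp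
    have "- (x * Im z) \<le> \<bar>x\<bar> * R"
      using mult_left_mono[OF assms(3), of "\<bar>x\<bar>"] abs_mult[of x "Im z"] by linarith
    then have 2: "2 * pi * (- (x * Im z)) \<le> 2 * pi * (\<bar>x\<bar> * R)" by (intro mult_left_mono) auto
    define B where "B = 2 * pi * R + 2"
    have "0 \<le> (2 * pi * \<delta> * \<bar>x\<bar> - B)\<^sup>2 / (4 * pi * \<delta>)" using assms by simp
    also have "\<dots> = B\<^sup>2 / (4 * pi * \<delta>) - B * \<bar>x\<bar> + pi * \<delta> * x\<^sup>2"
      using assms by (simp add: field_simps power2_eq_square)
    finally have 3: "pi * \<delta> * x\<^sup>2 \<ge> B * \<bar>x\<bar> - B\<^sup>2 / (4 * pi * \<delta>)" by simp
    have 4: "B * \<bar>x\<bar> = 2 * pi * (\<bar>x\<bar> * R) + 2 * \<bar>x\<bar>" by (simp add: B_def algebra_simps)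
    have le1: "pi * \<delta> * x\<^sup>2 \<le> - (- pi * x\<^sup>2 * Im \<tau>)" using 1 by (simp add: mult_ac)
    have le2: "- (2 * pi * x * Im z) \<le> 2 * pi * (\<bar>x\<bar> * R)" using 2 by (simp add: mult_ac)
    show "exp (- pi * x\<^sup>2 * Im \<tau> - 2 * pi * x * Im z) \<le> exp ((2 * pi * R + 2)\<^sup>2 / (4 * pi * \<delta>) - 2 * \<bar>x\<bar>)"
      unfolding exp_le_cancel_iff B_def[symmetric] using le1 le2 3 4 by linarith
  qed auto
  also have "\<dots> = fact k * exp ((2 * pi * R + 2)\<^sup>2 / (4 * pi * \<delta>)) * exp (- \<bar>x\<bar>)"
    by (simp add: mult.assoc flip: exp_add)
  also have "exp (- \<bar>x\<bar>) \<le> exp \<bar>a\<bar> * exp (- real_of_int \<bar>n\<bar>)"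
    unfolding x_def exp_add[symmetric] by simp
  finally show ?thesis
    unfolding theta_bound_def x_def by (simp add: mult_left_mono mult.assoc)
qed

lemma theta_term_abs_summable:
  assumes "Im \<tau> > 0"
  shows "(\<lambda>n::int. norm (theta_term k \<tau> z (of_int n + a))) summable_on UNIV"
  using norm_theta_term_le[OF assms order.refl order.refl]
  by (intro Infinite_Sum.abs_summable_on_comparison_test'[OF theta_bound_summable])

lemma theta_mom_deriv_z:
  assumes "Im \<tau> > 0"
  shows "(theta_mom a k \<tau> has_field_derivative 2 * of_real pi * \<i> * theta_mom a (Suc k) \<tau> z) (at z)"
proof -
  have "((\<lambda>w. \<Sum>\<^sub>\<infinity>n\<in>UNIV. theta_term k \<tau> w (of_int n + a)) has_field_derivative
      (\<Sum>\<^sub>\<infinity>n\<in>UNIV. 2 * of_real pi * \<i> * theta_term (Suc k) \<tau> z (of_int n + a))) (at z)"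
  proof (rule has_field_derivative_infsum[where r = 1 and M = "theta_bound k (Im \<tau>) (\<bar>Im z\<bar> + 1) a"])
    fix n w assume "w \<in> cball z 1"
    then have "\<bar>Im z - Im w\<bar> \<le> 1"
      using abs_Im_le_cmod[of "z - w"] by (simp add: dist_norm)
    then have "\<bar>Im w\<bar> \<le> \<bar>Im z\<bar> + 1" by linarith
    then show "norm (theta_term k \<tau> w (of_int n + a)) \<le> theta_bound k (Im \<tau>) (\<bar>Im z\<bar> + 1) a n"
      using assms by (intro norm_theta_term_le) auto
  qed (auto simp: theta_term_def theta_bound_summable intro!: derivative_eq_intros)
  then show ?thesis
    by (simp add: theta_mom_def[abs_def] infsum_cmult_right')
qed

lemma theta_mom_deriv_tau:
  assumes "Im \<tau> > 0"
  shows "((\<lambda>t. theta_mom a k t z) has_field_derivative of_real pi * \<i> * theta_mom a (k + 2) \<tau> z) (at \<tau>)"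
proof -
  have "((\<lambda>t. \<Sum>\<^sub>\<infinity>n\<in>UNIV. theta_term k t z (of_int n + a)) has_field_derivative
      (\<Sum>\<^sub>\<infinity>n\<in>UNIV. of_real pi * \<i> * theta_term (k + 2) \<tau> z (of_int n + a))) (at \<tau>)"
  proof (rule has_field_derivative_infsum[where r = "Im \<tau> / 2" and M = "theta_bound k (Im \<tau> / 2) \<bar>Im z\<bar> a"])
    fix n w assume "w \<in> cball \<tau> (Im \<tau> / 2)"
    then have "\<bar>Im \<tau> - Im w\<bar> \<le> Im \<tau> / 2"
      using abs_Im_le_cmod[of "\<tau> - w"] by (simp add: dist_norm)
    then have "Im w \<ge> Im \<tau> / 2" by linarith
    then show "norm (theta_term k w z (of_int n + a)) \<le> theta_bound k (Im \<tau> / 2) \<bar>Im z\<bar> a n"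
      using assms by (intro norm_theta_term_le) auto
  qed (auto simp: theta_term_def theta_bound_summable assms power2_eq_square intro!: derivative_eq_intros)
  then show ?thesis
    by (simp add: theta_mom_def[abs_def] infsum_cmult_right')
qed

section \<open>Products of theta series\<close>

lemma infsum_times_infsum:
  fixes f g :: "int \<Rightarrow> complex"
  assumes "(\<lambda>n. norm (f n)) summable_on UNIV" "(\<lambda>n. norm (g n)) summable_on UNIV"
  shows "((\<lambda>(m, n). f m * g n) has_sum (\<Sum>\<^sub>\<infinity>m. f m) * (\<Sum>\<^sub>\<infinity>n. g n)) UNIV"
    and "(\<lambda>(m, n). norm (f m * g n)) summable_on UNIV"
proof -
  have "(\<lambda>p. norm (case p of (m, n) \<Rightarrow> f m * g n)) summable_on UNIV \<times> UNIV"
    by (subst Infinite_Sum.abs_summable_on_Sigma_iff)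
      (auto simp: norm_mult infsum_cmult_right' abs_mult intro!: summable_on_cmult_right assms
        summable_on_cmult_left)
  then show n: "(\<lambda>(m, n). norm (f m * g n)) summable_on UNIV"
    by (simp add: case_prod_unfold)
  then have s: "(\<lambda>(m, n). f m * g n) summable_on UNIV \<times> UNIV"
    using abs_summable_summable[of "\<lambda>(m, n). f m * g n" UNIV] by (simp add: case_prod_unfold)
  have "(\<Sum>\<^sub>\<infinity>m. f m) * (\<Sum>\<^sub>\<infinity>n. g n) = (\<Sum>\<^sub>\<infinity>m. \<Sum>\<^sub>\<infinity>n. f m * g n)"
    by (simp add: infsum_cmult_right' infsum_cmult_left')
  also have "\<dots> = (\<Sum>\<^sub>\<infinity>(m, n)\<in>UNIV \<times> UNIV. f m * g n)"
    by (rule infsum_Sigma'_banach[OF s])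
  finally show "((\<lambda>(m, n). f m * g n) has_sum (\<Sum>\<^sub>\<infinity>m. f m) * (\<Sum>\<^sub>\<infinity>n. g n)) UNIV"
    using has_sum_infsum[OF s] by simp
qed

text \<open>Pairs with even sum form the index-two sublattice of all \<open>(k + l, k - l)\<close>; its other coset is
  reached by adding \<open>(1, 0)\<close>.\<close>

lemma infsum_int_pair_parity:
  fixes f :: "int \<times> int \<Rightarrow> complex"
  assumes "f summable_on UNIV"
  shows "(\<Sum>\<^sub>\<infinity>p. f p) = (\<Sum>\<^sub>\<infinity>(k, l)\<in>UNIV. f (k + l, k - l)) + (\<Sum>\<^sub>\<infinity>(k, l)\<in>UNIV. f (k + l + 1, k - l))"
proof -
  let ?E = "{(i, j :: int). even (i + j)}" and ?O = "{(i, j :: int). odd (i + j)}"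
  have U: "UNIV = ?E \<union> ?O" "?E \<inter> ?O = {}" by auto
  have s: "f summable_on ?E" "f summable_on ?O"
    using assms summable_on_subset_banach by blast+
  have "(\<Sum>\<^sub>\<infinity>p. f p) = (\<Sum>\<^sub>\<infinity>p\<in>?E. f p) + (\<Sum>\<^sub>\<infinity>p\<in>?O. f p)"
    using infsum_Un_disjoint[OF s U(2)] U(1) by simp
  moreover have "(\<Sum>\<^sub>\<infinity>(k, l)\<in>UNIV. f (k + l, k - l)) = (\<Sum>\<^sub>\<infinity>p\<in>?E. f p)"
    by (rule infsum_reindex_bij_witness[where j = "\<lambda>(k, l). (k + l, k - l)"
          and i = "\<lambda>(i, j). ((i + j) div 2, (i + j) div 2 - j)"]) (auto elim!: evenE, presburger+)
  moreover have "(\<Sum>\<^sub>\<infinity>(k, l)\<in>UNIV. f (k + l + 1, k - l)) = (\<Sum>\<^sub>\<infinity>p\<in>?O. f p)"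
    by (rule infsum_reindex_bij_witness[where j = "\<lambda>(k, l). (k + l + 1, k - l)"
          and i = "\<lambda>(i, j). ((i + j - 1) div 2, (i + j - 1) div 2 - j)"]) (auto elim!: oddE, presburger+)
  ultimately show ?thesis by simp
qed

text \<open>Half-sum and half-difference run over the same coset of \<open>\<int>\<close> shifted by \<open>(a + b)/2\<close> and \<open>(a - b)/2\<close>, or both
  over the coset shifted by a further \<open>1/2\<close>; within each case they are independent, so the double sum
  splits.\<close>

lemma infsum_half_sum_half_difference:
  fixes F :: "real \<Rightarrow> real \<Rightarrow> complex" and G H :: "real \<Rightarrow> complex"
  assumes F: "(\<lambda>(m, n). F (of_int m + a) (of_int n + b)) summable_on (UNIV :: (int \<times> int) set)"
    and G: "\<And>c. (\<lambda>n::int. norm (G (of_int n + c))) summable_on UNIV"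
    and H: "\<And>c. (\<lambda>n::int. norm (H (of_int n + c))) summable_on UNIV"
    and FGH: "\<And>x y. F x y = G ((x + y) / 2) * H ((x - y) / 2)"
  shows "(\<Sum>\<^sub>\<infinity>(m, n)\<in>(UNIV :: (int \<times> int) set). F (of_int m + a) (of_int n + b)) =
      (\<Sum>\<^sub>\<infinity>n\<in>(UNIV :: int set). G (of_int n + (a + b) / 2)) * (\<Sum>\<^sub>\<infinity>n\<in>(UNIV :: int set). H (of_int n + (a - b) / 2)) +
      (\<Sum>\<^sub>\<infinity>n\<in>(UNIV :: int set). G (of_int n + (a + b + 1) / 2)) * (\<Sum>\<^sub>\<infinity>n\<in>(UNIV :: int set). H (of_int n + (a - b + 1) / 2))"
proof -
  have 1: "F (of_int (k + l) + a) (of_int (k - l) + b) =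
      G (of_int k + (a + b) / 2) * H (of_int l + (a - b) / 2)" for k l
    unfolding FGH by (rule arg_cong2[where f = "(*)"]; rule arg_cong[where f = G] arg_cong[where f = H];
        simp add: field_simps)
  have 2: "F (of_int (k + l + 1) + a) (of_int (k - l) + b) =
      G (of_int k + (a + b + 1) / 2) * H (of_int l + (a - b + 1) / 2)" for k l
    unfolding FGH by (rule arg_cong2[where f = "(*)"]; rule arg_cong[where f = G] arg_cong[where f = H];
        simp add: field_simps)
  show ?thesis
    unfolding infsum_int_pair_parity[OF F] split 1 2
    using infsumI[OF infsum_times_infsum(1)[OF G H]] by simp
qed

lemma theta_mom_infsum_pair:
  assumes "Im \<tau> > 0"
  shows "((\<lambda>(m, n). theta_term k \<tau> z (of_int m + a) * theta_term l \<tau> w (of_int n + b))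
     has_sum theta_mom a k \<tau> z * theta_mom b l \<tau> w) UNIV"
  unfolding theta_mom_def by (intro infsum_times_infsum theta_term_abs_summable assms)

text \<open>The quadratic form is rotated, \<open>x\<^sup>2 + y\<^sup>2 = 2 ((x + y)/2)\<^sup>2 + 2 ((x - y)/2)\<^sup>2\<close>, which turns the parameter
  \<open>\<tau>\<close> into \<open>2 \<tau>\<close>. All duplication formulas are instances.\<close>

lemma theta_mom_product:
  assumes "Im \<tau> > 0"
  shows "theta_mom a 0 \<tau> (z + w) * theta_mom b 0 \<tau> (z - w) =
    theta_mom ((a + b) / 2) 0 (2 * \<tau>) (2 * z) * theta_mom ((a - b) / 2) 0 (2 * \<tau>) (2 * w) +
    theta_mom ((a + b + 1) / 2) 0 (2 * \<tau>) (2 * z) * theta_mom ((a - b + 1) / 2) 0 (2 * \<tau>) (2 * w)"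
proof -
  note hs = theta_mom_infsum_pair[OF assms, of 0 "z + w" a 0 "z - w" b]
  have e: "theta_term 0 \<tau> (z + w) x * theta_term 0 \<tau> (z - w) y =
      theta_term 0 (2 * \<tau>) (2 * z) ((x + y) / 2) * theta_term 0 (2 * \<tau>) (2 * w) ((x - y) / 2)" for x y
    unfolding theta_term_def power_0 mult_1 e2pi_add[symmetric]
    by (rule arg_cong[where f = e2pi]) (simp add: field_simps power2_eq_square)
  show ?thesis
    unfolding infsumI[OF hs, symmetric] theta_mom_def[of _ _ "2 * \<tau>"]
    using assms has_sum_imp_summable[OF hs]
    by (intro infsum_half_sum_half_difference theta_term_abs_summable e) auto
qed

text \<open>The weight \<open>x\<^sup>2 - y\<^sup>2 = 4 ((x + y)/2) ((x - y)/2)\<close> of the left-hand side factorises along the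
  same rotation.\<close>

lemma theta_mom_wronskian_product:
  assumes "Im \<tau> > 0"
  shows "theta_mom a 2 \<tau> (z + w) * theta_mom b 0 \<tau> (z - w) - theta_mom a 0 \<tau> (z + w) * theta_mom b 2 \<tau> (z - w) =
    4 * (theta_mom ((a + b) / 2) 1 (2 * \<tau>) (2 * z) * theta_mom ((a - b) / 2) 1 (2 * \<tau>) (2 * w) +
    theta_mom ((a + b + 1) / 2) 1 (2 * \<tau>) (2 * z) * theta_mom ((a - b + 1) / 2) 1 (2 * \<tau>) (2 * w))"
proof -
  define F where "F = (\<lambda>x y. theta_term 2 \<tau> (z + w) x * theta_term 0 \<tau> (z - w) y -
      theta_term 0 \<tau> (z + w) x * theta_term 2 \<tau> (z - w) y)"
  let ?G = "\<lambda>z x. 2 * theta_term 1 (2 * \<tau>) (2 * z) x"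
  have hs: "((\<lambda>(m, n). F (of_int m + a) (of_int n + b)) has_sum
    (theta_mom a 2 \<tau> (z + w) * theta_mom b 0 \<tau> (z - w) - theta_mom a 0 \<tau> (z + w) * theta_mom b 2 \<tau> (z - w))) UNIV"
    using has_sum_add[OF theta_mom_infsum_pair[OF assms, of 2 "z + w" a 0 "z - w" b]
        has_sum_uminusI[OF theta_mom_infsum_pair[OF assms, of 0 "z + w" a 2 "z - w" b]]]
    by (simp add: F_def case_prod_unfold)
  have e: "F x y = ?G z ((x + y) / 2) * ?G w ((x - y) / 2)" for x y
  proof -
    have "e2pi (of_real (x\<^sup>2) / 2 * \<tau> + of_real x * (z + w)) * e2pi (of_real (y\<^sup>2) / 2 * \<tau> + of_real y * (z - w)) =
      e2pi (of_real (((x + y) / 2)\<^sup>2) / 2 * (2 * \<tau>) + of_real ((x + y) / 2) * (2 * z)) *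
      e2pi (of_real (((x - y) / 2)\<^sup>2) / 2 * (2 * \<tau>) + of_real ((x - y) / 2) * (2 * w))" (is "?A * ?B = ?C * ?D")
      unfolding e2pi_add[symmetric]
      by (rule arg_cong[where f = e2pi]) (simp add: field_simps power2_eq_square)
    moreover have "F x y = of_real (x\<^sup>2 - y\<^sup>2) * (?A * ?B)"
      by (simp add: F_def theta_term_def algebra_simps)
    moreover have "?G z ((x + y) / 2) * ?G w ((x - y) / 2) =
        (2 * of_real ((x + y) / 2) * (2 * of_real ((x - y) / 2))) * (?C * ?D)"
      by (simp only: theta_term_def power_one_right mult_ac)
    moreover have "2 * of_real ((x + y) / 2) * (2 * of_real ((x - y) / 2)) = (of_real (x\<^sup>2 - y\<^sup>2) :: complex)"
      by (simp add: field_simps power2_eq_square)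
    ultimately show ?thesis by (simp only:)
  qed
  have "(\<Sum>\<^sub>\<infinity>(m, n)\<in>(UNIV :: (int \<times> int) set). F (of_int m + a) (of_int n + b)) =
      (\<Sum>\<^sub>\<infinity>n\<in>(UNIV :: int set). ?G z (of_int n + (a + b) / 2)) * (\<Sum>\<^sub>\<infinity>n\<in>(UNIV :: int set). ?G w (of_int n + (a - b) / 2)) +
      (\<Sum>\<^sub>\<infinity>n\<in>(UNIV :: int set). ?G z (of_int n + (a + b + 1) / 2)) * (\<Sum>\<^sub>\<infinity>n\<in>(UNIV :: int set). ?G w (of_int n + (a - b + 1) / 2))"
    using assms has_sum_imp_summable[OF hs]
    by (intro infsum_half_sum_half_difference e)
      (auto simp: norm_mult intro!: summable_on_cmult_right theta_term_abs_summable)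
  then show ?thesis
    unfolding infsumI[OF hs] infsum_cmult_right' theta_mom_def[symmetric] by simp
qed

lemma theta_mom_plus1_char: "theta_mom (a + 1) k \<tau> z = theta_mom a k \<tau> z"
  unfolding theta_mom_def
  by (rule infsum_reindex_bij_witness[where j = "\<lambda>n. n + 1" and i = "\<lambda>n. n - 1"]) (auto simp: add_ac)

lemma theta_mom_minus: "theta_mom a k \<tau> (- z) = (- 1) ^ k * theta_mom (- a) k \<tau> z"
proof -
  have "theta_mom a k \<tau> (- z) = (\<Sum>\<^sub>\<infinity>n\<in>(UNIV :: int set). (- 1) ^ k * theta_term k \<tau> z (of_int n - a))"
    unfolding theta_mom_def
  proof (rule infsum_reindex_bij_witness[where j = "\<lambda>n. - n" and i = "\<lambda>n. - n"])
    fix n :: int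
    have "of_int (- n) - a = - (of_int n + a)" by simp
    then show "(- 1) ^ k * theta_term k \<tau> z (of_int (- n) - a) = theta_term k \<tau> (- z) (of_int n + a)"
      by (simp only: theta_term_def of_real_minus power2_minus minus_mult_minus mult.assoc[symmetric]
          power_mult_distrib[symmetric] mult_minus1 minus_minus mult_minus_left mult_minus_right mult_1)
  qed auto
  then show ?thesis by (simp add: infsum_cmult_right' theta_mom_def)
qed

lemma theta_mom_plus1: "theta_mom a k \<tau> (z + 1) = e2pi (of_real a) * theta_mom a k \<tau> z"
proof -
  have "theta_term k \<tau> (z + 1) (of_int n + a) = e2pi (of_real a) * theta_term k \<tau> z (of_int n + a)" for n
  proof -
    have "e2pi (of_real ((of_int n + a)\<^sup>2) / 2 * \<tau> + of_real (of_int n + a) * (z + 1)) =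
      e2pi (of_real ((of_int n + a)\<^sup>2) / 2 * \<tau> + of_real (of_int n + a) * z) * e2pi (of_int n) * e2pi (of_real a)"
      unfolding e2pi_add[symmetric] by (rule arg_cong[where f = e2pi]) (simp add: algebra_simps)
    then show ?thesis by (simp add: theta_term_def)
  qed
  then show ?thesis by (simp add: theta_mom_def infsum_cmult_right')
qed

section \<open>The four theta functions and duplication\<close>

definition theta2 :: "complex \<Rightarrow> complex \<Rightarrow> complex" where
  "theta2 \<tau> z = theta_mom (1 / 2) 0 \<tau> z"

definition theta3 :: "complex \<Rightarrow> complex \<Rightarrow> complex" where
  "theta3 \<tau> z = theta_mom 0 0 \<tau> z"

definition theta4 :: "complex \<Rightarrow> complex \<Rightarrow> complex" where
  "theta4 \<tau> z = theta_mom 0 0 \<tau> (z + 1 / 2)"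

lemma theta_term_half_shift:
  "theta_term k \<tau> (z + 1 / 2) x = e2pi (of_real x / 2) * theta_term k \<tau> z x"
proof -
  have "e2pi (of_real (x\<^sup>2) / 2 * \<tau> + of_real x * (z + 1 / 2)) =
    e2pi (of_real (x\<^sup>2) / 2 * \<tau> + of_real x * z) * e2pi (of_real x / 2)"
    unfolding e2pi_add[symmetric] by (rule arg_cong[where f = e2pi]) (simp add: algebra_simps)
  then show ?thesis by (simp add: theta_term_def)
qed

lemma i_times_i_times: "\<i> * (\<i> * x) = - x"
  by (simp flip: mult.assoc)

text \<open>Shifting \<open>z\<close> by \<open>1/2\<close> multiplies the term of index \<open>n + 1/2\<close> by \<open>exp (\<pi> \<i> (n + 1/2)) = (-1)\<^sup>n \<i>\<close>.\<close>

lemma jtheta_eq_theta_mom: "jtheta \<tau> z = - \<i> * theta_mom (1 / 2) 0 \<tau> (z + 1 / 2)"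
proof -
  have "- \<i> * theta_term 0 \<tau> (z + 1 / 2) (of_int n + 1 / 2) =
     e2pi (\<tau> / 8) * ((- 1) powi n * e2pi (of_int (n * (n + 1)) / 2 * \<tau>) * e2pi ((of_int n + 1 / 2) * z))" for n
  proof -
    have 1: "e2pi (of_real (of_int n + 1 / 2) / 2) = (- 1) powi n * \<i>"
    proof -
      have "e2pi (of_real (of_int n + 1 / 2) / 2) = e2pi (of_int n / 2) * e2pi (1 / 4)"
        unfolding e2pi_add[symmetric] by (rule arg_cong[where f = e2pi]) (simp add: field_simps)
      then show ?thesis by (simp only: e2pi_half_int e2pi_quarter)
    qed
    have 2: "theta_term 0 \<tau> z (of_int n + 1 / 2) =
       e2pi (\<tau> / 8) * (e2pi (of_int (n * (n + 1)) / 2 * \<tau>) * e2pi ((of_int n + 1 / 2) * z))"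
      unfolding theta_term_def power_0 mult_1 e2pi_add[symmetric]
      by (rule arg_cong[where f = e2pi]) (simp add: field_simps power2_eq_square)
    show ?thesis unfolding theta_term_half_shift 1 2 by (simp add: mult_ac i_times_i_times)
  qed
  then show ?thesis
    unfolding jtheta_def theta_mom_def infsum_cmult_right'[symmetric] by simp
qed

lemma theta_mom_0_minus: "theta_mom 0 k \<tau> (- z) = (- 1) ^ k * theta_mom 0 k \<tau> z"
  using theta_mom_minus[of 0 k \<tau> z] by simp

lemma theta_mom_half_minus: "theta_mom (1 / 2) k \<tau> (- z) = (- 1) ^ k * theta_mom (1 / 2) k \<tau> z"
  using theta_mom_minus[of "1 / 2" k \<tau> z] theta_mom_plus1_char[of "- 1 / 2" k \<tau> z] by simp

lemma theta_mom_0_half: "theta_mom 0 k \<tau> (- (1 / 2)) = theta_mom 0 k \<tau> (1 / 2)"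
  using theta_mom_plus1[of 0 k \<tau> "- (1 / 2)"] by simp

lemma theta_mom_half_half: "theta_mom (1 / 2) k \<tau> (1 / 2) = - theta_mom (1 / 2) k \<tau> (- (1 / 2))"
  using theta_mom_plus1[of "1 / 2" k \<tau> "- (1 / 2)"] by simp

lemma jtheta_0 [simp]: "jtheta \<tau> 0 = 0"
proof -
  have "theta_mom (1 / 2) 0 \<tau> (1 / 2) = 0"
    using theta_mom_half_half[of 0 \<tau>] theta_mom_half_minus[of 0 \<tau> "1 / 2"] by simp
  then show ?thesis by (simp add: jtheta_eq_theta_mom)
qed

text \<open>The Taylor coefficients of \<open>\<theta>\<^sub>1\<close> at \<open>0\<close> in the variable \<open>2 \<pi> \<i> z\<close>, up to factorials; the one with \<open>k = 1\<close>
  is written \<open>\<theta>\<^sub>1'\<close> in the comments.\<close>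

definition jtheta_mom :: "nat \<Rightarrow> complex \<Rightarrow> complex" where
  "jtheta_mom k \<tau> = - \<i> * theta_mom (1 / 2) k \<tau> (1 / 2)"

lemma theta_mom_0_odd: "odd k \<Longrightarrow> theta_mom 0 k \<tau> 0 = 0"
  using theta_mom_0_minus[of k \<tau> 0] by simp

lemma theta_mom_half_odd: "odd k \<Longrightarrow> theta_mom (1 / 2) k \<tau> 0 = 0"
  using theta_mom_half_minus[of k \<tau> 0] by simp

lemma theta_mom_0_half_odd: "odd k \<Longrightarrow> theta_mom 0 k \<tau> (1 / 2) = 0"
  using theta_mom_0_minus[of k \<tau> "1 / 2"] theta_mom_0_half[of k \<tau>] by simp

lemma jtheta_mom_even: "even k \<Longrightarrow> jtheta_mom k \<tau> = 0"
  using theta_mom_half_half[of k \<tau>] theta_mom_half_minus[of k \<tau> "1 / 2"] by (simp add: jtheta_mom_def)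

context
  fixes \<tau> :: complex
  assumes \<tau>: "Im \<tau> > 0"
begin

lemma theta3_theta4_product:
  "theta3 \<tau> (z + w) * theta4 \<tau> (z - w) =
    theta4 (2 * \<tau>) (2 * z) * theta4 (2 * \<tau>) (2 * w) + jtheta (2 * \<tau>) (2 * z) * jtheta (2 * \<tau>) (2 * w)"
proof -
  have m: "theta_mom (1 / 2) 0 (2 * \<tau>) (2 * w - 1 / 2) = - theta_mom (1 / 2) 0 (2 * \<tau>) (2 * w + 1 / 2)"
    "theta_mom 0 0 (2 * \<tau>) (2 * w - 1 / 2) = theta_mom 0 0 (2 * \<tau>) (2 * w + 1 / 2)"
    using theta_mom_plus1[of "1 / 2" 0 "2 * \<tau>" "2 * w - 1 / 2"] theta_mom_plus1[of 0 0 "2 * \<tau>" "2 * w - 1 / 2"]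
    by (simp_all add: algebra_simps)
  \<comment> \<open>A quarter shift of opposite sign in \<open>z\<close> and \<open>w\<close> leaves \<open>z + w\<close> fixed and adds \<open>1/2\<close> to \<open>z - w\<close>.\<close>
  have "theta_mom 0 0 \<tau> ((z + 1/4) + (w - 1/4)) * theta_mom 0 0 \<tau> ((z + 1/4) - (w - 1/4)) =
    theta_mom ((0 + 0) / 2) 0 (2 * \<tau>) (2 * (z + 1/4)) * theta_mom ((0 - 0) / 2) 0 (2 * \<tau>) (2 * (w - 1/4)) +
    theta_mom ((0 + 0 + 1) / 2) 0 (2 * \<tau>) (2 * (z + 1/4)) * theta_mom ((0 - 0 + 1) / 2) 0 (2 * \<tau>) (2 * (w - 1/4))"
    by (rule theta_mom_product[OF \<tau>])
  moreover have "(z + 1/4) + (w - 1/4) = z + w" "(z + 1/4) - (w - 1/4) = z - w + 1 / 2"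
    "2 * (z + 1/4) = 2 * z + 1 / 2" "2 * (w - 1/4) = 2 * w - 1 / 2" by simp_all
  ultimately show ?thesis
    by (simp add: theta3_def theta4_def jtheta_eq_theta_mom m, simp add: mult_ac i_times_i_times)
qed

lemma jtheta_theta2_product:
  "jtheta \<tau> (z + w) * theta2 \<tau> (z - w) =
    jtheta (2 * \<tau>) (2 * z) * theta4 (2 * \<tau>) (2 * w) + theta4 (2 * \<tau>) (2 * z) * jtheta (2 * \<tau>) (2 * w)"
proof -
  \<comment> \<open>A common quarter shift adds \<open>1/2\<close> to \<open>z + w\<close> and leaves \<open>z - w\<close> fixed.\<close>
  have "theta_mom (1/2) 0 \<tau> ((z + 1/4) + (w + 1/4)) * theta_mom (1/2) 0 \<tau> ((z + 1/4) - (w + 1/4)) =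
    theta_mom ((1/2 + 1/2) / 2) 0 (2 * \<tau>) (2 * (z + 1/4)) * theta_mom ((1/2 - 1/2) / 2) 0 (2 * \<tau>) (2 * (w + 1/4)) +
    theta_mom ((1/2 + 1/2 + 1) / 2) 0 (2 * \<tau>) (2 * (z + 1/4)) * theta_mom ((1/2 - 1/2 + 1) / 2) 0 (2 * \<tau>) (2 * (w + 1/4))"
    by (rule theta_mom_product[OF \<tau>])
  moreover have "(z + 1/4) + (w + 1/4) = z + w + 1/2" "(z + 1/4) - (w + 1/4) = z - w"
    "2 * (z + 1/4) = 2 * z + 1 / 2" "2 * (w + 1/4) = 2 * w + 1 / 2" by simp_all
  ultimately show ?thesis
    using theta_mom_plus1_char[of 0 0 "2 * \<tau>" "2 * z + 1/2"]
    by (simp add: theta2_def theta4_def jtheta_eq_theta_mom algebra_simps)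
qed

lemma jtheta_theta2_double: "jtheta \<tau> z * theta2 \<tau> z = jtheta (2 * \<tau>) (2 * z) * theta4 (2 * \<tau>) 0"
  using jtheta_theta2_product[of z 0] by simp

lemma jtheta_theta4_double: "jtheta \<tau> (2 * z) * theta2 \<tau> 0 = 2 * jtheta (2 * \<tau>) (2 * z) * theta4 (2 * \<tau>) (2 * z)"
  using jtheta_theta2_product[of z z] by simp

lemma theta3_theta4_double: "theta3 \<tau> z * theta4 \<tau> z = theta4 (2 * \<tau>) (2 * z) * theta4 (2 * \<tau>) 0"
  using theta3_theta4_product[of z 0] by simp

lemma theta3_null_sq: "(theta3 \<tau> 0)\<^sup>2 = (theta3 (2 * \<tau>) 0)\<^sup>2 + (theta2 (2 * \<tau>) 0)\<^sup>2"
  using theta_mom_product[OF \<tau>, of 0 0 0 0] by (simp add: theta3_def theta2_def power2_eq_square)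

lemma theta4_null_sq: "(theta4 \<tau> 0)\<^sup>2 = (theta3 (2 * \<tau>) 0)\<^sup>2 - (theta2 (2 * \<tau>) 0)\<^sup>2"
  using theta_mom_product[OF \<tau>, of 0 "1 / 2" 0 0] theta_mom_plus1[of 0 0 "2 * \<tau>" 0]
     theta_mom_plus1[of "1 / 2" 0 "2 * \<tau>" 0]
  by (simp add: theta3_def theta2_def theta4_def power2_eq_square)

lemma theta2_null_sq: "(theta2 \<tau> 0)\<^sup>2 = 2 * theta2 (2 * \<tau>) 0 * theta3 (2 * \<tau>) 0"
  using theta_mom_product[OF \<tau>, of "1 / 2" 0 0 "1 / 2"] theta_mom_plus1_char[of 0 0 "2 * \<tau>" 0]
  by (simp add: theta3_def theta2_def power2_eq_square)

text \<open>Both \<open>\<theta>\<^sub>3\<^sup>4 - \<theta>\<^sub>4\<^sup>4\<close> and \<open>\<theta>\<^sub>2\<^sup>4\<close> equal \<open>4 \<theta>\<^sub>2\<^sup>2 \<theta>\<^sub>3\<^sup>2\<close> taken at \<open>2 \<tau>\<close>.\<close>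

lemma theta_null_quartic: "theta3 \<tau> 0 ^ 4 = theta2 \<tau> 0 ^ 4 + theta4 \<tau> 0 ^ 4"
proof -
  have p: "x ^ 4 = (x\<^sup>2)\<^sup>2" for x :: complex by simp
  show ?thesis unfolding p theta3_null_sq theta4_null_sq theta2_null_sq
    by (simp add: power2_eq_square algebra_simps)
qed

text \<open>By the heat equation the left-hand side is \<open>2 \<theta>\<^sub>3 \<theta>\<^sub>4 D log (\<theta>\<^sub>3/\<theta>\<^sub>4)\<close>, so this evaluates one
  logarithmic derivative in \<open>\<tau>\<close>.\<close>

lemma theta34_wronskian:
  "theta_mom 0 2 \<tau> 0 * theta4 \<tau> 0 - theta3 \<tau> 0 * theta_mom 0 2 \<tau> (1 / 2) = 4 * (jtheta_mom 1 (2 * \<tau>))\<^sup>2"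
proof -
  have "theta_mom 0 1 (2 * \<tau>) (1 / 2) = 0" by (rule theta_mom_0_half_odd) simp
  then show ?thesis
    using theta_mom_wronskian_product[OF \<tau>, of 0 "1 / 4" "- (1 / 4)" 0] theta_mom_half_half[of 1 "2 * \<tau>"]
    by (simp add: theta3_def theta4_def jtheta_mom_def power2_eq_square)
qed

text \<open>Three duplications combined: \<open>\<theta>\<^sub>1 \<theta>\<^sub>2\<close> and \<open>\<theta>\<^sub>3 \<theta>\<^sub>4\<close> are \<open>\<theta>\<^sub>1\<close> and \<open>\<theta>\<^sub>4\<close> at \<open>(2 \<tau>, 2 z)\<close> up to constants, and the
  product of those two is \<open>\<theta>\<^sub>1\<close> at \<open>(\<tau>, 2 z)\<close> up to a constant.\<close>

lemma jtheta_quadruple: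
  "jtheta \<tau> (2 * z) * theta2 \<tau> 0 * theta3 \<tau> 0 * theta4 \<tau> 0 =
     2 * jtheta \<tau> z * theta2 \<tau> z * theta3 \<tau> z * theta4 \<tau> z"
proof -
  have "jtheta \<tau> (2 * z) * theta2 \<tau> 0 * (theta3 \<tau> 0 * theta4 \<tau> 0) =
     2 * (jtheta (2 * \<tau>) (2 * z) * theta4 (2 * \<tau>) 0) * (theta4 (2 * \<tau>) (2 * z) * theta4 (2 * \<tau>) 0)"
    unfolding jtheta_theta4_double theta3_theta4_double by simp
  then show ?thesis
    unfolding jtheta_theta2_double[symmetric] theta3_theta4_double[symmetric] by (simp add: mult_ac)
qed

lemma theta_mom_deriv_z_chain:
  assumes "(f has_field_derivative f') (at z)"
  shows "((\<lambda>z. theta_mom a k \<tau> (f z)) has_field_derivative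
    (2 * of_real pi * \<i> * theta_mom a (Suc k) \<tau> (f z)) * f') (at z)"
  by (rule DERIV_chain2[OF theta_mom_deriv_z[OF \<tau>] assms])

end

lemma jtheta_has_deriv_0:
  assumes "Im \<tau> > 0"
  shows "(jtheta \<tau> has_field_derivative (2 * of_real pi * \<i> * jtheta_mom 1 \<tau>)) (at 0)"
  unfolding jtheta_eq_theta_mom[abs_def]
  by (rule derivative_eq_intros theta_mom_deriv_z_chain assms refl)+ (simp add: jtheta_mom_def mult_ac i_times_i_times)

text \<open>The duplication of \<open>\<theta>\<^sub>1 \<theta>\<^sub>2\<close>, differentiated at \<open>z = 0\<close>.\<close>

lemma jtheta_mom_double:
  assumes "Im \<tau> > 0"
  shows "jtheta_mom 1 \<tau> * theta2 \<tau> 0 = 2 * jtheta_mom 1 (2 * \<tau>) * theta4 (2 * \<tau>) 0"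
proof -
  have t2: "(theta2 \<tau> has_field_derivative (2 * of_real pi * \<i> * theta_mom (1/2) 1 \<tau> 0)) (at 0)"
    using theta_mom_deriv_z[OF assms, of "1/2" 0 0] by (simp add: theta2_def[abs_def])
  have "((\<lambda>z. jtheta \<tau> z * theta2 \<tau> z) has_field_derivative
      (2 * of_real pi * \<i> * jtheta_mom 1 \<tau> * theta2 \<tau> 0)) (at 0)"
    using DERIV_mult[OF jtheta_has_deriv_0[OF assms] t2] by (simp add: mult_ac)
  moreover have "((\<lambda>z. jtheta (2 * \<tau>) (2 * z) * theta4 (2 * \<tau>) 0) has_field_derivative
      (2 * of_real pi * \<i> * jtheta_mom 1 (2 * \<tau>) * 2 * theta4 (2 * \<tau>) 0)) (at 0)"
  proof -
    have "(jtheta (2 * \<tau>) has_field_derivative (2 * of_real pi * \<i> * jtheta_mom 1 (2 * \<tau>))) (at (2 * 0))"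
      using jtheta_has_deriv_0[of "2 * \<tau>"] assms by simp
    moreover have "((\<lambda>z::complex. 2 * z) has_field_derivative 2) (at 0)"
      by (auto intro!: derivative_eq_intros)
    ultimately show ?thesis
      by (rule DERIV_cmult_right[OF DERIV_chain2])
  qed
  ultimately have "2 * of_real pi * \<i> * jtheta_mom 1 \<tau> * theta2 \<tau> 0 =
      2 * of_real pi * \<i> * jtheta_mom 1 (2 * \<tau>) * 2 * theta4 (2 * \<tau>) 0"
    unfolding jtheta_theta2_double[OF assms] by (rule DERIV_unique)
  then show ?thesis by (simp add: mult_ac)
qed

section \<open>Behaviour at the cusp and the Jacobi triple product\<close>

text \<open>Tannery's theorem for unordered sums.\<close>

lemma tendsto_infsum_dominated:
  fixes f :: "nat \<Rightarrow> 'a \<Rightarrow> 'b :: banach"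
  assumes lim: "\<And>x. x \<in> X \<Longrightarrow> (\<lambda>N. f N x) \<longlonglongrightarrow> g x"
    and bound: "\<And>N x. x \<in> X \<Longrightarrow> norm (f N x) \<le> M x"
    and M: "M summable_on X"
  shows "(\<lambda>N. \<Sum>\<^sub>\<infinity>x\<in>X. f N x) \<longlonglongrightarrow> (\<Sum>\<^sub>\<infinity>x\<in>X. g x)"
proof -
  let ?F = "finite_subsets_at_top X"
  have ev: "eventually (\<lambda>A. finite A \<and> A \<subseteq> X) ?F"
    by (simp add: eventually_finite_subsets_at_top_weakI)
  have gb: "norm (g x) \<le> M x" if "x \<in> X" for x
    by (rule tendsto_upperbound[OF tendsto_norm[OF lim[OF that]]]) (use bound that in auto)
  have "g summable_on X"
    by (rule abs_summable_summable, rule Infinite_Sum.abs_summable_on_comparison_test'[OF M gb])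
  then have 1: "((\<lambda>A. \<Sum>x\<in>A. g x) \<longlongrightarrow> (\<Sum>\<^sub>\<infinity>x\<in>X. g x)) ?F"
    by (rule infsum_tendsto)
  have 2: "uniform_limit UNIV (\<lambda>A N. \<Sum>x\<in>A. f N x) (\<lambda>N. \<Sum>\<^sub>\<infinity>x\<in>X. f N x) ?F"
    by (rule Weierstrass_m_test_general[OF _ M]) (use bound in auto)
  have 3: "eventually (\<lambda>A. (\<lambda>N. \<Sum>x\<in>A. f N x) \<longlonglongrightarrow> (\<Sum>x\<in>A. g x)) ?F"
    using ev by eventually_elim (auto intro!: tendsto_sum lim)
  show ?thesis
    by (rule swap_uniform_limit'[OF 3 1 2]) auto
qed


text \<open>Along \<open>2\<^sup>N \<tau>\<close> each term is a fixed number of modulus at most \<open>1\<close>, raised to the power \<open>2\<^sup>N\<close>; only the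
  terms of the smallest exponent \<open>b\<close> survive, and the terms for \<open>N = 0\<close> dominate.\<close>

lemma theta_mom_cusp_limit:
  fixes a b :: real and z :: complex
  assumes \<tau>: "Im \<tau> > 0" and b: "\<And>n::int. b \<le> (of_int n + a)\<^sup>2 / 2"
  shows "(\<lambda>N. theta_mom a k (2 ^ N * \<tau>) z * e2pi (- of_real b * (2 ^ N * \<tau>)))
    \<longlonglongrightarrow> (\<Sum>\<^sub>\<infinity>n\<in>(UNIV :: int set). if (of_int n + a)\<^sup>2 / 2 = b then theta_term k 0 z (of_int n + a) else 0)"
proof -
  let ?f = "\<lambda>N n::int. theta_term k (2 ^ N * \<tau>) z (of_int n + a) * e2pi (- of_real b * (2 ^ N * \<tau>))"
  let ?e = "\<lambda>n::int. e2pi (of_real ((of_int n + a)\<^sup>2 / 2 - b) * \<tau>)"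
  have f: "?f N n = theta_term k 0 z (of_int n + a) * ?e n ^ (2 ^ N)" for N n
  proof -
    have "e2pi (of_real ((of_int n + a)\<^sup>2) / 2 * (2 ^ N * \<tau>) + of_real (of_int n + a) * z) * e2pi (- of_real b * (2 ^ N * \<tau>))
      = e2pi (of_real ((of_int n + a)\<^sup>2) / 2 * 0 + of_real (of_int n + a) * z) * ?e n ^ (2 ^ N)"
      unfolding e2pi_add[symmetric] e2pi_power by (rule arg_cong[where f = e2pi]) (simp add: algebra_simps)
    then show ?thesis by (simp add: theta_term_def mult.assoc)
  qed
  have e: "norm (?e n) \<le> 1" for n
    using b[of n] \<tau> by (simp add: norm_e2pi)
  have "(\<lambda>N. \<Sum>\<^sub>\<infinity>n. ?f N n) \<longlonglongrightarrow> (\<Sum>\<^sub>\<infinity>n\<in>(UNIV :: int set). if (of_int n + a)\<^sup>2 / 2 = b then theta_term k 0 z (of_int n + a) else 0)"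
  proof (rule tendsto_infsum_dominated[where M = "\<lambda>n. norm (?f 0 n)"])
    fix n :: int
    show "(\<lambda>N. ?f N n) \<longlonglongrightarrow> (if (of_int n + a)\<^sup>2 / 2 = b then theta_term k 0 z (of_int n + a) else 0)"
    proof (cases "(of_int n + a)\<^sup>2 / 2 = b")
      case True
      then have "?e n = 1" by simp
      then show ?thesis unfolding f using True by simp
    next
      case False
      then have "norm (?e n) < 1"
        using b[of n] \<tau> by (simp add: norm_e2pi)
      then have "(\<lambda>m. ?e n ^ m) \<longlonglongrightarrow> 0" by (rule LIMSEQ_power_zero)
      moreover have "filterlim (\<lambda>N::nat. 2 ^ N :: nat) at_top at_top"
        by (rule filterlim_at_top_mono[OF filterlim_ident]) (auto intro!: always_eventually less_imp_le less_exp)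
      ultimately have "(\<lambda>N. ?e n ^ (2 ^ N)) \<longlonglongrightarrow> 0"
        by (rule filterlim_compose)
      then show ?thesis unfolding f using False by (auto intro!: tendsto_mult_right_zero)
    qed
    show "norm (?f N n) \<le> norm (?f 0 n)" for N
    proof -
      have "norm (?e n) ^ (2 ^ N) \<le> norm (?e n) ^ 1"
        by (rule power_decreasing) (use e in auto)
      then show ?thesis unfolding f norm_mult norm_power by (intro mult_left_mono) auto
    qed
  next
    have "(\<lambda>n::int. norm (theta_term k \<tau> z (of_int n + a)) * norm (e2pi (- of_real b * \<tau>))) summable_on UNIV"
      by (intro summable_on_cmult_left theta_term_abs_summable \<tau>)
    then show "(\<lambda>n. norm (?f 0 n)) summable_on UNIV" by (simp add: norm_mult)
  qed
  then show ?thesis by (simp only: infsum_cmult_left' theta_mom_def)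
qed

lemma theta_mom_0_cusp_limit:
  assumes \<tau>: "Im \<tau> > 0"
  shows "(\<lambda>N. theta_mom 0 0 (2 ^ N * \<tau>) z) \<longlonglongrightarrow> 1"
proof -
  have "(\<Sum>\<^sub>\<infinity>n\<in>(UNIV :: int set). if (of_int n + 0)\<^sup>2 / 2 = (0::real) then theta_term 0 0 z (of_int n + 0) else 0) =
    (\<Sum>n\<in>{0::int}. theta_term 0 0 z (of_int n + 0))"
    by (rule infsumI, rule has_sum_finite_neutralI[where B = "{0}"]) auto
  also have "\<dots> = 1" by (simp add: theta_term_def)
  finally show ?thesis using theta_mom_cusp_limit[OF \<tau>, of 0 0 0 z] by simp
qed

lemma theta_mom_half_cusp_limit:
  assumes \<tau>: "Im \<tau> > 0"
  shows "(\<lambda>N. theta_mom (1 / 2) k (2 ^ N * \<tau>) z * e2pi (- (2 ^ N * \<tau>) / 8))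
     \<longlonglongrightarrow> theta_term k 0 z (1 / 2) + theta_term k 0 z (- (1 / 2))"
proof -
  have sq: "(of_int n + 1 / 2)\<^sup>2 / 2 = (of_int (n * (n + 1)) / 2 + 1 / 8 :: real)" for n
    by (simp add: field_simps power2_eq_square)
  have nn: "n * (n + 1) \<ge> 0" for n :: int
    by (cases "n \<ge> 0") (auto simp: mult_nonpos_nonpos)
  have le: "1 / 8 \<le> (of_int n + 1 / 2)\<^sup>2 / (2::real)" for n
  proof -
    have "(0::real) \<le> of_int (n * (n + 1))" using nn[of n] by (simp only: of_int_0_le_iff)
    then show ?thesis unfolding sq by simp
  qed
  have eq: "(of_int n + 1 / 2)\<^sup>2 / (2::real) = 1 / 8 \<longleftrightarrow> n \<in> {0, -1}" for n
  proof -
    have "(of_int n + 1 / 2)\<^sup>2 / (2::real) = 1 / 8 \<longleftrightarrow> of_int (n * (n + 1)) = (0::real)"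
      unfolding sq by simp
    also have "\<dots> \<longleftrightarrow> n * (n + 1) = 0" by (simp only: of_int_eq_0_iff)
    finally show ?thesis by auto
  qed
  have "(\<Sum>\<^sub>\<infinity>n\<in>(UNIV :: int set). if (of_int n + 1 / 2)\<^sup>2 / 2 = (1 / 8::real) then theta_term k 0 z (of_int n + 1 / 2) else 0) =
    (\<Sum>n\<in>{0::int, -1}. theta_term k 0 z (of_int n + 1 / 2))"
    unfolding eq by (rule infsumI, rule has_sum_finite_neutralI[where B = "{0, -1}"]) auto
  then show ?thesis using theta_mom_cusp_limit[OF \<tau> le, of k z] by simp
qed

definition qprod :: "complex \<Rightarrow> complex \<Rightarrow> complex" where
  "qprod \<tau> z = (\<Prod>n. 1 - e2pi z * e2pi \<tau> ^ Suc n)"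

lemma norm_e2pi_less_1: "Im \<tau> > 0 \<Longrightarrow> norm (e2pi \<tau>) < 1"
  by (simp add: norm_e2pi)

context
  fixes \<tau> :: complex
  assumes \<tau>: "Im \<tau> > 0"
begin

lemma qprod_convergent: "convergent_prod (\<lambda>n. 1 - e2pi z * e2pi \<tau> ^ Suc n)"
proof (rule abs_convergent_prod_imp_convergent_prod, rule summable_imp_abs_convergent_prod)
  have "summable (\<lambda>n. norm (e2pi z * e2pi \<tau>) * norm (e2pi \<tau>) ^ n)"
    using norm_e2pi_less_1[OF \<tau>] by (intro summable_mult summable_geometric) simp
  then show "summable (\<lambda>n. norm (1 - e2pi z * e2pi \<tau> ^ Suc n - 1))"
    by (simp add: norm_mult norm_power mult.assoc)
qed

lemma qprod_LIMSEQ: "(\<lambda>N. \<Prod>k<N. 1 - e2pi z * e2pi \<tau> ^ Suc k) \<longlonglongrightarrow> qprod \<tau> z"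
  unfolding qprod_def
  by (rule has_prod_imp_tendsto'[OF convergent_prod_has_prod[OF qprod_convergent]])

lemma one_minus_e2pi_power_nonzero: "1 - e2pi \<tau> ^ Suc n \<noteq> 0"
proof -
  have "norm (e2pi \<tau> ^ Suc n) < 1"
    unfolding norm_power using norm_e2pi_less_1[OF \<tau>] by (intro power_Suc_less_one) auto
  then show ?thesis by (auto simp del: power_Suc)
qed

lemma qprod_0_nonzero: "qprod \<tau> 0 \<noteq> 0"
proof -
  have "1 - e2pi 0 * e2pi \<tau> ^ Suc n \<noteq> 0" for n
    using one_minus_e2pi_power_nonzero[of n] by simp
  then show ?thesis unfolding qprod_def
    using prodinf_nonzero[OF qprod_convergent, of 0] by blast
qed

text \<open>The Pochhammer product \<open>(q; q)\<^sub>N\<close>.\<close>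

definition qfac :: "nat \<Rightarrow> complex" where "qfac N = (\<Prod>k<N. 1 - e2pi \<tau> ^ Suc k)"

text \<open>With the value \<open>0\<close> at negative arguments the recursion for \<open>1/(q; q)\<^sub>m\<close> holds at every integer, so that
  the finite triple product can be a sum over all of \<open>\<int>\<close> with no boundary terms.\<close>

definition rqfac :: "int \<Rightarrow> complex" where "rqfac m = (if m < 0 then 0 else 1 / qfac (nat m))"

lemma qfac_nonzero: "qfac N \<noteq> 0"
  using one_minus_e2pi_power_nonzero unfolding qfac_def by simp

lemma rqfac_rec: "rqfac (m - 1) = (1 - e2pi (of_int m * \<tau>)) * rqfac m"
proof (cases "m > 0")
  case True
  then obtain n where n: "m = int (Suc n)" by (metis gr0_implies_Suc pos_int_cases)
  then have "rqfac (m - 1) = 1 / qfac n" "rqfac m = 1 / (qfac n * (1 - e2pi \<tau> ^ Suc n))"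
    by (auto simp: rqfac_def qfac_def nat_add_distrib)
  moreover have "e2pi (of_int m * \<tau>) = e2pi \<tau> ^ Suc n"
    unfolding e2pi_power n by simp
  ultimately show ?thesis using qfac_nonzero[of n] qfac_nonzero[of "Suc n"] by (auto simp: qfac_def)
next
  case False
  then show ?thesis by (cases "m = 0") (auto simp: rqfac_def)
qed

text \<open>The Gaussian binomial coefficient of \<open>2 N\<close> over \<open>N + n\<close>.\<close>

definition jtp_coeff :: "nat \<Rightarrow> int \<Rightarrow> complex" where
  "jtp_coeff N n = qfac (2 * N) * rqfac (int N + n) * rqfac (int N - n)"

lemma jtp_coeff_rec:
  "jtp_coeff (Suc N) n = (1 + e2pi \<tau> ^ (2 * N + 1)) * jtp_coeff N n
    + e2pi \<tau> ^ (N + 1) * e2pi (- of_int n * \<tau>) * jtp_coeff N (n - 1)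
    + e2pi \<tau> ^ (N + 1) * e2pi (of_int n * \<tau>) * jtp_coeff N (n + 1)"
proof -
  define q u v A B where "q = e2pi \<tau>" and "u = e2pi \<tau> ^ N" and "v = e2pi (of_int n * \<tau>)"
    and "A = rqfac (int N + 1 + n)" and "B = rqfac (int N + 1 - n)"
  have v0: "v \<noteq> 0" by (simp add: v_def)
  have e1: "e2pi (of_int (int N + 1 + n) * \<tau>) = q * u * v"
    unfolding q_def u_def v_def e2pi_power e2pi_add[symmetric] by (rule arg_cong[where f = e2pi]) (simp add: algebra_simps)
  have e2: "e2pi (of_int (int N + n) * \<tau>) = u * v"
    unfolding q_def u_def v_def e2pi_power e2pi_add[symmetric] by (rule arg_cong[where f = e2pi]) (simp add: algebra_simps)
  have v': "e2pi (- of_int n * \<tau>) = 1 / v"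
    unfolding v_def using e2pi_minus[of "of_int n * \<tau>"] by (simp add: field_simps)
  have e3: "e2pi (of_int (int N + 1 - n) * \<tau>) = q * u / v"
  proof -
    have "e2pi (of_int (int N + 1 - n) * \<tau>) = q * u * e2pi (- of_int n * \<tau>)"
      unfolding q_def u_def v_def e2pi_power e2pi_add[symmetric] by (rule arg_cong[where f = e2pi]) (simp add: algebra_simps)
    then show ?thesis unfolding v' by simp
  qed
  have e4: "e2pi (of_int (int N - n) * \<tau>) = u / v"
  proof -
    have "e2pi (of_int (int N - n) * \<tau>) = u * e2pi (- of_int n * \<tau>)"
      unfolding q_def u_def v_def e2pi_power e2pi_add[symmetric] by (rule arg_cong[where f = e2pi]) (simp add: algebra_simps)
    then show ?thesis unfolding v' by simp
  qed
  have r1: "rqfac (int N + n) = (1 - q * u * v) * A"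
    using rqfac_rec[of "int N + 1 + n"] e1 by (simp add: A_def)
  have r2: "rqfac (int N + n - 1) = (1 - u * v) * ((1 - q * u * v) * A)"
    using rqfac_rec[of "int N + n"] e2 r1 by simp
  have r3: "rqfac (int N - n) = (1 - q * u / v) * B"
    using rqfac_rec[of "int N + 1 - n"] e3 by (simp add: B_def)
  have r4: "rqfac (int N - n - 1) = (1 - u / v) * ((1 - q * u / v) * B)"
    using rqfac_rec[of "int N - n"] e4 r3 by simp
  have c0: "jtp_coeff N n = qfac (2 * N) * ((1 - q * u * v) * A) * ((1 - q * u / v) * B)"
    by (simp add: jtp_coeff_def r1 r3)
  have c1: "jtp_coeff N (n - 1) = qfac (2 * N) * ((1 - u * v) * ((1 - q * u * v) * A)) * B"
  proof -
    have "int N + (n - 1) = int N + n - 1" "int N - (n - 1) = int N + 1 - n" by simp_all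
    then show ?thesis by (simp only: jtp_coeff_def r2 B_def)
  qed
  have c2: "jtp_coeff N (n + 1) = qfac (2 * N) * A * ((1 - u / v) * ((1 - q * u / v) * B))"
  proof -
    have "int N + (n + 1) = int N + 1 + n" "int N - (n + 1) = int N - n - 1" by simp_all
    then show ?thesis by (simp only: jtp_coeff_def r4 A_def)
  qed
  have c3: "jtp_coeff (Suc N) n = qfac (2 * N) * (1 - q * u\<^sup>2) * (1 - q\<^sup>2 * u\<^sup>2) * A * B"
  proof -
    have "int (Suc N) + n = int N + 1 + n" "int (Suc N) - n = int N + 1 - n" by simp_all
    moreover have "qfac (2 * Suc N) = qfac (2 * N) * (1 - q * u\<^sup>2) * (1 - q\<^sup>2 * u\<^sup>2)"
    proof -
      have "u\<^sup>2 = q ^ (2 * N)" by (simp add: u_def q_def power_mult[symmetric] mult.commute)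
      then show ?thesis by (simp add: qfac_def q_def[symmetric] power2_eq_square mult.assoc)
    qed
    ultimately show ?thesis by (simp only: jtp_coeff_def A_def B_def mult.assoc)
  qed
  have p: "e2pi \<tau> ^ (2 * N + 1) = q * u\<^sup>2" "e2pi \<tau> ^ (N + 1) = q * u"
    by (simp_all add: q_def u_def power_mult[symmetric] mult.commute)
  show ?thesis
    unfolding c0 c1 c2 c3 p v' v_def[symmetric] using v0
    by (simp add: field_simps power2_eq_square)
qed

text \<open>Passing from \<open>N\<close> to \<open>N + 1\<close> multiplies the product by
  \<open>(1 - \<zeta> q\<^sup>N\<^sup>+\<^sup>1) (1 - \<zeta>\<^sup>-\<^sup>1 q\<^sup>N) = 1 + q\<^sup>2\<^sup>N\<^sup>+\<^sup>1 - \<zeta> q\<^sup>N\<^sup>+\<^sup>1 - \<zeta>\<^sup>-\<^sup>1 q\<^sup>N\<close>; on the side of the coefficients this is \<open>jtp_coeff_rec\<close>.\<close>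

lemma finite_jacobi_triple_product:
  "((\<lambda>n. (- 1) powi n * jtp_coeff N n * e2pi (of_int (n * (n + 1)) / 2 * \<tau> + of_int n * z))
     has_sum (\<Prod>k<N. (1 - e2pi z * e2pi \<tau> ^ Suc k) * (1 - e2pi (- z) * e2pi \<tau> ^ k))) UNIV"
proof (induction N)
  case 0
  have z: "(- 1) powi n * jtp_coeff 0 n * e2pi (of_int (n * (n + 1)) / 2 * \<tau> + of_int n * z) = 0" if "n \<noteq> 0" for n
    using that by (auto simp: jtp_coeff_def rqfac_def)
  show ?case
    by (rule has_sum_finite_neutralI[where B = "{0}"]) (use z in \<open>auto simp: jtp_coeff_def rqfac_def qfac_def\<close>)
next
  case (Suc N)
  define A where "A N n = (- 1) powi n * jtp_coeff N n * e2pi (of_int (n * (n + 1)) / 2 * \<tau> + of_int n * z)" for N n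
  define Q where "Q = (\<Prod>k<N. (1 - e2pi z * e2pi \<tau> ^ Suc k) * (1 - e2pi (- z) * e2pi \<tau> ^ k))"
  have IH: "(A N has_sum Q) UNIV"
    using Suc.IH unfolding A_def[symmetric] Q_def .
  have m: "((\<lambda>n. A N (n - 1)) has_sum Q) UNIV"
    by (subst has_sum_reindex_bij_witness[where T = UNIV and h = "A N" and s' = Q and i = "\<lambda>n. n + 1" and j = "\<lambda>n. n - 1"]) (auto simp: IH)
  have p: "((\<lambda>n. A N (n + 1)) has_sum Q) UNIV"
    by (subst has_sum_reindex_bij_witness[where T = UNIV and h = "A N" and s' = Q and i = "\<lambda>n. n - 1" and j = "\<lambda>n. n + 1"]) (auto simp: IH)
  let ?q = "e2pi \<tau>"
  have rec: "A (Suc N) n = (1 + ?q ^ (2 * N + 1)) * A N n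
      + (- (?q ^ (N + 1) * e2pi z)) * A N (n - 1) + (- (?q ^ N * e2pi (- z))) * A N (n + 1)" for n
  proof -
    define E where "E = e2pi (of_int (n * (n + 1)) / 2 * \<tau> + of_int n * z)"
    have 1: "e2pi z * e2pi (of_int ((n - 1) * (n - 1 + 1)) / 2 * \<tau> + of_int (n - 1) * z) = E * e2pi (- of_int n * \<tau>)"
      unfolding E_def e2pi_add[symmetric] by (rule arg_cong[where f = e2pi]) (simp add: field_simps)
    have 2: "e2pi (- z) * e2pi (of_int ((n + 1) * (n + 1 + 1)) / 2 * \<tau> + of_int (n + 1) * z) = E * (?q * e2pi (of_int n * \<tau>))"
      unfolding E_def e2pi_add[symmetric] by (rule arg_cong[where f = e2pi]) (simp add: field_simps)
    have s: "(- 1) powi (n - 1) = - ((- 1) powi n :: complex)" "(- 1) powi (n + 1) = - ((- 1) powi n :: complex)"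
      by (simp_all add: power_int_diff power_int_add)
    have a: "(- (?q ^ (N + 1) * e2pi z)) * A N (n - 1) =
        (- 1) powi n * (?q ^ (N + 1) * (e2pi (- of_int n * \<tau>) * jtp_coeff N (n - 1))) * E"
      using 1 unfolding A_def s by (simp add: algebra_simps)
    have b: "(- (?q ^ N * e2pi (- z))) * A N (n + 1) =
        (- 1) powi n * (?q ^ (N + 1) * (e2pi (of_int n * \<tau>) * jtp_coeff N (n + 1))) * E"
      using 2 unfolding A_def s by (simp add: algebra_simps)
    have c: "A N n = (- 1) powi n * jtp_coeff N n * E" "A (Suc N) n = (- 1) powi n * jtp_coeff (Suc N) n * E"
      by (simp_all add: A_def E_def)
    show ?thesis unfolding a b c jtp_coeff_rec by (simp add: algebra_simps)
  qed
  have "(A (Suc N) has_sum ((1 + ?q ^ (2 * N + 1)) * Q + (- (?q ^ (N + 1) * e2pi z)) * Q + (- (?q ^ N * e2pi (- z))) * Q)) UNIV"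
    unfolding rec[abs_def] by (intro has_sum_add has_sum_cmult_right IH m p)
  moreover have "(1 + ?q ^ (2 * N + 1)) * Q + (- (?q ^ (N + 1) * e2pi z)) * Q + (- (?q ^ N * e2pi (- z))) * Q =
     Q * ((1 - e2pi z * ?q ^ Suc N) * (1 - e2pi (- z) * ?q ^ N))"
  proof -
    have "?q ^ (2 * N + 1) = e2pi z * ?q ^ Suc N * (e2pi (- z) * ?q ^ N)"
      by (simp add: e2pi_minus mult_2 power_add)
    then show ?thesis by (simp add: algebra_simps)
  qed
  ultimately have "(A (Suc N) has_sum Q * ((1 - e2pi z * ?q ^ Suc N) * (1 - e2pi (- z) * ?q ^ N))) UNIV"
    by (simp only:)
  then show ?case unfolding A_def[abs_def] Q_def prod.lessThan_Suc .
qed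

lemma qfac_LIMSEQ: "qfac \<longlonglongrightarrow> qprod \<tau> 0"
  using qprod_LIMSEQ[of 0] by (simp add: qfac_def[abs_def])

lemma rqfac_LIMSEQ:
  assumes "filterlim g at_top sequentially"
  shows "(\<lambda>N. rqfac (g N)) \<longlonglongrightarrow> 1 / qprod \<tau> 0"
proof -
  have "filterlim (\<lambda>N. nat (g N)) at_top sequentially"
    by (rule filterlim_compose[OF filterlim_nat_sequentially assms])
  then have "(\<lambda>N. 1 / qfac (nat (g N))) \<longlonglongrightarrow> 1 / qprod \<tau> 0"
    by (intro tendsto_divide filterlim_compose[OF qfac_LIMSEQ] tendsto_const qprod_0_nonzero)
  moreover have "eventually (\<lambda>N. g N \<ge> 0) sequentially"
    using assms by (auto simp: filterlim_at_top)
  then have "eventually (\<lambda>N. rqfac (g N) = 1 / qfac (nat (g N))) sequentially"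
    by eventually_elim (simp add: rqfac_def)
  ultimately show ?thesis by (simp only: tendsto_cong)
qed

lemma jtp_coeff_LIMSEQ: "(\<lambda>N. jtp_coeff N n) \<longlonglongrightarrow> 1 / qprod \<tau> 0"
proof -
  have 1: "(\<lambda>N. qfac (2 * N)) \<longlonglongrightarrow> qprod \<tau> 0"
    by (rule filterlim_compose[OF qfac_LIMSEQ]) (rule mult_nat_left_at_top, simp)
  have f: "filterlim (\<lambda>N. int N + m) at_top sequentially" for m
    unfolding filterlim_at_top
  proof
    fix Z :: int
    show "eventually (\<lambda>N. Z \<le> int N + m) sequentially"
      by (rule eventually_sequentiallyI[of "nat (Z - m)"]) linarith
  qed
  have "filterlim (\<lambda>N. int N + n) at_top sequentially" "filterlim (\<lambda>N. int N - n) at_top sequentially"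
    using f[of n] f[of "- n"] by simp_all
  then have "(\<lambda>N. jtp_coeff N n) \<longlonglongrightarrow> qprod \<tau> 0 * (1 / qprod \<tau> 0) * (1 / qprod \<tau> 0)"
    unfolding jtp_coeff_def by (intro tendsto_mult 1 rqfac_LIMSEQ)
  then show ?thesis using qprod_0_nonzero by simp
qed

lemma jtp_coeff_bounded: "\<exists>K. \<forall>N n. norm (jtp_coeff N n) \<le> K"
proof -
  obtain K1 where K1: "K1 > 0" "\<And>N. norm (qfac N) \<le> K1"
    using convergent_imp_Bseq[OF convergentI[OF qfac_LIMSEQ]] by (auto simp: Bseq_def)
  have "(\<lambda>N. 1 / qfac N) \<longlonglongrightarrow> 1 / qprod \<tau> 0"
    by (intro tendsto_divide qfac_LIMSEQ tendsto_const qprod_0_nonzero)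
  then have "Bseq (\<lambda>N. 1 / qfac N)"
    by (intro convergent_imp_Bseq convergentI)
  then obtain K2 where K2: "K2 > 0" "\<forall>N. norm (1 / qfac N) \<le> K2"
    by (erule BseqE)
  have r: "norm (rqfac m) \<le> K2" for m
    using K2 by (simp add: rqfac_def)
  have "norm (jtp_coeff N n) \<le> K1 * K2 * K2" for N n
    unfolding jtp_coeff_def norm_mult using K1 K2 r by (intro mult_mono) auto
  then show ?thesis by blast
qed

text \<open>The limit \<open>N \<rightarrow> \<infinity>\<close> of the finite identity: the Gaussian coefficients are bounded and tend to \<open>1/(q; q)\<^sub>\<infinity>\<close>.\<close>

lemma jacobi_triple_product:
  "jtheta \<tau> z = e2pi (\<tau> / 8) * (e2pi (z / 2) - e2pi (- z / 2)) * qprod \<tau> 0 * qprod \<tau> z * qprod \<tau> (- z)"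
proof -
  define g where "g n = (- 1) powi n * e2pi (of_int (n * (n + 1)) / 2 * \<tau> + of_int n * z)" for n
  have gj: "jtheta \<tau> z = e2pi (\<tau> / 8) * e2pi (z / 2) * (\<Sum>\<^sub>\<infinity>n. g n)"
  proof -
    have "(- 1) powi n * e2pi (of_int (n * (n + 1)) / 2 * \<tau>) * e2pi ((of_int n + 1 / 2) * z) = e2pi (z / 2) * g n" for n
    proof -
      have "e2pi (of_int (n * (n + 1)) / 2 * \<tau>) * e2pi ((of_int n + 1 / 2) * z) =
         e2pi (z / 2) * e2pi (of_int (n * (n + 1)) / 2 * \<tau> + of_int n * z)"
        unfolding e2pi_add[symmetric] by (rule arg_cong[where f = e2pi]) (simp add: algebra_simps)
      then show ?thesis by (simp add: g_def mult_ac)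
    qed
    then show ?thesis by (simp add: jtheta_def infsum_cmult_right')
  qed
  have sg: "(\<lambda>n. norm (g n)) summable_on UNIV"
  proof -
    have "norm (g n) = norm (inverse (e2pi (\<tau> / 8 + z / 2))) * norm (theta_term 0 \<tau> z (of_int n + 1 / 2))" for n
    proof -
      have "theta_term 0 \<tau> z (of_int n + 1 / 2) = e2pi (\<tau> / 8 + z / 2) * e2pi (of_int (n * (n + 1)) / 2 * \<tau> + of_int n * z)"
        unfolding theta_term_def power_0 mult_1 e2pi_add[symmetric]
        by (rule arg_cong[where f = e2pi]) (simp add: field_simps power2_eq_square)
      moreover have "norm (e2pi (of_int (n * (n + 1)) / 2 * \<tau> + of_int n * z)) = norm (g n)"
        unfolding g_def norm_mult by (simp add: norm_power_int)
      ultimately show ?thesis by (simp add: norm_mult norm_inverse)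
    qed
    then show ?thesis
      by (simp only: summable_on_cmult_right[OF theta_term_abs_summable[OF \<tau>]])
  qed
  obtain K where K: "\<And>N n. norm (jtp_coeff N n) \<le> K" using jtp_coeff_bounded by blast
  have L1: "(\<lambda>N. \<Sum>\<^sub>\<infinity>n. jtp_coeff N n * g n) \<longlonglongrightarrow> (\<Sum>\<^sub>\<infinity>n. 1 / qprod \<tau> 0 * g n)"
  proof (rule tendsto_infsum_dominated[where M = "\<lambda>n. K * norm (g n)"])
    show "(\<lambda>N. jtp_coeff N n * g n) \<longlonglongrightarrow> 1 / qprod \<tau> 0 * g n" for n
      by (intro tendsto_mult jtp_coeff_LIMSEQ tendsto_const)
    show "norm (jtp_coeff N n * g n) \<le> K * norm (g n)" for N n
      unfolding norm_mult by (intro mult_right_mono K) simp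
    show "(\<lambda>n. K * norm (g n)) summable_on UNIV"
      by (intro summable_on_cmult_right sg)
  qed
  define P1 where "P1 N = (\<Prod>k<N. 1 - e2pi z * e2pi \<tau> ^ Suc k)" for N
  define P2 where "P2 N = (\<Prod>k<N. 1 - e2pi (- z) * e2pi \<tau> ^ Suc k)" for N
  have F: "(\<Sum>\<^sub>\<infinity>n. jtp_coeff (Suc N) n * g n) = P1 (Suc N) * ((1 - e2pi (- z)) * P2 N)" for N
  proof -
    have "(\<Sum>\<^sub>\<infinity>n. jtp_coeff (Suc N) n * g n) = (\<Prod>k<Suc N. (1 - e2pi z * e2pi \<tau> ^ Suc k) * (1 - e2pi (- z) * e2pi \<tau> ^ k))"
    proof -
      have "jtp_coeff (Suc N) n * g n = (- 1) powi n * jtp_coeff (Suc N) n * e2pi (of_int (n * (n + 1)) / 2 * \<tau> + of_int n * z)" for n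
        by (simp only: g_def mult_ac)
      then show ?thesis
        unfolding infsumI[OF finite_jacobi_triple_product[of "Suc N" z], symmetric] by (rule infsum_cong)
    qed
    also have "\<dots> = P1 (Suc N) * (\<Prod>k<Suc N. 1 - e2pi (- z) * e2pi \<tau> ^ k)"
      by (simp only: prod.distrib P1_def)
    also have "(\<Prod>k<Suc N. 1 - e2pi (- z) * e2pi \<tau> ^ k) = (1 - e2pi (- z)) * P2 N"
      by (subst prod.lessThan_Suc_shift) (simp add: P2_def)
    finally show ?thesis .
  qed
  have L2: "(\<lambda>N. P1 (Suc N) * ((1 - e2pi (- z)) * P2 N)) \<longlonglongrightarrow> qprod \<tau> z * ((1 - e2pi (- z)) * qprod \<tau> (- z))"
    unfolding P1_def P2_def
    by (intro tendsto_mult tendsto_const qprod_LIMSEQ LIMSEQ_Suc[OF qprod_LIMSEQ])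
  have "(\<lambda>N. P1 (Suc N) * ((1 - e2pi (- z)) * P2 N)) \<longlonglongrightarrow> 1 / qprod \<tau> 0 * (\<Sum>\<^sub>\<infinity>n. g n)"
    using LIMSEQ_Suc[OF L1] unfolding F infsum_cmult_right' .
  from LIMSEQ_unique[OF this L2]
  have S: "(\<Sum>\<^sub>\<infinity>n. g n) = qprod \<tau> 0 * (qprod \<tau> z * ((1 - e2pi (- z)) * qprod \<tau> (- z)))"
    using qprod_0_nonzero by (simp add: field_simps)
  have X: "e2pi (z / 2) - e2pi (- z / 2) = e2pi (z / 2) * (1 - e2pi (- z))"
    unfolding right_diff_distrib mult_1_right e2pi_add[symmetric] by simp
  show ?thesis unfolding gj S X by (simp only: mult_ac)
qed

end

section \<open>Logarithmic derivative of the triple product\<close>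

lemma higher_deriv_sum_finite:
  assumes "open U" "\<And>x. x \<in> A \<Longrightarrow> f x holomorphic_on U" "z \<in> U" "finite A"
  shows "(deriv ^^ j) (\<lambda>w. \<Sum>x\<in>A. f x w) z = (\<Sum>x\<in>A. (deriv ^^ j) (f x) z)"
  using assms(4,2)
proof (induction A rule: finite_induct)
  case empty
  then show ?case by simp
next
  case (insert x A)
  have "(deriv ^^ j) (\<lambda>w. f x w + (\<Sum>x\<in>A. f x w)) z = (deriv ^^ j) (f x) z + (deriv ^^ j) (\<lambda>w. \<Sum>x\<in>A. f x w) z"
    by (rule higher_deriv_add[of _ U]) (use insert assms in \<open>auto intro!: holomorphic_intros\<close>)
  then show ?case using insert by simp
qed

lemma higher_deriv_infsum:
  fixes f :: "'a \<Rightarrow> complex \<Rightarrow> complex"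
  assumes U: "open U" "z \<in> U"
    and holo: "\<And>x. x \<in> X \<Longrightarrow> f x holomorphic_on U"
    and bound: "\<And>x w. x \<in> X \<Longrightarrow> w \<in> U \<Longrightarrow> norm (f x w) \<le> M x"
    and M: "M summable_on X"
  shows "((\<lambda>x. (deriv ^^ j) (f x) z) has_sum (deriv ^^ j) (\<lambda>w. \<Sum>\<^sub>\<infinity>x\<in>X. f x w) z) X"
proof -
  let ?F = "finite_subsets_at_top X"
  have ev: "eventually (\<lambda>A. finite A \<and> A \<subseteq> X) ?F"
    by (simp add: eventually_finite_subsets_at_top_weakI)
  have "((\<lambda>A. (deriv ^^ j) (\<lambda>w. \<Sum>x\<in>A. f x w) z) \<longlongrightarrow> (deriv ^^ j) (\<lambda>w. \<Sum>\<^sub>\<infinity>x\<in>X. f x w) z) ?F"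
  proof (rule higher_deriv_complex_uniform_limit)
    show "uniform_limit U (\<lambda>A w. \<Sum>x\<in>A. f x w) (\<lambda>w. \<Sum>\<^sub>\<infinity>x\<in>X. f x w) ?F"
      by (rule Weierstrass_m_test_general[OF bound M])
    show "eventually (\<lambda>A. (\<lambda>w. \<Sum>x\<in>A. f x w) holomorphic_on U) ?F"
      using ev by eventually_elim (use holo in \<open>auto intro!: holomorphic_intros\<close>)
  qed (use U in auto)
  moreover have "eventually (\<lambda>A. (deriv ^^ j) (\<lambda>w. \<Sum>x\<in>A. f x w) z = (\<Sum>x\<in>A. (deriv ^^ j) (f x) z)) ?F"
    using ev by eventually_elim (use U holo in \<open>auto intro!: higher_deriv_sum_finite[of U]\<close>)
  ultimately show ?thesis unfolding has_sum_def by (simp only: tendsto_cong)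
qed

lemma holomorphic_on_infsum:
  fixes f :: "'a \<Rightarrow> complex \<Rightarrow> complex"
  assumes U: "open U"
    and holo: "\<And>x. x \<in> X \<Longrightarrow> f x holomorphic_on U"
    and bound: "\<And>x w. x \<in> X \<Longrightarrow> w \<in> U \<Longrightarrow> norm (f x w) \<le> M x"
    and M: "M summable_on X"
  shows "(\<lambda>w. \<Sum>\<^sub>\<infinity>x\<in>X. f x w) holomorphic_on U"
  unfolding holomorphic_on_open[OF U]
proof
  fix z assume "z \<in> U"
  then obtain r where r: "r > 0" "cball z r \<subseteq> U" using U open_contains_cball by blast
  have "((\<lambda>w. \<Sum>\<^sub>\<infinity>x\<in>X. f x w) has_field_derivative (\<Sum>\<^sub>\<infinity>x\<in>X. deriv (f x) z)) (at z)"
    by (rule has_field_derivative_infsum[OF r(1) _ _ M])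
      (use r U holo bound in \<open>auto intro!: holomorphic_derivI\<close>)
  then show "\<exists>f'. ((\<lambda>w. \<Sum>\<^sub>\<infinity>x\<in>X. f x w) has_field_derivative f') (at z)" by blast
qed

text \<open>A Lambert series collected by powers of \<open>q\<close>: the terms with \<open>(k + 1)(m + 1) = n + 1\<close> correspond to the
  divisors \<open>m + 1\<close> of \<open>n + 1\<close>.\<close>

lemma infsum_divisor_sum:
  fixes q :: complex
  assumes "((\<lambda>(k, m). of_nat (Suc m) ^ j * q ^ (Suc k * Suc m)) has_sum S) (UNIV :: (nat \<times> nat) set)"
  shows "(\<lambda>n. of_nat (divisor_sum j (Suc n)) * q ^ Suc n) sums S"
proof -
  let ?B = "\<lambda>n. {d. d dvd Suc n}"
  have "((\<lambda>(n, d). of_nat d ^ j * q ^ Suc n) has_sum S) (Sigma UNIV ?B)"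
  proof (subst has_sum_reindex_bij_witness[where T = UNIV and h = "\<lambda>(k, m). of_nat (Suc m) ^ j * q ^ (Suc k * Suc m)"
      and s' = S and j = "\<lambda>(n, d). (Suc n div d - 1, d - 1)" and i = "\<lambda>(k, m). (Suc k * Suc m - 1, Suc m)"])
    show "((\<lambda>(k, m). of_nat (Suc m) ^ j * q ^ (Suc k * Suc m)) has_sum S) UNIV" by fact
  next
    fix a assume "a \<in> Sigma UNIV ?B"
    then obtain n d where a: "a = (n, d)" and d: "d dvd Suc n" by auto
    obtain e where e: "Suc n = d * e" using d by (auto elim: dvdE)
    then have "d > 0" "e > 0" by (auto intro!: Nat.gr0I)
    then have f: "Suc n div d = e" "Suc (e - 1) = e" "Suc (d - 1) = d"
      using e by simp_all
    have g: "e * d = Suc n" using e by (simp only: mult.commute)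
    show "(case case a of (n, d) \<Rightarrow> (Suc n div d - 1, d - 1) of (k, m) \<Rightarrow> (Suc k * Suc m - 1, Suc m)) = a"
      unfolding a prod.case f g by simp
    show "(case case a of (n, d) \<Rightarrow> (Suc n div d - 1, d - 1) of (k, m) \<Rightarrow> of_nat (Suc m) ^ j * q ^ (Suc k * Suc m)) =
        (case a of (n, d) \<Rightarrow> of_nat d ^ j * q ^ Suc n)"
      unfolding a prod.case f g by (rule refl)
  qed (auto simp del: mult_Suc mult_Suc_right)
  then have "((\<lambda>n. \<Sum>d | d dvd Suc n. of_nat d ^ j * q ^ Suc n) has_sum S) UNIV"
    by (rule has_sum_SigmaD) (auto intro!: has_sum_finiteI)
  then have "(\<lambda>n. \<Sum>d | d dvd Suc n. of_nat d ^ j * q ^ Suc n) sums S"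
    by (rule has_sum_imp_sums)
  then show ?thesis by (simp only: divisor_sum_def of_nat_sum of_nat_power sum_distrib_right)
qed

definition eis_sum :: "nat \<Rightarrow> complex \<Rightarrow> complex" where
  "eis_sum j \<tau> = (\<Sum>n. of_nat (divisor_sum j (Suc n)) * e2pi \<tau> ^ Suc n)"

text \<open>From here on \<open>t = 2 \<pi> \<i> z\<close>, so \<open>\<zeta> = exp t\<close>. These are the terms of the geometric series for the
  logarithmic derivatives of \<open>1 - \<zeta>\<^sup>\<plusminus>\<^sup>1 q\<^sup>k\<^sup>+\<^sup>1\<close>.\<close>

definition logderiv_term :: "complex \<Rightarrow> nat \<times> nat \<Rightarrow> complex \<Rightarrow> complex" where
  "logderiv_term \<tau> = (\<lambda>(k, m) t. - ((exp t * e2pi \<tau> ^ Suc k) ^ Suc m - (exp (- t) * e2pi \<tau> ^ Suc k) ^ Suc m))"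

definition logderiv_series :: "complex \<Rightarrow> complex \<Rightarrow> complex" where
  "logderiv_series \<tau> t = (\<Sum>\<^sub>\<infinity>x. logderiv_term \<tau> x t)"

definition qprod_pair :: "complex \<Rightarrow> complex \<Rightarrow> complex" where
  "qprod_pair \<tau> t = (\<Prod>n. 1 - exp t * e2pi \<tau> ^ Suc n) * (\<Prod>n. 1 - exp (- t) * e2pi \<tau> ^ Suc n)"

context
  fixes \<tau> :: complex
  assumes \<tau>: "Im \<tau> > 0"
begin

text \<open>A neighbourhood of \<open>0\<close> on which \<open>\<bar>\<zeta>\<^sup>\<plusminus>\<^sup>1 q\<bar> < 1\<close>, so that all the geometric series converge.\<close>

definition conv_disc where "conv_disc = ball (0 :: complex) (pi * Im \<tau>)"

lemma conv_disc_open: "open conv_disc" and conv_disc_0: "0 \<in> conv_disc"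
  using \<tau> by (auto simp: conv_disc_def)

lemma conv_disc_uminus: "t \<in> conv_disc \<Longrightarrow> - t \<in> conv_disc" by (simp add: conv_disc_def)

lemma conv_disc_norm_exp: "t \<in> conv_disc \<Longrightarrow> norm (exp t) \<le> exp (pi * Im \<tau>)"
  using abs_Re_le_cmod[of t] by (simp add: conv_disc_def)

lemma conv_disc_norm_factor: "t \<in> conv_disc \<Longrightarrow> norm (exp t * e2pi \<tau> ^ Suc k) \<le> exp (- pi * Im \<tau>) ^ (2 * k + 1)"
proof -
  assume "t \<in> conv_disc"
  have "norm (exp t * e2pi \<tau> ^ Suc k) \<le> exp (pi * Im \<tau>) * exp (- 2 * pi * Im \<tau>) ^ Suc k"
    unfolding norm_mult norm_power norm_e2pi by (intro mult_right_mono conv_disc_norm_exp) (use \<open>t \<in> conv_disc\<close> in auto)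
  also have "\<dots> = exp (- pi * Im \<tau>) ^ (2 * k + 1)"
    by (simp add: exp_add[symmetric] exp_of_nat_mult[symmetric] algebra_simps del: exp_of_nat_mult flip: exp_add)
  finally show ?thesis .
qed

definition conv_ratio where "conv_ratio = exp (- pi * Im \<tau>)"

lemma conv_ratio: "0 < conv_ratio" "conv_ratio < 1" using \<tau> by (auto simp: conv_ratio_def)

lemma conv_ratio_power_less: "conv_ratio ^ (2 * n + 1) < 1"
  using power_Suc_less_one[of conv_ratio "2 * n"] conv_ratio by simp

lemma logderiv_term_bound:
  assumes "t \<in> conv_disc" shows "norm (logderiv_term \<tau> (k, m) t) \<le> 2 * (conv_ratio ^ k * conv_ratio ^ m)"
proof -
  have b: "norm ((exp t * e2pi \<tau> ^ Suc k) ^ Suc m) \<le> conv_ratio ^ k * conv_ratio ^ m" if "t \<in> conv_disc" for t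
  proof -
    have "norm ((exp t * e2pi \<tau> ^ Suc k) ^ Suc m) \<le> (conv_ratio ^ (2 * k + 1)) ^ Suc m"
      unfolding norm_power[of _ "Suc m"] conv_ratio_def by (intro power_mono conv_disc_norm_factor that) auto
    also have "\<dots> = conv_ratio ^ ((2 * k + 1) * Suc m)" by (simp only: power_mult)
    also have "\<dots> \<le> conv_ratio ^ (k + m)" using conv_ratio by (intro power_decreasing) auto
    finally show ?thesis by (simp add: power_add)
  qed
  have "norm (logderiv_term \<tau> (k, m) t) \<le> norm ((exp t * e2pi \<tau> ^ Suc k) ^ Suc m) + norm ((exp (- t) * e2pi \<tau> ^ Suc k) ^ Suc m)"
    unfolding logderiv_term_def split norm_minus_cancel by (rule norm_triangle_ineq4)
  with b[OF assms] b[OF conv_disc_uminus[OF assms]] show ?thesis by linarith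
qed

lemma conv_ratio_summable: "(\<lambda>(k, m). 2 * (conv_ratio ^ k * conv_ratio ^ m)) summable_on UNIV"
proof -
  have s: "(\<lambda>k. conv_ratio ^ k) summable_on UNIV"
    using conv_ratio by (subst summable_on_UNIV_nonneg_real_iff) (auto intro!: summable_geometric)
  have "(\<lambda>p. norm (case p of (k, m) \<Rightarrow> 2 * (conv_ratio ^ k * conv_ratio ^ m))) summable_on UNIV \<times> UNIV"
    using conv_ratio s by (subst Infinite_Sum.abs_summable_on_Sigma_iff)
      (auto simp: abs_mult infsum_cmult_right' infsum_cmult_left' intro!: summable_on_cmult_right summable_on_cmult_left infsum_nonneg)
  then show ?thesis using conv_ratio by (simp add: case_prod_unfold abs_mult)
qed

lemma logderiv_term_bound': "t \<in> conv_disc \<Longrightarrow> norm (logderiv_term \<tau> x t) \<le> (case x of (k, m) \<Rightarrow> 2 * (conv_ratio ^ k * conv_ratio ^ m))"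
  using logderiv_term_bound by (cases x) auto

lemma logderiv_term_holomorphic: "logderiv_term \<tau> x holomorphic_on A"
  unfolding logderiv_term_def by (cases x) (auto intro!: holomorphic_intros)

lemma logderiv_series_holomorphic: "logderiv_series \<tau> holomorphic_on conv_disc"
  unfolding logderiv_series_def[abs_def]
  by (rule holomorphic_on_infsum[OF conv_disc_open logderiv_term_holomorphic logderiv_term_bound' conv_ratio_summable])

lemma logderiv_term_higher_deriv:
  "(deriv ^^ j) (logderiv_term \<tau> (k, m)) 0 = (- 1 + (- 1) ^ j) * (of_nat (Suc m) ^ j * e2pi \<tau> ^ (Suc k * Suc m))"
proof -
  define c where "c = e2pi \<tau> ^ (Suc k * Suc m)"
  define a :: complex where "a = of_nat (Suc m)"
  have S: "logderiv_term \<tau> (k, m) = (\<lambda>t. - (c * exp (a * t)) + c * exp (- a * t))"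
    unfolding logderiv_term_def split c_def a_def power_mult_distrib exp_of_nat_mult[symmetric] power_mult
    by (rule ext) (simp add: exp_of_nat_mult[symmetric] algebra_simps)
  have "(deriv ^^ j) (\<lambda>t. - (c * exp (a * t)) + c * exp (- a * t)) = (\<lambda>t. - (c * a ^ j * exp (a * t)) + c * (- a) ^ j * exp (- a * t))"
  proof (induction j)
    case (Suc j)
    show ?case unfolding funpow.simps o_def Suc.IH
      by (intro ext DERIV_imp_deriv) (auto intro!: derivative_eq_intros simp: algebra_simps)
  qed simp
  then show ?thesis unfolding S c_def[symmetric] a_def[symmetric]
    by (simp add: algebra_simps power_minus[of a])
qed

text \<open>The \<open>j\<close>-th derivative at \<open>0\<close> brings out the factor \<open>(m + 1)\<^sup>j\<close>, and the two terms with \<open>exp (\<plusminus> (m + 1) t)\<close> cancel for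
  even \<open>j\<close>.\<close>

lemma logderiv_series_higher_deriv: "(deriv ^^ j) (logderiv_series \<tau>) 0 = (- 1 + (- 1) ^ j) * eis_sum j \<tau>"
proof -
  have hs: "((\<lambda>x. (deriv ^^ j) (logderiv_term \<tau> x) 0) has_sum (deriv ^^ j) (logderiv_series \<tau>) 0) UNIV"
    unfolding logderiv_series_def[abs_def]
    by (rule higher_deriv_infsum[OF conv_disc_open conv_disc_0 logderiv_term_holomorphic logderiv_term_bound' conv_ratio_summable])
  show ?thesis
  proof (cases "even j")
    case True
    then have "(\<lambda>x. (deriv ^^ j) (logderiv_term \<tau> x) 0) = (\<lambda>x. 0)"
      using logderiv_term_higher_deriv by (auto simp: fun_eq_iff)
    with hs have "(deriv ^^ j) (logderiv_series \<tau>) 0 = 0" by (metis has_sum_0 has_sum_unique)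
    then show ?thesis using True by simp
  next
    case False
    have "((\<lambda>x. (- 1 / 2) * (deriv ^^ j) (logderiv_term \<tau> x) 0) has_sum (- 1 / 2) * (deriv ^^ j) (logderiv_series \<tau>) 0) UNIV"
      by (rule has_sum_cmult_right[OF hs])
    moreover have "(\<lambda>x. (- 1 / 2) * (deriv ^^ j) (logderiv_term \<tau> x) 0) = (\<lambda>(k, m). of_nat (Suc m) ^ j * e2pi \<tau> ^ (Suc k * Suc m))"
      using False by (auto simp: fun_eq_iff logderiv_term_higher_deriv simp del: of_nat_Suc mult_Suc mult_Suc_right power_Suc)
    ultimately have "(\<lambda>n. of_nat (divisor_sum j (Suc n)) * e2pi \<tau> ^ Suc n) sums ((- 1 / 2) * (deriv ^^ j) (logderiv_series \<tau>) 0)"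
      using infsum_divisor_sum by simp
    then have "eis_sum j \<tau> = (- 1 / 2) * (deriv ^^ j) (logderiv_series \<tau>) 0"
      by (simp only: eis_sum_def sums_iff)
    then show ?thesis using False by simp
  qed
qed

lemma qprod_pair_convergent: "convergent_prod (\<lambda>n. 1 - exp t * e2pi \<tau> ^ Suc n)"
  using qprod_convergent[OF \<tau>, of "t / (2 * of_real pi * \<i>)"] by (simp add: e2pi_def)

lemma qprod_factor_nonzero: "t \<in> conv_disc \<Longrightarrow> 1 - exp t * e2pi \<tau> ^ Suc n \<noteq> 0"
proof -
  assume "t \<in> conv_disc"
  then have "norm (exp t * e2pi \<tau> ^ Suc n) \<le> conv_ratio ^ (2 * n + 1)" unfolding conv_ratio_def by (rule conv_disc_norm_factor)
  also have "\<dots> < 1" by (rule conv_ratio_power_less)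
  finally show ?thesis by (auto simp del: power_Suc)
qed

lemma qprod_pair_nonzero: "t \<in> conv_disc \<Longrightarrow> qprod_pair \<tau> t \<noteq> 0"
  unfolding qprod_pair_def using prodinf_nonzero[OF qprod_pair_convergent qprod_factor_nonzero] conv_disc_uminus by fastforce

definition qprod_factor where "qprod_factor k t = (1 - exp t * e2pi \<tau> ^ Suc k) * (1 - exp (- t) * e2pi \<tau> ^ Suc k)"

lemma qprod_pair_uniform_limit: "uniform_limit conv_disc (\<lambda>n t. \<Prod>k<n. qprod_factor k t) (qprod_pair \<tau>) sequentially"
proof -
  let ?C = "cball (0 :: complex) (pi * Im \<tau>)"
  define K where "K = exp (pi * Im \<tau>)"
  have nK: "norm (exp t) \<le> K" "norm (exp (- t)) \<le> K" if "t \<in> ?C" for t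
    using abs_Re_le_cmod[of t] that by (auto simp: K_def)
  have le: "norm (norm (qprod_factor k t - 1)) \<le> (2 * K + 1) * norm (e2pi \<tau>) ^ Suc k" if "t \<in> ?C" for k t
  proof -
    let ?q = "e2pi \<tau> ^ Suc k"
    have q1: "norm ?q \<le> 1" unfolding norm_power using norm_e2pi_less_1[OF \<tau>] by (intro power_le_one) auto
    have "exp t * exp (- t) = 1" by (simp flip: exp_add)
    then have "qprod_factor k t - 1 = ?q * (?q - (exp t + exp (- t)))"
      unfolding qprod_factor_def by (simp add: algebra_simps)
    then have "norm (qprod_factor k t - 1) = norm ?q * norm (?q - (exp t + exp (- t)))" by (simp only: norm_mult)
    also have "norm (?q - (exp t + exp (- t))) \<le> norm ?q + (norm (exp t) + norm (exp (- t)))"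
      by (rule order_trans[OF norm_triangle_ineq4]) (intro add_left_mono norm_triangle_ineq)
    also have "\<dots> \<le> 2 * K + 1" using q1 nK[OF that] by linarith
    finally have "norm (qprod_factor k t - 1) \<le> norm ?q * (2 * K + 1)" by (simp add: mult_left_mono)
    then show ?thesis by (simp add: norm_power norm_mult mult.commute)
  qed
  have "summable (\<lambda>k. (2 * K + 1) * norm (e2pi \<tau>) ^ Suc k)"
    using norm_e2pi_less_1[OF \<tau>] by (intro summable_mult) (simp add: summable_geometric)
  then have "uniformly_convergent_on ?C (\<lambda>N t. \<Sum>k<N. norm (qprod_factor k t - 1))"
    by (intro Weierstrass_m_test'[where M = "\<lambda>k. (2 * K + 1) * norm (e2pi \<tau>) ^ Suc k"] le)
  then have "uniformly_convergent_on ?C (\<lambda>n t. \<Prod>k<n. qprod_factor k t)"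
    by (intro uniformly_convergent_on_prod') (auto simp: qprod_factor_def intro!: continuous_intros)
  then have ul: "uniform_limit ?C (\<lambda>n t. \<Prod>k<n. qprod_factor k t) (\<lambda>t. lim (\<lambda>n. \<Prod>k<n. qprod_factor k t)) sequentially"
    using uniformly_convergent_uniform_limit_iff by blast
  have "(\<lambda>n. \<Prod>k<n. qprod_factor k t) \<longlonglongrightarrow> qprod_pair \<tau> t" for t
    unfolding qprod_factor_def qprod_pair_def prod.distrib
    by (intro tendsto_mult has_prod_imp_tendsto'[OF convergent_prod_has_prod[OF qprod_pair_convergent]])
  then have "lim (\<lambda>n. \<Prod>k<n. qprod_factor k t) = qprod_pair \<tau> t" for t by (rule limI)
  with ul have "uniform_limit ?C (\<lambda>n t. \<Prod>k<n. qprod_factor k t) (qprod_pair \<tau>) sequentially" by simp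
  then show ?thesis by (rule uniform_limit_on_subset) (auto simp: conv_disc_def)
qed

lemma qprod_factor_holomorphic: "qprod_factor k holomorphic_on A"
  unfolding qprod_factor_def[abs_def] by (intro holomorphic_intros)

lemma qprod_pair_holomorphic: "qprod_pair \<tau> holomorphic_on conv_disc"
proof (rule holomorphic_uniform_sequence[OF conv_disc_open])
  show "(\<lambda>t. \<Prod>k<n. qprod_factor k t) holomorphic_on conv_disc" for n
    by (intro holomorphic_intros qprod_factor_holomorphic)
  fix x assume "x \<in> conv_disc"
  then obtain d where "d > 0" "cball x d \<subseteq> conv_disc" using conv_disc_open open_contains_cball by blast
  then show "\<exists>d>0. cball x d \<subseteq> conv_disc \<and> uniform_limit (cball x d) (\<lambda>n t. \<Prod>k<n. qprod_factor k t) (qprod_pair \<tau>) sequentially"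
    using uniform_limit_on_subset[OF qprod_pair_uniform_limit] by blast
qed

lemma qprod_factor_logderiv:
  assumes "t \<in> conv_disc"
  shows "((\<lambda>m. logderiv_term \<tau> (k, m) t) has_sum deriv (qprod_factor k) t / qprod_factor k t) UNIV"
proof -
  let ?a = "exp t * e2pi \<tau> ^ Suc k" and ?b = "exp (- t) * e2pi \<tau> ^ Suc k"
  have n: "norm (exp s * e2pi \<tau> ^ Suc k) < 1" if "s \<in> conv_disc" for s
  proof -
    have "norm (exp s * e2pi \<tau> ^ Suc k) \<le> conv_ratio ^ (2 * k + 1)" unfolding conv_ratio_def by (rule conv_disc_norm_factor[OF that])
    also have "\<dots> < 1" by (rule conv_ratio_power_less)
    finally show ?thesis .
  qed
  have g: "((\<lambda>m. x ^ Suc m) has_sum (x / (1 - x))) UNIV" if "norm x < 1" for x :: complex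
    by (subst has_sum_reindex_bij_witness[where T = "{1..}" and h = "\<lambda>m. x ^ m" and s' = "x / (1 - x)"
          and j = Suc and i = "\<lambda>n. n - 1"]) (use has_sum_geometric_from_1[OF that] in auto)
  have "((\<lambda>m. - (?a ^ Suc m) + ?b ^ Suc m) has_sum (- (?a / (1 - ?a)) + ?b / (1 - ?b))) UNIV"
    by (intro has_sum_add has_sum_uminusI g n assms conv_disc_uminus)
  moreover have "deriv (qprod_factor k) t = - ?a * (1 - ?b) + (1 - ?a) * ?b"
    unfolding qprod_factor_def[abs_def] by (rule DERIV_imp_deriv) (auto intro!: derivative_eq_intros)
  moreover have "1 - ?a \<noteq> 0" "1 - ?b \<noteq> 0" using qprod_factor_nonzero assms conv_disc_uminus by blast+
  then have "(- ?a * (1 - ?b) + (1 - ?a) * ?b) / ((1 - ?a) * (1 - ?b)) = - (?a / (1 - ?a)) + ?b / (1 - ?b)"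
    by (simp add: divide_simps)
  ultimately show ?thesis
    by (simp add: logderiv_term_def qprod_factor_def del: power_Suc)
qed

text \<open>Logarithmic differentiation of the product, followed by the geometric series in each factor.\<close>

lemma qprod_pair_deriv: 
  assumes "t \<in> conv_disc" shows "deriv (qprod_pair \<tau>) t = logderiv_series \<tau> t * qprod_pair \<tau> t"
proof -
  have s: "(\<lambda>x. logderiv_term \<tau> x t) summable_on UNIV"
    by (rule abs_summable_summable, rule Infinite_Sum.abs_summable_on_comparison_test'[OF conv_ratio_summable logderiv_term_bound'[OF assms]])
  then have "((\<lambda>x. logderiv_term \<tau> x t) has_sum logderiv_series \<tau> t) (UNIV \<times> UNIV)"
    by (simp add: logderiv_series_def)
  then have "((\<lambda>k. deriv (qprod_factor k) t / qprod_factor k t) has_sum logderiv_series \<tau> t) UNIV"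
    by (rule has_sum_SigmaD) (rule qprod_factor_logderiv[OF assms])
  then have "(\<lambda>k. deriv (qprod_factor k) t / qprod_factor k t) sums logderiv_series \<tau> t"
    by (rule has_sum_imp_sums)
  moreover have "(\<lambda>k. deriv (qprod_factor k) t / qprod_factor k t) sums (deriv (qprod_pair \<tau>) t / qprod_pair \<tau> t)"
    by (rule logderiv_prodinf_complex_uniform_limit[OF qprod_pair_uniform_limit qprod_factor_holomorphic qprod_pair_nonzero conv_disc_open])
      (use assms in auto)
  ultimately have "logderiv_series \<tau> t = deriv (qprod_pair \<tau>) t / qprod_pair \<tau> t" by (rule sums_unique2)
  then show ?thesis using qprod_pair_nonzero[OF assms] by simp
qed

end

section \<open>Taylor coefficients of theta and Eisenstein series\<close>

lemma fps_expansion_nthI: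
  assumes "f holomorphic_on A" "open A" "0 \<in> A" "\<And>n. (deriv ^^ n) f 0 = c n"
  shows "f has_fps_expansion Abs_fps (\<lambda>n. c n / fact n)"
proof -
  have "f analytic_on {0}" using assms analytic_at by blast
  then have "f has_fps_expansion fps_expansion f 0" by (rule analytic_at_imp_has_fps_expansion_0)
  then show ?thesis by (simp add: fps_expansion_def assms(4))
qed

context
  fixes \<tau> :: complex
  assumes \<tau>: "Im \<tau> > 0"
begin

lemma theta_mom_fps:
  "(\<lambda>t. theta_mom a k \<tau> (z0 + t / (2 * of_real pi * \<i>))) has_fps_expansion
     Abs_fps (\<lambda>n. theta_mom a (k + n) \<tau> z0 / fact n)"
proof -
  let ?f = "\<lambda>k t. theta_mom a k \<tau> (z0 + t / (2 * of_real pi * \<i>))"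
  have d: "(?f k has_field_derivative ?f (Suc k) t) (at t)" for k t
  proof -
    have "((\<lambda>t. z0 + t / (2 * of_real pi * \<i>)) has_field_derivative 1 / (2 * of_real pi * \<i>)) (at t)"
      by (auto intro!: derivative_eq_intros)
    from theta_mom_deriv_z_chain[OF \<tau> this, of a k] show ?thesis by simp
  qed
  have "(deriv ^^ n) (?f k) = ?f (k + n)" for n
    by (induction n) (auto intro!: ext DERIV_imp_deriv d)
  then have e: "(deriv ^^ n) (?f k) 0 = theta_mom a (k + n) \<tau> z0" for n by simp
  have "?f k holomorphic_on UNIV"
    using d by (auto simp: holomorphic_on_open)
  then show ?thesis by (rule fps_expansion_nthI[OF _ open_UNIV UNIV_I e])
qed

definition jtheta_fps where "jtheta_fps = Abs_fps (\<lambda>n. jtheta_mom n \<tau> / fact n)"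

lemma jtheta_fps: "(\<lambda>t. jtheta \<tau> (t / (2 * of_real pi * \<i>))) has_fps_expansion jtheta_fps"
proof -
  have "(\<lambda>t. - \<i> * theta_mom (1 / 2) 0 \<tau> (1 / 2 + t / (2 * of_real pi * \<i>))) has_fps_expansion
      fps_const (- \<i>) * Abs_fps (\<lambda>n. theta_mom (1 / 2) (0 + n) \<tau> (1 / 2) / fact n)"
    by (intro has_fps_expansion_cmult_left theta_mom_fps)
  moreover have "fps_const (- \<i>) * Abs_fps (\<lambda>n. theta_mom (1 / 2) (0 + n) \<tau> (1 / 2) / fact n) = jtheta_fps"
    by (simp add: jtheta_fps_def fps_eq_iff jtheta_mom_def)
  ultimately show ?thesis by (simp add: jtheta_eq_theta_mom add.commute)
qed

definition jtheta_cofactor where "jtheta_cofactor t = e2pi (\<tau> / 8) * qprod \<tau> 0 * qprod_pair \<tau> t"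

lemma jtheta_G_fun:
  "jtheta \<tau> (t / (2 * of_real pi * \<i>)) = (exp (1 / 2 * t) - exp (- 1 / 2 * t)) * jtheta_cofactor t"
proof -
  have "qprod \<tau> (t / (2 * of_real pi * \<i>)) * qprod \<tau> (- (t / (2 * of_real pi * \<i>))) = qprod_pair \<tau> t"
    by (simp add: qprod_def qprod_pair_def e2pi_def)
  moreover have "e2pi (t / (2 * of_real pi * \<i>) / 2) = exp (1 / 2 * t)" "e2pi (- (t / (2 * of_real pi * \<i>)) / 2) = exp (- 1 / 2 * t)"
    by (simp_all add: e2pi_def)
  ultimately show ?thesis
    unfolding jacobi_triple_product[OF \<tau>] jtheta_cofactor_def by (simp add: mult_ac)
qed

lemma jtheta_cofactor_0: "jtheta_cofactor 0 = dedekind_eta \<tau> ^ 3"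
proof -
  have "qprod_pair \<tau> 0 = qprod \<tau> 0 * qprod \<tau> 0" by (simp add: qprod_pair_def qprod_def)
  moreover have "dedekind_eta \<tau> = e2pi (\<tau> / 24) * qprod \<tau> 0" by (simp add: dedekind_eta_def qprod_def)
  moreover have "e2pi (\<tau> / 24) ^ 3 = e2pi (\<tau> / 8)" by (simp add: e2pi_power)
  ultimately show ?thesis by (simp add: jtheta_cofactor_def power_mult_distrib power3_eq_cube mult_ac)
qed

lemma dedekind_eta_nonzero: "dedekind_eta \<tau> \<noteq> 0"
proof -
  have "dedekind_eta \<tau> = e2pi (\<tau> / 24) * qprod \<tau> 0" by (simp add: dedekind_eta_def qprod_def)
  then show ?thesis using qprod_0_nonzero[OF \<tau>] by simp
qed

text \<open>The triple product in the form \<open>\<theta>\<^sub>1 = 2 sinh (t/2) G\<close> with \<open>G' = S G\<close>. As an identity of power series it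
  determines all Taylor coefficients of \<open>\<theta>\<^sub>1\<close> from \<open>G(0) = \<eta>\<^sup>3\<close> and those of \<open>S\<close>.\<close>

lemma jtheta_fps_factorisation:
  obtains G where "jtheta_fps = (fps_exp (1 / 2) - fps_exp (- 1 / 2)) * G"
    "fps_deriv G = Abs_fps (\<lambda>n. ((- 1 + (- 1) ^ n) * eis_sum n \<tau>) / fact n) * G"
    "fps_nth G 0 = dedekind_eta \<tau> ^ 3"
proof -
  define G where "G = fps_expansion jtheta_cofactor 0"
  let ?S = "Abs_fps (\<lambda>n. ((- 1 + (- 1) ^ n) * eis_sum n \<tau>) / fact n)"
  have U: "open (conv_disc \<tau>)" "0 \<in> conv_disc \<tau>" using conv_disc_open[OF \<tau>] conv_disc_0[OF \<tau>] by auto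
  have S: "logderiv_series \<tau> has_fps_expansion ?S"
    by (rule fps_expansion_nthI[OF logderiv_series_holomorphic[OF \<tau>] U logderiv_series_higher_deriv[OF \<tau>]])
  have "jtheta_cofactor holomorphic_on conv_disc \<tau>"
    unfolding jtheta_cofactor_def[abs_def] by (intro holomorphic_intros qprod_pair_holomorphic \<tau>)
  then have G: "jtheta_cofactor has_fps_expansion G"
    unfolding G_def using U analytic_at analytic_at_imp_has_fps_expansion_0 by blast
  have "(\<lambda>t. (exp (1 / 2 * t) - exp (- 1 / 2 * t)) * jtheta_cofactor t) has_fps_expansion (fps_exp (1 / 2) - fps_exp (- 1 / 2)) * G"
    by (intro fps_expansion_intros G)
  then have 1: "jtheta_fps = (fps_exp (1 / 2) - fps_exp (- 1 / 2)) * G"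
    using jtheta_fps unfolding jtheta_G_fun by (rule fps_expansion_unique_complex[rotated])
  have "deriv jtheta_cofactor t = logderiv_series \<tau> t * jtheta_cofactor t" if t: "t \<in> conv_disc \<tau>" for t
  proof -
    have "(qprod_pair \<tau> has_field_derivative logderiv_series \<tau> t * qprod_pair \<tau> t) (at t)"
      using holomorphic_derivI[OF qprod_pair_holomorphic[OF \<tau>] U(1) t] qprod_pair_deriv[OF \<tau> t] by simp
    then show ?thesis
      unfolding jtheta_cofactor_def[abs_def] by (intro DERIV_imp_deriv) (auto intro!: derivative_eq_intros)
  qed
  then have "eventually (\<lambda>t. deriv jtheta_cofactor t = logderiv_series \<tau> t * jtheta_cofactor t) (nhds 0)"
    using U eventually_nhds by blast
  moreover have "(\<lambda>t. logderiv_series \<tau> t * jtheta_cofactor t) has_fps_expansion ?S * G"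
    by (intro fps_expansion_intros S G)
  ultimately have "deriv jtheta_cofactor has_fps_expansion ?S * G"
    using has_fps_expansion_cong[OF _ refl] by metis
  then have 2: "fps_deriv G = ?S * G"
    by (rule fps_expansion_unique_complex[OF has_fps_expansion_deriv[OF G]])
  have "fps_nth G 0 = jtheta_cofactor 0" using has_fps_expansion_imp_0_eq_fps_nth_0[OF G] by simp
  then show ?thesis using that 1 2 jtheta_cofactor_0 by simp
qed

lemma jtheta_mom_eis_sum:
  shows "jtheta_mom 1 \<tau> = dedekind_eta \<tau> ^ 3"
    and "jtheta_mom 3 \<tau> = jtheta_mom 1 \<tau> * (1 / 4 - 6 * eis_sum 1 \<tau>)"
    and "jtheta_mom 5 \<tau> = jtheta_mom 1 \<tau> * 120 * (1 / 1920 - eis_sum 1 \<tau> / 24 + (eis_sum 1 \<tau>)\<^sup>2 / 2 - eis_sum 3 \<tau> / 12)"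
    and "jtheta_mom 7 \<tau> = jtheta_mom 1 \<tau> * 5040 * (1 / 322560 - eis_sum 1 \<tau> / 1920
       + ((eis_sum 1 \<tau>)\<^sup>2 / 2 - eis_sum 3 \<tau> / 12) / 24
       + (- eis_sum 5 \<tau> / 60 + eis_sum 1 \<tau> * eis_sum 3 \<tau> / 3 - 2 * eis_sum 1 \<tau> * ((eis_sum 1 \<tau>)\<^sup>2 / 2 - eis_sum 3 \<tau> / 12)) / 6)"
proof -
  obtain G where J: "jtheta_fps = (fps_exp (1 / 2) - fps_exp (- 1 / 2)) * G"
    and dG: "fps_deriv G = Abs_fps (\<lambda>n. ((- 1 + (- 1) ^ n) * eis_sum n \<tau>) / fact n) * G"
    and G0: "fps_nth G 0 = dedekind_eta \<tau> ^ 3" by (rule jtheta_fps_factorisation)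
  let ?e = "dedekind_eta \<tau> ^ 3"
  have dn: "of_nat (Suc n) * fps_nth G (Suc n) =
      (\<Sum>i=0..n. ((- 1 + (- 1) ^ i) * eis_sum i \<tau>) / fact i * fps_nth G (n - i))" for n
    using arg_cong[OF dG, of "\<lambda>F. fps_nth F n"] by (simp add: fps_mult_nth)
  have jn: "jtheta_mom n \<tau> = fact n * (\<Sum>i=0..n. ((1 / 2) ^ i - (- 1 / 2) ^ i) / fact i * fps_nth G (n - i))" for n
  proof -
    have "jtheta_mom n \<tau> / fact n = (\<Sum>i=0..n. ((1 / 2) ^ i - (- 1 / 2) ^ i) / fact i * fps_nth G (n - i))"
      using arg_cong[OF J, of "\<lambda>F. fps_nth F n"]
      unfolding jtheta_fps_def fps_mult_nth fps_nth_Abs_fps fps_sub_nth fps_exp_nth diff_divide_distrib of_nat_fact .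
    then show ?thesis by (simp add: divide_eq_eq mult.commute)
  qed
  have sums: "(\<Sum>i=0..1. f i) = f 0 + f 1" "(\<Sum>i=0..2. f i) = f 0 + f 1 + f 2"
    "(\<Sum>i=0..3. f i) = f 0 + f 1 + f 2 + f 3" "(\<Sum>i=0..4. f i) = f 0 + f 1 + f 2 + f 3 + f 4"
    "(\<Sum>i=0..5. f i) = f 0 + f 1 + f 2 + f 3 + f 4 + f 5"
    "(\<Sum>i=0..7. f i) = f 0 + f 1 + f 2 + f 3 + f 4 + f 5 + f 6 + f 7" for f :: "nat \<Rightarrow> complex"
    by (simp_all add: eval_nat_numeral)
  have G1: "fps_nth G 1 = 0" using dn[of 0] by simp
  have G2: "fps_nth G 2 = - eis_sum 1 \<tau> * ?e"
    using dn[of 1] G0 G1 unfolding sums by (simp add: numeral_2_eq_2)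
  have G3: "fps_nth G 3 = 0"
    using dn[of 2] G0 G1 G2 unfolding sums by (simp add: numeral_3_eq_3 numeral_2_eq_2)
  have dn': "of_nat (n + 1) * fps_nth G (n + 1) =
      (\<Sum>i=0..n. ((- 1 + (- 1) ^ i) * eis_sum i \<tau>) / fact i * fps_nth G (n - i))" for n
    using dn[of n] by simp
  have G1': "fps_nth G (Suc 0) = 0" using G1 by simp
  have G4: "fps_nth G 4 = ((eis_sum 1 \<tau>)\<^sup>2 / 2 - eis_sum 3 \<tau> / 12) * ?e"
    using dn'[of 3] unfolding sums by (simp add: G0 G1' G2 G3 fact_numeral field_simps power2_eq_square)
  have G5: "fps_nth G 5 = 0"
    using dn'[of 4] unfolding sums by (simp add: G0 G1' G2 G3 G4)
  have G6: "fps_nth G 6 = (- eis_sum 5 \<tau> / 60 + eis_sum 1 \<tau> * eis_sum 3 \<tau> / 3 - 2 * eis_sum 1 \<tau> * ((eis_sum 1 \<tau>)\<^sup>2 / 2 - eis_sum 3 \<tau> / 12)) / 6 * ?e"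
    using dn'[of 5] unfolding sums
    by (simp add: G0 G1' G2 G3 G4 G5 fact_numeral field_simps power2_eq_square)
  show 1: "jtheta_mom 1 \<tau> = ?e" using jn[of 1] G0 by simp
  show "jtheta_mom 3 \<tau> = jtheta_mom 1 \<tau> * (1 / 4 - 6 * eis_sum 1 \<tau>)"
    unfolding 1 jn[of 3] sums by (simp add: G0 G1' G2 G3 fact_numeral power_divide field_simps)
  show "jtheta_mom 5 \<tau> = jtheta_mom 1 \<tau> * 120 * (1 / 1920 - eis_sum 1 \<tau> / 24 + (eis_sum 1 \<tau>)\<^sup>2 / 2 - eis_sum 3 \<tau> / 12)"
    unfolding 1 jn[of 5] sums by (simp add: G0 G1' G2 G3 G4 G5 fact_numeral power_divide field_simps)
  show "jtheta_mom 7 \<tau> = jtheta_mom 1 \<tau> * 5040 * (1 / 322560 - eis_sum 1 \<tau> / 1920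
       + ((eis_sum 1 \<tau>)\<^sup>2 / 2 - eis_sum 3 \<tau> / 12) / 24
       + (- eis_sum 5 \<tau> / 60 + eis_sum 1 \<tau> * eis_sum 3 \<tau> / 3 - 2 * eis_sum 1 \<tau> * ((eis_sum 1 \<tau>)\<^sup>2 / 2 - eis_sum 3 \<tau> / 12)) / 6)"
    unfolding 1 jn[of 7] sums by (simp add: G0 G1' G2 G3 G4 G5 G6 fact_numeral power_divide field_simps)
qed

end

section \<open>Differential equations of the theta constants\<close>

text \<open>The derivative \<open>D = (2 \<pi> \<i>)\<^sup>-\<^sup>1 d/d\<tau> = q d/dq\<close>.\<close>

definition has_qderiv :: "(complex \<Rightarrow> complex) \<Rightarrow> complex \<Rightarrow> complex \<Rightarrow> bool" where
  "has_qderiv f d \<tau> \<longleftrightarrow> (f has_field_derivative 2 * of_real pi * \<i> * d) (at \<tau>)"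

lemma has_qderiv_unique: "has_qderiv f d \<tau> \<Longrightarrow> has_qderiv f e \<tau> \<Longrightarrow> d = e"
  unfolding has_qderiv_def using DERIV_unique by fastforce

lemma open_upper_half_plane: "open {t. Im t > 0}"
  by (simp add: open_halfspace_Im_gt)

lemma has_qderiv_transform:
  assumes "has_qderiv f d \<tau>" "Im \<tau> > 0" "\<And>t. Im t > 0 \<Longrightarrow> f t = g t"
  shows "has_qderiv g d \<tau>"
  unfolding has_qderiv_def
  by (rule has_field_derivative_transform_within_open[OF assms(1)[unfolded has_qderiv_def] open_upper_half_plane])
    (use assms in auto)

lemma has_qderiv_const: "has_qderiv (\<lambda>t. c) 0 \<tau>"
  by (simp add: has_qderiv_def)

lemma has_qderiv_add: "has_qderiv f d \<tau> \<Longrightarrow> has_qderiv g e \<tau> \<Longrightarrow> has_qderiv (\<lambda>t. f t + g t) (d + e) \<tau>"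
  unfolding has_qderiv_def distrib_left by (rule DERIV_add)

lemma has_qderiv_diff: "has_qderiv f d \<tau> \<Longrightarrow> has_qderiv g e \<tau> \<Longrightarrow> has_qderiv (\<lambda>t. f t - g t) (d - e) \<tau>"
  unfolding has_qderiv_def right_diff_distrib by (rule DERIV_diff)

lemma has_qderiv_mult:
  "has_qderiv f d \<tau> \<Longrightarrow> has_qderiv g e \<tau> \<Longrightarrow> has_qderiv (\<lambda>t. f t * g t) (d * g \<tau> + f \<tau> * e) \<tau>"
  unfolding has_qderiv_def by (rule DERIV_cong, erule (1) DERIV_mult) (simp add: algebra_simps)

lemma has_qderiv_cmult: "has_qderiv f d \<tau> \<Longrightarrow> has_qderiv (\<lambda>t. c * f t) (c * d) \<tau>"
  using has_qderiv_mult[OF has_qderiv_const] by fastforce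

lemma has_qderiv_divide:
  "has_qderiv f d \<tau> \<Longrightarrow> has_qderiv g e \<tau> \<Longrightarrow> g \<tau> \<noteq> 0 \<Longrightarrow>
    has_qderiv (\<lambda>t. f t / g t) ((d * g \<tau> - f \<tau> * e) / (g \<tau>)\<^sup>2) \<tau>"
  unfolding has_qderiv_def by (rule DERIV_cong, erule (2) DERIV_divide) (simp add: field_simps power2_eq_square)

lemma has_qderiv_power:
  "has_qderiv f d \<tau> \<Longrightarrow> has_qderiv (\<lambda>t. f t ^ Suc n) (of_nat (Suc n) * f \<tau> ^ n * d) \<tau>"
  unfolding has_qderiv_def by (rule DERIV_cong, erule DERIV_power) (simp add: algebra_simps)

lemma has_qderiv_theta_mom:
  assumes "Im \<tau> > 0"
  shows "has_qderiv (\<lambda>t. theta_mom a k t z) (theta_mom a (k + 2) \<tau> z / 2) \<tau>"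
  unfolding has_qderiv_def by (rule DERIV_cong[OF theta_mom_deriv_tau[OF assms]]) simp

lemma has_qderiv_jtheta_d:
  assumes "Im \<tau> > 0"
  shows "has_qderiv (jtheta_mom k) (jtheta_mom (k + 2) \<tau> / 2) \<tau>"
  unfolding jtheta_mom_def[abs_def]
  using has_qderiv_cmult[OF has_qderiv_theta_mom[OF assms], of "- \<i>"] by (simp add: mult_ac)

text \<open>The quasimodular \<open>E\<^sub>2 = 1 - 24 \<Sum> \<sigma>\<^sub>1(n) q\<^sup>n\<close>.\<close>

definition eis_E2 :: "complex \<Rightarrow> complex" where "eis_E2 \<tau> = - 24 * eis_G2 \<tau>"

lemma eis_sum_eq:
  "eis_sum 1 \<tau> = (1 - eis_E2 \<tau>) / 24" "eis_sum 3 \<tau> = (eis_E4 \<tau> - 1) / 240" "eis_sum 5 \<tau> = (1 - eis_E6 \<tau>) / 504"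
  by (simp_all add: eis_E2_def eis_G2_def eis_E4_def eis_E6_def eis_sum_def)

lemma jtheta_mom_nonzero: "Im \<tau> > 0 \<Longrightarrow> jtheta_mom 1 \<tau> \<noteq> 0"
  using jtheta_mom_eis_sum(1) dedekind_eta_nonzero by simp

text \<open>The heat equation makes these the values of \<open>(2 D)\<^sup>j \<theta>\<^sub>1'\<close> for \<open>j = 1, 2, 3\<close>.\<close>

lemma jtheta_mom_eis:
  assumes "Im \<tau> > 0"
  shows "jtheta_mom 3 \<tau> = jtheta_mom 1 \<tau> * eis_E2 \<tau> / 4"
    and "jtheta_mom 5 \<tau> = jtheta_mom 1 \<tau> * (5 * eis_E2 \<tau> ^ 2 - 2 * eis_E4 \<tau>) / 48"
    and "jtheta_mom 7 \<tau> = jtheta_mom 1 \<tau> * (35 * eis_E2 \<tau> ^ 3 - 42 * eis_E2 \<tau> * eis_E4 \<tau> + 16 * eis_E6 \<tau>) / 576"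
  unfolding jtheta_mom_eis_sum(2-4)[OF assms] eis_sum_eq
  by (simp_all add: field_simps power2_eq_square power3_eq_cube)

text \<open>Since \<open>E\<^sub>2 = 4 \<mu>\<^sub>3/\<mu>\<^sub>1\<close> for the moments \<open>\<mu>\<^sub>k\<close> of \<open>\<theta>\<^sub>1\<close> and \<open>D \<mu>\<^sub>k = \<mu>\<^sub>k\<^sub>+\<^sub>2/2\<close>, the derivative involves only
  \<open>\<mu>\<^sub>1, \<mu>\<^sub>3, \<mu>\<^sub>5\<close>.\<close>

lemma ramanujan_E2:
  assumes \<tau>: "Im \<tau> > 0"
  shows "has_qderiv eis_E2 ((eis_E2 \<tau> ^ 2 - eis_E4 \<tau>) / 12) \<tau>"
proof -
  note nz = jtheta_mom_nonzero[OF \<tau>]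
  have j: "jtheta_mom (1 + 2) \<tau> = jtheta_mom 3 \<tau>" "jtheta_mom (3 + 2) \<tau> = jtheta_mom 5 \<tau>" "jtheta_mom (5 + 2) \<tau> = jtheta_mom 7 \<tau>"
    by (simp_all add: eval_nat_numeral)
  have "has_qderiv (\<lambda>t. 4 * (jtheta_mom 3 t / jtheta_mom 1 t))
     (4 * ((jtheta_mom (3 + 2) \<tau> / 2 * jtheta_mom 1 \<tau> - jtheta_mom 3 \<tau> * (jtheta_mom (1 + 2) \<tau> / 2)) / (jtheta_mom 1 \<tau>)\<^sup>2)) \<tau>"
    by (intro has_qderiv_cmult has_qderiv_divide has_qderiv_jtheta_d \<tau> nz)
  also have "4 * ((jtheta_mom (3 + 2) \<tau> / 2 * jtheta_mom 1 \<tau> - jtheta_mom 3 \<tau> * (jtheta_mom (1 + 2) \<tau> / 2)) / (jtheta_mom 1 \<tau>)\<^sup>2) =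
      (eis_E2 \<tau> ^ 2 - eis_E4 \<tau>) / 12"
    unfolding j jtheta_mom_eis[OF \<tau>] using nz by (simp add: field_simps power2_eq_square)
  finally show ?thesis
    by (rule has_qderiv_transform[OF _ \<tau>]) (simp add: jtheta_mom_eis(1) jtheta_mom_nonzero[simplified])
qed

lemma ramanujan_E4:
  assumes \<tau>: "Im \<tau> > 0"
  shows "has_qderiv eis_E4 ((eis_E2 \<tau> * eis_E4 \<tau> - eis_E6 \<tau>) / 3) \<tau>"
proof -
  note nz = jtheta_mom_nonzero[OF \<tau>]
  have j: "jtheta_mom (1 + 2) \<tau> = jtheta_mom 3 \<tau>" "jtheta_mom (3 + 2) \<tau> = jtheta_mom 5 \<tau>" "jtheta_mom (5 + 2) \<tau> = jtheta_mom 7 \<tau>"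
    by (simp_all add: eval_nat_numeral)
  have "has_qderiv (\<lambda>t. (5 / 2) * eis_E2 t ^ Suc 1 - 24 * (jtheta_mom 5 t / jtheta_mom 1 t))
     ((5 / 2) * (of_nat (Suc 1) * eis_E2 \<tau> ^ 1 * ((eis_E2 \<tau> ^ 2 - eis_E4 \<tau>) / 12)) -
      24 * ((jtheta_mom (5 + 2) \<tau> / 2 * jtheta_mom 1 \<tau> - jtheta_mom 5 \<tau> * (jtheta_mom (1 + 2) \<tau> / 2)) / (jtheta_mom 1 \<tau>)\<^sup>2)) \<tau>"
    by (intro has_qderiv_diff has_qderiv_cmult has_qderiv_divide has_qderiv_power has_qderiv_jtheta_d ramanujan_E2 \<tau> nz)
  also have "(5 / 2) * (of_nat (Suc 1) * eis_E2 \<tau> ^ 1 * ((eis_E2 \<tau> ^ 2 - eis_E4 \<tau>) / 12)) -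
      24 * ((jtheta_mom (5 + 2) \<tau> / 2 * jtheta_mom 1 \<tau> - jtheta_mom 5 \<tau> * (jtheta_mom (1 + 2) \<tau> / 2)) / (jtheta_mom 1 \<tau>)\<^sup>2) =
      (eis_E2 \<tau> * eis_E4 \<tau> - eis_E6 \<tau>) / 3"
    unfolding j jtheta_mom_eis[OF \<tau>] using nz by (simp add: field_simps power2_eq_square power3_eq_cube)
  finally show ?thesis
    by (rule has_qderiv_transform[OF _ \<tau>])
      (simp add: jtheta_mom_eis(2) jtheta_mom_nonzero[simplified] power2_eq_square field_simps)
qed

lemma Im_power_two_mult: "Im (2 ^ N * \<tau>) = 2 ^ N * Im \<tau>"
  by (induction N) (simp_all add: mult.assoc)

lemma theta_null_cusp_limits:
  assumes \<tau>: "Im \<tau> > 0"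
  shows "(\<lambda>N. theta3 (2 ^ N * \<tau>) 0) \<longlonglongrightarrow> 1" "(\<lambda>N. theta4 (2 ^ N * \<tau>) 0) \<longlonglongrightarrow> 1"
    "(\<lambda>N. theta2 (2 ^ N * \<tau>) 0 * e2pi (- (2 ^ N * \<tau>) / 8)) \<longlonglongrightarrow> 2"
    "(\<lambda>N. jtheta_mom 1 (2 ^ N * \<tau>) * e2pi (- (2 ^ N * \<tau>) / 8)) \<longlonglongrightarrow> 1"
proof -
  show "(\<lambda>N. theta3 (2 ^ N * \<tau>) 0) \<longlonglongrightarrow> 1" "(\<lambda>N. theta4 (2 ^ N * \<tau>) 0) \<longlonglongrightarrow> 1"
    unfolding theta3_def theta4_def by (rule theta_mom_0_cusp_limit[OF \<tau>])+
  show "(\<lambda>N. theta2 (2 ^ N * \<tau>) 0 * e2pi (- (2 ^ N * \<tau>) / 8)) \<longlonglongrightarrow> 2"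
    unfolding theta2_def using theta_mom_half_cusp_limit[OF \<tau>, of 0 0] by (simp add: theta_term_def)
  have "e2pi (- 1 / 4) = - \<i>" using e2pi_minus[of "1 / 4"] by simp
  then have "theta_term 1 0 (1 / 2) (1 / 2) + theta_term 1 0 (1 / 2) (- (1 / 2)) = \<i>"
    by (simp add: theta_term_def)
  then have "(\<lambda>N. - \<i> * (theta_mom (1 / 2) 1 (2 ^ N * \<tau>) (1 / 2) * e2pi (- (2 ^ N * \<tau>) / 8))) \<longlonglongrightarrow> - \<i> * \<i>"
    using tendsto_mult_left[OF theta_mom_half_cusp_limit[OF \<tau>, of 1 "1 / 2"], of "- \<i>"] by simp
  then show "(\<lambda>N. jtheta_mom 1 (2 ^ N * \<tau>) * e2pi (- (2 ^ N * \<tau>) / 8)) \<longlonglongrightarrow> 1"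
    by (simp add: jtheta_mom_def mult.assoc)
qed

text \<open>Jacobi's derivative formula \<open>2 \<theta>\<^sub>1' = \<theta>\<^sub>2 \<theta>\<^sub>3 \<theta>\<^sub>4\<close>. Duplication shows that the quotient of the two sides is
  unchanged by \<open>\<tau> \<mapsto> 2 \<tau>\<close>, so it equals its limit at the cusp.\<close>

lemma jtheta_derivative_formula:
  assumes \<tau>: "Im \<tau> > 0"
  shows "theta2 \<tau> 0 * theta3 \<tau> 0 * theta4 \<tau> 0 = 2 * jtheta_mom 1 \<tau>"
proof -
  define P where "P t = theta2 t 0 * theta3 t 0 * theta4 t 0" for t
  define r where "r t = P t / jtheta_mom 1 t" for t
  have rec: "r (2 * t) = r t" if t: "Im t > 0" for t
  proof -
    have t2: "Im (2 * t) > 0" using t by simp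
    have "2 * P (2 * t) = theta2 t 0 ^ 2 * theta4 (2 * t) 0"
      unfolding theta2_null_sq[OF t] P_def by simp
    then have "jtheta_mom 1 t * (2 * P (2 * t)) = (jtheta_mom 1 t * theta2 t 0) * (theta2 t 0 * theta4 (2 * t) 0)"
      by (simp add: power2_eq_square)
    also have "\<dots> = 2 * (jtheta_mom 1 (2 * t) * (theta2 t 0 * (theta4 (2 * t) 0 * theta4 (2 * t) 0)))"
      unfolding jtheta_mom_double[OF t] by simp
    also have "theta4 (2 * t) 0 * theta4 (2 * t) 0 = theta3 t 0 * theta4 t 0"
      using theta3_theta4_double[OF t, of 0] by simp
    finally have "jtheta_mom 1 t * P (2 * t) = jtheta_mom 1 (2 * t) * P t" by (simp add: P_def mult_ac)
    then show ?thesis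
      using jtheta_mom_nonzero[OF t] jtheta_mom_nonzero[OF t2] by (simp add: r_def field_simps)
  qed
  have rN: "r (2 ^ N * \<tau>) = r \<tau>" for N
  proof (induction N)
    case (Suc N)
    have "r (2 * (2 ^ N * \<tau>)) = r (2 ^ N * \<tau>)" using \<tau> Im_power_two_mult[of N \<tau>] by (intro rec) simp
    then show ?case using Suc by (simp add: mult.assoc)
  qed simp
  have "(\<lambda>N. (theta2 (2 ^ N * \<tau>) 0 * e2pi (- (2 ^ N * \<tau>) / 8)) * theta3 (2 ^ N * \<tau>) 0 * theta4 (2 ^ N * \<tau>) 0 /
      (jtheta_mom 1 (2 ^ N * \<tau>) * e2pi (- (2 ^ N * \<tau>) / 8))) \<longlonglongrightarrow> 2 * 1 * 1 / 1"
    by (intro tendsto_divide tendsto_mult theta_null_cusp_limits \<tau>) simp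
  moreover have "(theta2 (2 ^ N * \<tau>) 0 * e2pi (- (2 ^ N * \<tau>) / 8)) * theta3 (2 ^ N * \<tau>) 0 * theta4 (2 ^ N * \<tau>) 0 /
      (jtheta_mom 1 (2 ^ N * \<tau>) * e2pi (- (2 ^ N * \<tau>) / 8)) = r \<tau>" for N
    unfolding rN[of N, symmetric] by (simp add: r_def P_def field_simps)
  ultimately have "r \<tau> = 2" by (simp add: LIMSEQ_const_iff)
  then show ?thesis using jtheta_mom_nonzero[OF \<tau>] by (simp add: r_def P_def field_simps)
qed


context
  fixes \<tau> :: complex
  assumes \<tau>: "Im \<tau> > 0"
begin

lemma theta_null_nonzero: "theta2 \<tau> 0 \<noteq> 0" "theta3 \<tau> 0 \<noteq> 0" "theta4 \<tau> 0 \<noteq> 0"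
  using jtheta_derivative_formula[OF \<tau>] jtheta_mom_nonzero[OF \<tau>] by auto

lemma theta_null_qderiv:
  "has_qderiv (\<lambda>t. theta2 t 0) (theta_mom (1 / 2) 2 \<tau> 0 / 2) \<tau>"
  "has_qderiv (\<lambda>t. theta3 t 0) (theta_mom 0 2 \<tau> 0 / 2) \<tau>"
  "has_qderiv (\<lambda>t. theta4 t 0) (theta_mom 0 2 \<tau> (1 / 2) / 2) \<tau>"
proof -
  have "has_qderiv (\<lambda>t. theta_mom a 0 t z) (theta_mom a 2 \<tau> z / 2) \<tau>" for a z
    using has_qderiv_theta_mom[OF \<tau>, of a 0 z] by (simp add: numeral_2_eq_2)
  from this[of "1 / 2" 0] this[of 0 0] this[of 0 "1 / 2"] show
    "has_qderiv (\<lambda>t. theta2 t 0) (theta_mom (1 / 2) 2 \<tau> 0 / 2) \<tau>"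
    "has_qderiv (\<lambda>t. theta3 t 0) (theta_mom 0 2 \<tau> 0 / 2) \<tau>"
    "has_qderiv (\<lambda>t. theta4 t 0) (theta_mom 0 2 \<tau> (1 / 2) / 2) \<tau>"
    by (simp_all add: theta2_def theta3_def theta4_def)
qed

text \<open>Equivalently \<open>D log \<theta>\<^sub>2\<close>, \<open>D log \<theta>\<^sub>3\<close>, \<open>D log \<theta>\<^sub>4\<close>. They solve a linear system of three equations: the Wronskian
  of \<open>\<theta>\<^sub>3\<close> and \<open>\<theta>\<^sub>4\<close>, the derivative of Jacobi's quartic identity, and the logarithmic derivative of
  \<open>\<theta>\<^sub>2 \<theta>\<^sub>3 \<theta>\<^sub>4 = 2 \<theta>\<^sub>1'\<close>.\<close>

lemma theta_mom_2:
  "theta_mom (1 / 2) 2 \<tau> 0 = theta2 \<tau> 0 * (eis_E2 \<tau> + theta3 \<tau> 0 ^ 4 + theta4 \<tau> 0 ^ 4) / 12"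
  "theta_mom 0 2 \<tau> 0 = theta3 \<tau> 0 * (eis_E2 \<tau> + theta2 \<tau> 0 ^ 4 - theta4 \<tau> 0 ^ 4) / 12"
  "theta_mom 0 2 \<tau> (1 / 2) = theta4 \<tau> 0 * (eis_E2 \<tau> - theta2 \<tau> 0 ^ 4 - theta3 \<tau> 0 ^ 4) / 12"
proof -
  define A B C A2 B2 C2 E where "A = theta2 \<tau> 0" and "B = theta3 \<tau> 0" and "C = theta4 \<tau> 0"
    and "A2 = theta_mom (1 / 2) 2 \<tau> 0" and "B2 = theta_mom 0 2 \<tau> 0" and "C2 = theta_mom 0 2 \<tau> (1 / 2)"
    and "E = eis_E2 \<tau>"
  note defs = A_def B_def C_def A2_def B2_def C2_def E_def
  have nz: "A \<noteq> 0" "B \<noteq> 0" "C \<noteq> 0" using theta_null_nonzero unfolding defs .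
  have jac: "B ^ 4 = A ^ 4 + C ^ 4" unfolding defs by (rule theta_null_quartic[OF \<tau>])
  have J: "jtheta_mom 1 \<tau> = A * B * C / 2" using jtheta_derivative_formula[OF \<tau>] by (simp add: defs)
  have R1: "B2 * C - B * C2 = A ^ 4 * B * C / 4"
  proof -
    have "(B2 * C - B * C2) * (B * C) = (2 * jtheta_mom 1 (2 * \<tau>) * theta4 (2 * \<tau>) 0)\<^sup>2"
      using theta34_wronskian[OF \<tau>] theta3_theta4_double[OF \<tau>, of 0] unfolding defs
      by (simp add: power2_eq_square)
    also have "\<dots> = (A * B * C / 2 * A)\<^sup>2"
      unfolding jtheta_mom_double[OF \<tau>, symmetric] J A_def ..
    also have "\<dots> = (A ^ 4 * B * C / 4) * (B * C)"
      by (simp add: power2_eq_square power4_eq_xxxx mult_ac)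
    finally have "(B2 * C - B * C2) * (B * C) = (A ^ 4 * B * C / 4) * (B * C)" .
    then show ?thesis using nz by simp
  qed
  have R2: "B ^ 3 * B2 = A ^ 3 * A2 + C ^ 3 * C2"
  proof -
    have "has_qderiv (\<lambda>t. theta2 t 0 ^ Suc 3 + theta4 t 0 ^ Suc 3) (of_nat (Suc 3) * A ^ 3 * (A2 / 2) + of_nat (Suc 3) * C ^ 3 * (C2 / 2)) \<tau>"
      unfolding defs by (intro has_qderiv_add has_qderiv_power theta_null_qderiv)
    then have "has_qderiv (\<lambda>t. theta3 t 0 ^ Suc 3) (of_nat (Suc 3) * A ^ 3 * (A2 / 2) + of_nat (Suc 3) * C ^ 3 * (C2 / 2)) \<tau>"
      by (rule has_qderiv_transform[OF _ \<tau>]) (use theta_null_quartic in \<open>simp add: eval_nat_numeral\<close>)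
    moreover have "has_qderiv (\<lambda>t. theta3 t 0 ^ Suc 3) (of_nat (Suc 3) * B ^ 3 * (B2 / 2)) \<tau>"
      unfolding defs by (intro has_qderiv_power theta_null_qderiv)
    ultimately have "of_nat (Suc 3) * A ^ 3 * (A2 / 2) + of_nat (Suc 3) * C ^ 3 * (C2 / 2) = of_nat (Suc 3) * B ^ 3 * (B2 / 2)"
      by (rule has_qderiv_unique)
    then have "2 * (A ^ 3 * A2 + C ^ 3 * C2) = 2 * (B ^ 3 * B2)" by (simp add: mult_ac)
    then have "A ^ 3 * A2 + C ^ 3 * C2 = B ^ 3 * B2" by (simp only: mult_cancel_left) simp
    then show ?thesis ..
  qed
  have R3: "A2 * B * C + A * B2 * C + A * B * C2 = A * B * C * E / 4"
  proof -
    have "has_qderiv (\<lambda>t. theta2 t 0 * theta3 t 0 * theta4 t 0) ((A2 / 2 * B + A * (B2 / 2)) * C + (A * B) * (C2 / 2)) \<tau>"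
      unfolding defs by (intro has_qderiv_mult theta_null_qderiv)
    then have "has_qderiv (\<lambda>t. 2 * jtheta_mom 1 t) ((A2 / 2 * B + A * (B2 / 2)) * C + (A * B) * (C2 / 2)) \<tau>"
      by (rule has_qderiv_transform[OF _ \<tau>]) (rule jtheta_derivative_formula)
    moreover have "has_qderiv (\<lambda>t. 2 * jtheta_mom 1 t) (2 * (jtheta_mom (1 + 2) \<tau> / 2)) \<tau>"
      by (intro has_qderiv_cmult has_qderiv_jtheta_d \<tau>)
    ultimately have "(A2 / 2 * B + A * (B2 / 2)) * C + (A * B) * (C2 / 2) = jtheta_mom (1 + 2) \<tau>"
      using has_qderiv_unique by fastforce
    also have "jtheta_mom (1 + 2) \<tau> = jtheta_mom 3 \<tau>" by (simp add: eval_nat_numeral)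
    also have "\<dots> = A * B * C / 2 * E / 4" unfolding jtheta_mom_eis(1)[OF \<tau>] J E_def ..
    finally have f: "(A2 / 2 * B + A * (B2 / 2)) * C + (A * B) * (C2 / 2) = A * B * C / 2 * E / 4" .
    have "A2 * B * C + A * B2 * C + A * B * C2 = 2 * ((A2 / 2 * B + A * (B2 / 2)) * C + (A * B) * (C2 / 2))"
      by (simp add: algebra_simps)
    then show ?thesis unfolding f by simp
  qed
  \<comment> \<open>Twice the logarithmic derivatives of the theta constants.\<close>
  define a b c where "a = A2 / A" and "b = B2 / B" and "c = C2 / C"
  have abc: "A2 = A * a" "B2 = B * b" "C2 = C * c" using nz by (auto simp: a_def b_def c_def)
  have "B * C * (b - c) = B * C * (A ^ 4 / 4)" using R1 unfolding abc by (simp add: algebra_simps)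
  then have "b - c = A ^ 4 / 4" using nz by simp
  then have 1: "b = c + A ^ 4 / 4" by (simp only: diff_eq_eq add.commute)
  have "B ^ 4 * b = A ^ 4 * a + C ^ 4 * c" using R2 unfolding abc by (simp add: eval_nat_numeral mult_ac)
  then have "A ^ 4 * a = A ^ 4 * (c + B ^ 4 / 4)" unfolding 1 jac by (simp add: algebra_simps add_divide_distrib)
  then have 2: "a = c + B ^ 4 / 4" using nz by simp
  have "A * B * C * (a + b + c) = A * B * C * (E / 4)" using R3 unfolding abc by (simp add: algebra_simps)
  then have 3: "a + b + c = E / 4" using nz by simp
  have "E = 4 * (a + b + c)" unfolding 3 by simp
  then have c: "c = (E - A ^ 4 - B ^ 4) / 12" unfolding 1 2 by (simp add: algebra_simps)
  have b: "b = (E + A ^ 4 - C ^ 4) / 12" unfolding 1 c jac by (simp add: field_simps)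
  have a: "a = (E + B ^ 4 + C ^ 4) / 12" unfolding 2 c jac by (simp add: field_simps)
  show "theta_mom (1 / 2) 2 \<tau> 0 = theta2 \<tau> 0 * (eis_E2 \<tau> + theta3 \<tau> 0 ^ 4 + theta4 \<tau> 0 ^ 4) / 12"
    using abc(1) unfolding a unfolding defs by simp
  show "theta_mom 0 2 \<tau> 0 = theta3 \<tau> 0 * (eis_E2 \<tau> + theta2 \<tau> 0 ^ 4 - theta4 \<tau> 0 ^ 4) / 12"
    using abc(2) unfolding b unfolding defs by simp
  show "theta_mom 0 2 \<tau> (1 / 2) = theta4 \<tau> 0 * (eis_E2 \<tau> - theta2 \<tau> 0 ^ 4 - theta3 \<tau> 0 ^ 4) / 12"
    using abc(3) unfolding c unfolding defs by simp
qed

lemma theta_null_fourth_qderiv: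
  "has_qderiv (\<lambda>t. theta2 t 0 ^ 4) (theta2 \<tau> 0 ^ 4 * (eis_E2 \<tau> + theta3 \<tau> 0 ^ 4 + theta4 \<tau> 0 ^ 4) / 6) \<tau>"
  "has_qderiv (\<lambda>t. theta3 t 0 ^ 4) (theta3 \<tau> 0 ^ 4 * (eis_E2 \<tau> + theta2 \<tau> 0 ^ 4 - theta4 \<tau> 0 ^ 4) / 6) \<tau>"
  "has_qderiv (\<lambda>t. theta4 t 0 ^ 4) (theta4 \<tau> 0 ^ 4 * (eis_E2 \<tau> - theta2 \<tau> 0 ^ 4 - theta3 \<tau> 0 ^ 4) / 6) \<tau>"
proof -
  have p: "g * (g ^ 3 * y) = g ^ 4 * y" for g y :: complex
    by (simp add: eval_nat_numeral)
  show "has_qderiv (\<lambda>t. theta2 t 0 ^ 4) (theta2 \<tau> 0 ^ 4 * (eis_E2 \<tau> + theta3 \<tau> 0 ^ 4 + theta4 \<tau> 0 ^ 4) / 6) \<tau>"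
    using has_qderiv_power[OF theta_null_qderiv(1), of 3] unfolding theta_mom_2 by (simp add: p)
  show "has_qderiv (\<lambda>t. theta3 t 0 ^ 4) (theta3 \<tau> 0 ^ 4 * (eis_E2 \<tau> + theta2 \<tau> 0 ^ 4 - theta4 \<tau> 0 ^ 4) / 6) \<tau>"
    using has_qderiv_power[OF theta_null_qderiv(2), of 3] unfolding theta_mom_2 by (simp add: p)
  show "has_qderiv (\<lambda>t. theta4 t 0 ^ 4) (theta4 \<tau> 0 ^ 4 * (eis_E2 \<tau> - theta2 \<tau> 0 ^ 4 - theta3 \<tau> 0 ^ 4) / 6) \<tau>"
    using has_qderiv_power[OF theta_null_qderiv(3), of 3] unfolding theta_mom_2 by (simp add: p)
qed

lemma jtheta_quadruple_fps:
  "Abs_fps (\<lambda>n. 2 ^ n * fps_nth (jtheta_fps \<tau>) n) * fps_const (theta2 \<tau> 0 * theta3 \<tau> 0 * theta4 \<tau> 0) =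
    fps_const 2 * ((jtheta_fps \<tau> * Abs_fps (\<lambda>n. theta_mom (1 / 2) n \<tau> 0 / fact n)) *
     (Abs_fps (\<lambda>n. theta_mom 0 n \<tau> 0 / fact n) * Abs_fps (\<lambda>n. theta_mom 0 n \<tau> (1 / 2) / fact n)))"
proof (rule fps_expansion_unique_complex)
  let ?c = "2 * of_real pi * \<i> :: complex"
  have "((\<lambda>t. jtheta \<tau> (t / ?c)) \<circ> (\<lambda>t. 2 * t)) has_fps_expansion fps_compose (jtheta_fps \<tau>) (fps_const 2 * fps_X)"
    by (rule has_fps_expansion_compose[OF jtheta_fps[OF \<tau>]]) (auto intro!: fps_expansion_intros)
  then have "(\<lambda>t. jtheta \<tau> (2 * (t / ?c))) has_fps_expansion Abs_fps (\<lambda>n. 2 ^ n * fps_nth (jtheta_fps \<tau>) n)"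
    by (simp add: fps_compose_linear o_def)
  then show "(\<lambda>t. jtheta \<tau> (2 * (t / ?c)) * (theta2 \<tau> 0 * theta3 \<tau> 0 * theta4 \<tau> 0)) has_fps_expansion
     Abs_fps (\<lambda>n. 2 ^ n * fps_nth (jtheta_fps \<tau>) n) * fps_const (theta2 \<tau> 0 * theta3 \<tau> 0 * theta4 \<tau> 0)"
    by (rule has_fps_expansion_cmult_right)
  have q: "jtheta \<tau> (2 * z) * (theta2 \<tau> 0 * theta3 \<tau> 0 * theta4 \<tau> 0) =
     2 * ((jtheta \<tau> z * theta_mom (1 / 2) 0 \<tau> (0 + z)) * (theta_mom 0 0 \<tau> (0 + z) * theta_mom 0 0 \<tau> (1 / 2 + z)))" for z
    using jtheta_quadruple[OF \<tau>, of z] by (simp add: theta2_def theta3_def theta4_def mult.assoc add.commute)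
  have "(\<lambda>t. 2 * ((jtheta \<tau> (t / ?c) * theta_mom (1 / 2) 0 \<tau> (0 + t / ?c)) * (theta_mom 0 0 \<tau> (0 + t / ?c) * theta_mom 0 0 \<tau> (1 / 2 + t / ?c))))
    has_fps_expansion fps_const 2 * ((jtheta_fps \<tau> * Abs_fps (\<lambda>n. theta_mom (1 / 2) (0 + n) \<tau> 0 / fact n)) *
     (Abs_fps (\<lambda>n. theta_mom 0 (0 + n) \<tau> 0 / fact n) * Abs_fps (\<lambda>n. theta_mom 0 (0 + n) \<tau> (1 / 2) / fact n)))"
    by (intro has_fps_expansion_cmult_left has_fps_expansion_mult jtheta_fps theta_mom_fps \<tau>)
  then show "(\<lambda>t. jtheta \<tau> (2 * (t / ?c)) * (theta2 \<tau> 0 * theta3 \<tau> 0 * theta4 \<tau> 0)) has_fps_expansion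
    fps_const 2 * ((jtheta_fps \<tau> * Abs_fps (\<lambda>n. theta_mom (1 / 2) n \<tau> 0 / fact n)) *
     (Abs_fps (\<lambda>n. theta_mom 0 n \<tau> 0 / fact n) * Abs_fps (\<lambda>n. theta_mom 0 n \<tau> (1 / 2) / fact n)))"
    unfolding q by simp
qed

text \<open>The coefficient of \<open>t\<^sup>5\<close> in \<open>jtheta_quadruple_fps\<close>. It is the lowest degree that says anything new: degree \<open>1\<close> is a
  tautology and degree \<open>3\<close> is the logarithmic derivative of \<open>2 \<theta>\<^sub>1' = \<theta>\<^sub>2 \<theta>\<^sub>3 \<theta>\<^sub>4\<close>.\<close>

lemma theta_mom_quintic_relation:
  fixes A B C A2 B2 C2 A4 B4 C4 J1 J3 J5 :: complex
  defines "A \<equiv> theta2 \<tau> 0" and "B \<equiv> theta3 \<tau> 0" and "C \<equiv> theta4 \<tau> 0"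
    and "A2 \<equiv> theta_mom (1 / 2) 2 \<tau> 0" and "B2 \<equiv> theta_mom 0 2 \<tau> 0" and "C2 \<equiv> theta_mom 0 2 \<tau> (1 / 2)"
    and "A4 \<equiv> theta_mom (1 / 2) 4 \<tau> 0" and "B4 \<equiv> theta_mom 0 4 \<tau> 0" and "C4 \<equiv> theta_mom 0 4 \<tau> (1 / 2)"
    and "J1 \<equiv> jtheta_mom 1 \<tau>" and "J3 \<equiv> jtheta_mom 3 \<tau>" and "J5 \<equiv> jtheta_mom 5 \<tau>"
  shows "32 * J5 / 120 * (A * B * C) = 2 * (J1 * A * (B4 * C / 24 + B2 * C2 / 4 + B * C4 / 24) +
      (J3 * A / 6 + J1 * A2 / 2) * (B2 * C / 2 + B * C2 / 2) + (J5 * A / 120 + J3 * A2 / 12 + J1 * A4 / 24) * (B * C))"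
proof -
  have sums: "(\<Sum>i=0..1. f i) = f 0 + f 1" "(\<Sum>i=0..2. f i) = f 0 + f 1 + f 2"
    "(\<Sum>i=0..3. f i) = f 0 + f 1 + f 2 + f 3" "(\<Sum>i=0..4. f i) = f 0 + f 1 + f 2 + f 3 + f 4"
    "(\<Sum>i=0..5. f i) = f 0 + f 1 + f 2 + f 3 + f 4 + f 5" for f :: "nat \<Rightarrow> complex"
    by (simp_all add: eval_nat_numeral)
  define F where "F = jtheta_fps \<tau> * Abs_fps (\<lambda>n. theta_mom (1 / 2) n \<tau> 0 / fact n)"
  define G where "G = Abs_fps (\<lambda>n. theta_mom 0 n \<tau> 0 / fact n) * Abs_fps (\<lambda>n. theta_mom 0 n \<tau> (1 / 2) / fact n)"
  have Jn: "fps_nth (jtheta_fps \<tau>) n = jtheta_mom n \<tau> / fact n" for n by (simp add: jtheta_fps_def[OF \<tau>])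
  have A0: "theta_mom (1 / 2) 0 \<tau> 0 = A" "theta_mom 0 0 \<tau> 0 = B" "theta_mom 0 0 \<tau> (1 / 2) = C"
    by (simp_all add: A_def B_def C_def theta2_def theta3_def theta4_def)
  have z: "theta_mom (1 / 2) 1 \<tau> 0 = 0" "theta_mom (1 / 2) 3 \<tau> 0 = 0" "theta_mom (1 / 2) 5 \<tau> 0 = 0"
    "theta_mom 0 1 \<tau> 0 = 0" "theta_mom 0 3 \<tau> 0 = 0" "theta_mom 0 5 \<tau> 0 = 0"
    "theta_mom 0 1 \<tau> (1 / 2) = 0" "theta_mom 0 3 \<tau> (1 / 2) = 0" "theta_mom 0 5 \<tau> (1 / 2) = 0"
    "jtheta_mom 0 \<tau> = 0" "jtheta_mom 2 \<tau> = 0" "jtheta_mom 4 \<tau> = 0"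
    by (simp_all add: theta_mom_half_odd theta_mom_0_odd theta_mom_0_half_odd jtheta_mom_even)
  note z' = z[unfolded One_nat_def]
  have G0: "fps_nth G 0 = B * C" by (simp add: G_def A0)
  have G2: "fps_nth G 2 = B2 * C / 2 + B * C2 / 2"
    unfolding G_def fps_mult_nth sums by (simp add: A0 z' B2_def C2_def)
  have G4: "fps_nth G 4 = B4 * C / 24 + B2 * C2 / 4 + B * C4 / 24"
    unfolding G_def fps_mult_nth sums by (simp add: A0 z' B2_def C2_def B4_def C4_def fact_numeral)
  have G1: "fps_nth G 1 = 0" "fps_nth G 3 = 0" "fps_nth G 5 = 0"
    unfolding G_def fps_mult_nth sums by (simp_all add: z')
  have F0: "fps_nth F 0 = 0" "fps_nth F 2 = 0" "fps_nth F 4 = 0"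
    unfolding F_def fps_mult_nth sums by (simp_all add: z' Jn)
  have F1: "fps_nth F 1 = J1 * A"
    unfolding F_def fps_mult_nth sums by (simp add: z' Jn A0 J1_def)
  have F3: "fps_nth F 3 = J3 * A / 6 + J1 * A2 / 2"
    unfolding F_def fps_mult_nth sums by (simp add: z' Jn A0 J1_def J3_def A2_def fact_numeral)
  have F5: "fps_nth F 5 = J5 * A / 120 + J3 * A2 / 12 + J1 * A4 / 24"
    unfolding F_def fps_mult_nth sums by (simp add: z' Jn A0 J1_def J3_def J5_def A2_def A4_def fact_numeral)
  have "fps_nth (Abs_fps (\<lambda>n. 2 ^ n * fps_nth (jtheta_fps \<tau>) n) * fps_const (A * B * C)) 5 = fps_nth (fps_const 2 * (F * G)) 5"
    unfolding F_def G_def A_def B_def C_def jtheta_quadruple_fps ..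
  then have "32 * J5 / 120 * (A * B * C) = 2 * fps_nth (F * G) 5"
    by (simp add: Jn J5_def fact_numeral)
  also have "fps_nth (F * G) 5 = fps_nth F 1 * fps_nth G 4 + fps_nth F 3 * fps_nth G 2 + fps_nth F 5 * fps_nth G 0"
    unfolding fps_mult_nth sums using F0 G1 by simp
  finally show ?thesis unfolding F1 F3 F5 G0 G2 G4 .
qed

end

text \<open>Differentiating \<open>\<theta>'' = \<theta> g / 12\<close> once more in \<open>\<tau>\<close>, where \<open>g\<close> is the combination found in \<open>theta_mom_2\<close>.\<close>

lemma theta_mom_4:
  assumes \<tau>: "Im \<tau> > 0"
  defines "x \<equiv> theta2 \<tau> 0 ^ 4" and "y \<equiv> theta4 \<tau> 0 ^ 4" and "w \<equiv> theta3 \<tau> 0 ^ 4"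
    and "E \<equiv> eis_E2 \<tau>" and "DE \<equiv> (eis_E2 \<tau> ^ 2 - eis_E4 \<tau>) / 12"
  shows "theta_mom (1 / 2) 4 \<tau> 0 = theta2 \<tau> 0 * (((E + w + y) / 12)\<^sup>2 + (DE + w * (E + x - y) / 6 + y * (E - x - w) / 6) / 6)"
    and "theta_mom 0 4 \<tau> 0 = theta3 \<tau> 0 * (((E + x - y) / 12)\<^sup>2 + (DE + x * (E + w + y) / 6 - y * (E - x - w) / 6) / 6)"
    and "theta_mom 0 4 \<tau> (1 / 2) = theta4 \<tau> 0 * (((E - x - w) / 12)\<^sup>2 + (DE - x * (E + w + y) / 6 - w * (E + x - y) / 6) / 6)"
proof -
  note ds = theta_null_fourth_qderiv[OF \<tau>, folded x_def y_def w_def E_def] ramanujan_E2[OF \<tau>, folded DE_def]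
  note dn = theta_null_qderiv[OF \<tau>]
  have m: "has_qderiv (\<lambda>t. theta_mom a 2 t z) (theta_mom a 4 \<tau> z / 2) \<tau>" for a z
    using has_qderiv_theta_mom[OF \<tau>, of a 2 z] by simp
  have gen: "theta_mom a 4 \<tau> z = th \<tau> * ((g \<tau> / 12)\<^sup>2 + dg / 6)"
    if th: "has_qderiv th (theta_mom a 2 \<tau> z / 2) \<tau>"
      and g: "has_qderiv g dg \<tau>"
      and eq: "\<And>t. Im t > 0 \<Longrightarrow> theta_mom a 2 t z = th t * g t / 12" for a z th g dg
  proof -
    have "has_qderiv (\<lambda>t. 1 / 12 * (th t * g t)) (1 / 12 * (theta_mom a 2 \<tau> z / 2 * g \<tau> + th \<tau> * dg)) \<tau>"
      by (intro has_qderiv_cmult has_qderiv_mult th g)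
    then have "has_qderiv (\<lambda>t. theta_mom a 2 t z) (1 / 12 * (theta_mom a 2 \<tau> z / 2 * g \<tau> + th \<tau> * dg)) \<tau>"
      by (rule has_qderiv_transform[OF _ \<tau>]) (simp add: eq)
    with m have "theta_mom a 4 \<tau> z / 2 = 1 / 12 * (theta_mom a 2 \<tau> z / 2 * g \<tau> + th \<tau> * dg)"
      by (rule has_qderiv_unique)
    then show ?thesis unfolding eq[OF \<tau>] by (simp add: field_simps power2_eq_square)
  qed
  have "has_qderiv (\<lambda>t. eis_E2 t + theta3 t 0 ^ 4 + theta4 t 0 ^ 4) (DE + w * (E + x - y) / 6 + y * (E - x - w) / 6) \<tau>"
    by (intro has_qderiv_add ds)
  from gen[OF dn(1) this theta_mom_2(1)]
  show "theta_mom (1 / 2) 4 \<tau> 0 = theta2 \<tau> 0 * (((E + w + y) / 12)\<^sup>2 + (DE + w * (E + x - y) / 6 + y * (E - x - w) / 6) / 6)"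
    by (simp add: x_def y_def w_def E_def)
  have "has_qderiv (\<lambda>t. eis_E2 t + theta2 t 0 ^ 4 - theta4 t 0 ^ 4) (DE + x * (E + w + y) / 6 - y * (E - x - w) / 6) \<tau>"
    by (intro has_qderiv_add has_qderiv_diff ds)
  from gen[OF dn(2) this theta_mom_2(2)]
  show "theta_mom 0 4 \<tau> 0 = theta3 \<tau> 0 * (((E + x - y) / 12)\<^sup>2 + (DE + x * (E + w + y) / 6 - y * (E - x - w) / 6) / 6)"
    by (simp add: x_def y_def w_def E_def)
  have "has_qderiv (\<lambda>t. eis_E2 t - theta2 t 0 ^ 4 - theta3 t 0 ^ 4) (DE - x * (E + w + y) / 6 - w * (E + x - y) / 6) \<tau>"
    by (intro has_qderiv_add has_qderiv_diff ds)
  from gen[OF dn(3) this theta_mom_2(3)]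
  show "theta_mom 0 4 \<tau> (1 / 2) = theta4 \<tau> 0 * (((E - x - w) / 12)\<^sup>2 + (DE - x * (E + w + y) / 6 - w * (E + x - y) / 6) / 6)"
    by (simp add: x_def y_def w_def E_def)
qed

text \<open>In the degree-five relation \<open>E\<^sub>4\<close> enters through \<open>D E\<^sub>2\<close> and through \<open>\<mu>\<^sub>5\<close>, with total coefficient different from
  zero, while \<open>E\<^sub>2\<close> drops out.\<close>

lemma eis_E4_theta:
  assumes \<tau>: "Im \<tau> > 0"
  shows "eis_E4 \<tau> = theta2 \<tau> 0 ^ 8 + theta2 \<tau> 0 ^ 4 * theta4 \<tau> 0 ^ 4 + theta4 \<tau> 0 ^ 8"
proof -
  define A B C x y w E F J where "A = theta2 \<tau> 0" and "B = theta3 \<tau> 0" and "C = theta4 \<tau> 0"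
    and "x = theta2 \<tau> 0 ^ 4" and "y = theta4 \<tau> 0 ^ 4" and "w = theta3 \<tau> 0 ^ 4"
    and "E = eis_E2 \<tau>" and "F = eis_E4 \<tau>" and "J = jtheta_mom 1 \<tau>"
  note defs = A_def B_def C_def x_def y_def w_def E_def F_def J_def
  have nz: "A \<noteq> 0" "B \<noteq> 0" "C \<noteq> 0" "J \<noteq> 0" using theta_null_nonzero[OF \<tau>] jtheta_mom_nonzero[OF \<tau>] unfolding defs .
  have w: "w = x + y" unfolding defs by (rule theta_null_quartic[OF \<tau>])
  define a b c where "a = (E + w + y) / 12" and "b = (E + x - y) / 12" and "c = (E - x - w) / 12"
  define a4 b4 c4 where "a4 = a\<^sup>2 + ((E\<^sup>2 - F) / 12 + w * (E + x - y) / 6 + y * (E - x - w) / 6) / 6"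
    and "b4 = b\<^sup>2 + ((E\<^sup>2 - F) / 12 + x * (E + w + y) / 6 - y * (E - x - w) / 6) / 6"
    and "c4 = c\<^sup>2 + ((E\<^sup>2 - F) / 12 - x * (E + w + y) / 6 - w * (E + x - y) / 6) / 6"
  have m2: "theta_mom (1 / 2) 2 \<tau> 0 = A * a" "theta_mom 0 2 \<tau> 0 = B * b" "theta_mom 0 2 \<tau> (1 / 2) = C * c"
    unfolding theta_mom_2[OF \<tau>] by (simp_all add: a_def b_def c_def defs)
  have m4: "theta_mom (1 / 2) 4 \<tau> 0 = A * a4" "theta_mom 0 4 \<tau> 0 = B * b4" "theta_mom 0 4 \<tau> (1 / 2) = C * c4"
    unfolding theta_mom_4[OF \<tau>] a4_def b4_def c4_def a_def b_def c_def defs by (rule refl)+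
  have j: "jtheta_mom 3 \<tau> = J * E / 4" "jtheta_mom 5 \<tau> = J * (5 * E\<^sup>2 - 2 * F) / 48"
    unfolding jtheta_mom_eis[OF \<tau>] defs by (rule refl)+
  have "(A * B * C * J) * (32 * ((5 * E\<^sup>2 - 2 * F) / 48) / 120) = (A * B * C * J) * (2 * (b4 / 24 + b * c / 4 + c4 / 24 +
      (E / 24 + a / 2) * (b / 2 + c / 2) + ((5 * E\<^sup>2 - 2 * F) / 48 / 120 + E / 4 * a / 12 + a4 / 24)))"
    using theta_mom_quintic_relation[OF \<tau>] unfolding m2 m4 j A_def[symmetric] B_def[symmetric] C_def[symmetric] J_def[symmetric]
    by (simp add: field_simps)
  then have eq: "32 * ((5 * E\<^sup>2 - 2 * F) / 48) / 120 = 2 * (b4 / 24 + b * c / 4 + c4 / 24 +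
      (E / 24 + a / 2) * (b / 2 + c / 2) + ((5 * E\<^sup>2 - 2 * F) / 48 / 120 + E / 4 * a / 12 + a4 / 24))"
    using nz by simp
  \<comment> \<open>The difference of the two sides of the relation is a multiple of \<open>x\<^sup>2 + x y + y\<^sup>2 - E\<^sub>4\<close>.\<close>
  have "32 * ((5 * E\<^sup>2 - 2 * F) / 48) / 120 - 2 * (b4 / 24 + b * c / 4 + c4 / 24 +
      (E / 24 + a / 2) * (b / 2 + c / 2) + ((5 * E\<^sup>2 - 2 * F) / 48 / 120 + E / 4 * a / 12 + a4 / 24)) =
      (x\<^sup>2 + x * y + y\<^sup>2 - F) / 144"
    unfolding a4_def b4_def c4_def a_def b_def c_def w by (simp add: field_simps power2_eq_square)
  then have "F = x\<^sup>2 + x * y + y\<^sup>2" unfolding eq by simp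
  then show ?thesis by (simp add: defs flip: power_mult)
qed

text \<open>Ramanujan's equation for \<open>D E\<^sub>4\<close>, evaluated on the polynomial \<open>x\<^sup>2 + x y + y\<^sup>2\<close>.\<close>

lemma eis_E6_theta:
  assumes \<tau>: "Im \<tau> > 0"
  defines "x \<equiv> theta2 \<tau> 0 ^ 4" and "y \<equiv> theta4 \<tau> 0 ^ 4"
  shows "eis_E6 \<tau> = (2 * x + y) * (x + 2 * y) * (y - x) / 2"
proof -
  define E where "E = eis_E2 \<tau>"
  have w: "theta3 \<tau> 0 ^ 4 = x + y" unfolding x_def y_def by (rule theta_null_quartic[OF \<tau>])
  note ds = theta_null_fourth_qderiv[OF \<tau>, unfolded w, folded x_def y_def E_def]
  let ?X = "\<lambda>t. theta2 t 0 ^ 4" and ?Y = "\<lambda>t. theta4 t 0 ^ 4"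
  let ?dx = "x * (E + (x + y) + y) / 6" and ?dy = "y * (E - x - (x + y)) / 6"
  have "has_qderiv (\<lambda>t. ?X t * ?X t + ?X t * ?Y t + ?Y t * ?Y t) ((?dx * x + x * ?dx) + (?dx * y + x * ?dy) + (?dy * y + y * ?dy)) \<tau>"
    unfolding x_def y_def
    by (intro has_qderiv_add has_qderiv_mult ds[unfolded x_def y_def])
  then have "has_qderiv eis_E4 ((?dx * x + x * ?dx) + (?dx * y + x * ?dy) + (?dy * y + y * ?dy)) \<tau>"
    by (rule has_qderiv_transform[OF _ \<tau>]) (simp add: eis_E4_theta flip: power_add)
  then have "(E * eis_E4 \<tau> - eis_E6 \<tau>) / 3 = (?dx * x + x * ?dx) + (?dx * y + x * ?dy) + (?dy * y + y * ?dy)"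
    using ramanujan_E4[OF \<tau>, folded E_def] has_qderiv_unique by blast
  moreover have "eis_E4 \<tau> = x * x + x * y + y * y"
    unfolding eis_E4_theta[OF \<tau>] x_def y_def by (simp flip: power_add)
  moreover have "b = a - 3 * r" if "(a - b) / 3 = r" for a b r :: complex
    using that by (auto simp: field_simps)
  ultimately have "eis_E6 \<tau> = E * (x * x + x * y + y * y) - 3 * ((?dx * x + x * ?dx) + (?dx * y + x * ?dy) + (?dy * y + y * ?dy))"
    by metis
  also have "\<dots> = (2 * x + y) * (x + 2 * y) * (y - x) / 2" by (simp add: field_simps)
  finally show ?thesis .
qed

section \<open>Theta series of even unimodular lattices\<close>

lemma infsum_prod_UNIV:
  fixes f :: "'n::finite \<Rightarrow> int \<Rightarrow> complex"
  assumes "\<And>i. (\<lambda>n. norm (f i n)) summable_on UNIV"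
  shows "((\<lambda>m. \<Prod>i\<in>UNIV. f i (m i)) has_sum (\<Prod>i\<in>UNIV. \<Sum>\<^sub>\<infinity>n. f i n)) UNIV"
proof -
  have P: "PiE (UNIV :: 'n set) (\<lambda>_. UNIV :: int set) = UNIV" by auto
  have "Infinite_Set_Sum.abs_summable_on (\<lambda>m. \<Prod>i\<in>UNIV. f i (m i)) (PiE UNIV (\<lambda>_. UNIV))"
    by (rule abs_summable_on_prod_PiE) (use assms in \<open>auto simp: abs_summable_equivalent[symmetric]\<close>)
  then have "(\<lambda>m. norm (\<Prod>i\<in>UNIV. f i (m i))) summable_on UNIV"
    unfolding P abs_summable_equivalent[symmetric] .
  then have "(\<lambda>m. \<Prod>i\<in>UNIV. f i (m i)) summable_on UNIV" by (rule abs_summable_summable)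
  moreover have "(\<Sum>\<^sub>\<infinity>m. \<Prod>i\<in>UNIV. f i (m i)) = (\<Prod>i\<in>UNIV. \<Sum>\<^sub>\<infinity>n. f i n)"
    using infsum_prod_PiE_abs[of UNIV f "\<lambda>_. UNIV"] assms unfolding P by simp
  ultimately show ?thesis by (metis has_sum_infsum)
qed

text \<open>The parity condition is imposed by the average of the characters \<open>1\<close> and \<open>(-1)\<^sup>\<Sum>\<^sup>m\<close>, both of which are
  multiplicative over the coordinates.\<close>

lemma has_sum_even_part:
  fixes f :: "'n::finite \<Rightarrow> int \<Rightarrow> complex"
  assumes f: "\<And>i. (\<lambda>n. norm (f i n)) summable_on UNIV"
  shows "((\<lambda>m. \<Prod>i\<in>UNIV. f i (m i)) has_sum
     (((\<Prod>i\<in>UNIV. \<Sum>\<^sub>\<infinity>n. f i n) + (\<Prod>i\<in>UNIV. \<Sum>\<^sub>\<infinity>n. (- 1) powi n * f i n)) / 2)) {m. even (\<Sum>i\<in>UNIV. m i)}"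
proof -
  have g: "(\<lambda>n. norm ((- 1) powi n * f i n)) summable_on UNIV" for i
    using f by (simp add: norm_mult norm_power_int)
  have e: "(\<Prod>i\<in>UNIV. (- 1) powi (m i) * f i (m i)) = (if even (\<Sum>i\<in>UNIV. m i) then 1 else - 1) * (\<Prod>i\<in>UNIV. f i (m i))" for m
  proof -
    have "(\<Prod>i\<in>A. (- 1 :: complex) powi (m i)) = (- 1) powi (\<Sum>i\<in>A. m i)" if "finite A" for A
      using that by (induction A rule: finite_induct) (auto simp: power_int_add)
    then show ?thesis by (simp add: prod.distrib power_int_minus_left)
  qed
  have "((\<lambda>m. ((\<Prod>i\<in>UNIV. f i (m i)) + (\<Prod>i\<in>UNIV. (- 1) powi (m i) * f i (m i))) * (1 / 2)) has_sum
     ((\<Prod>i\<in>UNIV. \<Sum>\<^sub>\<infinity>n. f i n) + (\<Prod>i\<in>UNIV. \<Sum>\<^sub>\<infinity>n. (- 1) powi n * f i n)) * (1 / 2)) UNIV"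
    by (intro has_sum_cmult_left has_sum_add infsum_prod_UNIV f g)
  then show ?thesis
    by (subst has_sum_cong_neutral[where T = UNIV and g = "\<lambda>m. ((\<Prod>i\<in>UNIV. f i (m i)) + (\<Prod>i\<in>UNIV. (- 1) powi (m i) * f i (m i))) * (1 / 2)"])
      (auto simp: e)
qed

lemma D_lattice_diff: "x \<in> D_lattice \<Longrightarrow> y \<in> D_lattice \<Longrightarrow> x - y \<in> D_lattice"
proof -
  assume "x \<in> D_lattice" "y \<in> D_lattice"
  then obtain m m' where "\<And>i. x $ i = of_int (m i)" "even (\<Sum>i\<in>UNIV. m i)"
    "\<And>i. y $ i = of_int (m' i)" "even (\<Sum>i\<in>UNIV. m' i)" unfolding D_lattice_def by auto
  then show ?thesis unfolding D_lattice_def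
    by (auto intro!: exI[of _ "\<lambda>i. m i - m' i"] simp: sum_subtractf)
qed

lemma D_lattice_0: "0 \<in> D_lattice"
  unfolding D_lattice_def by (auto intro!: exI[of _ "\<lambda>i. 0"])

text \<open>In even dimension twice the glue vector \<open>(1/2, \<dots>, 1/2)\<close> lies in \<open>D\<^sub>n\<close>, so two cosets suffice.\<close>

lemma D_plus_lattice_eq:
  assumes "even CARD('n::finite)"
  shows "(D_plus_lattice :: (real ^ 'n) set) = D_lattice \<union> (\<lambda>x. x + (\<chi> i. 1 / 2)) ` D_lattice"
proof -
  let ?h = "(\<chi> i. 1 / 2) :: real ^ 'n"
  have one: "?h + ?h \<in> D_lattice"
    unfolding D_lattice_def using assms by (auto intro!: exI[of _ "\<lambda>i. 1"])
  show ?thesis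
  proof (intro equalityI subsetI)
    fix x :: "real ^ 'n" assume "x \<in> D_plus_lattice"
    then show "x \<in> D_lattice \<union> (\<lambda>x. x + ?h) ` D_lattice"
      unfolding D_plus_lattice_def
    proof (induction rule: group_closure.induct)
      case (base s)
      have "?h \<in> (\<lambda>x. x + ?h) ` D_lattice" using D_lattice_0 by force
      then show ?case using base D_lattice_0 by auto
    next
      case (diff s t)
      have "s - (t' + ?h) = (s - t' - (?h + ?h)) + ?h" for t' by simp
      then have 1: "s \<in> D_lattice \<Longrightarrow> t' \<in> D_lattice \<Longrightarrow> s - (t' + ?h) \<in> (\<lambda>x. x + ?h) ` D_lattice" for t'
        using D_lattice_diff one by (metis (no_types, lifting) imageI)
      have "(s' + ?h) - t = (s' - t) + ?h" for s' by simp
      then have 2: "s' \<in> D_lattice \<Longrightarrow> t \<in> D_lattice \<Longrightarrow> (s' + ?h) - t \<in> (\<lambda>x. x + ?h) ` D_lattice" for s'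
        using D_lattice_diff by (metis (no_types, lifting) imageI)
      have 3: "s' \<in> D_lattice \<Longrightarrow> t' \<in> D_lattice \<Longrightarrow> (s' + ?h) - (t' + ?h) \<in> D_lattice" for s' t'
        using D_lattice_diff by simp
      from diff.IH show ?case using 1 2 3 D_lattice_diff by blast
    qed
  next
    fix x :: "real ^ 'n" assume "x \<in> D_lattice \<union> (\<lambda>x. x + ?h) ` D_lattice"
    then show "x \<in> D_plus_lattice" unfolding D_plus_lattice_def
      by (auto intro!: group_closure_add intro: group_closure.base)
  qed
qed

lemma lattice_theta_term:
  fixes z :: "complex ^ 'n::finite" and l :: "real ^ 'n"
  shows "e2pi (of_real (l \<bullet> l) / 2 * \<tau>) * e2pi (\<Sum>i\<in>UNIV. z $ i * of_real (l $ i)) =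
    (\<Prod>i\<in>UNIV. theta_term 0 \<tau> (z $ i) (l $ i))"
proof -
  have "(\<Prod>i\<in>A. theta_term 0 \<tau> (z $ i) (l $ i)) =
    e2pi (\<Sum>i\<in>A. of_real ((l $ i)\<^sup>2) / 2 * \<tau> + of_real (l $ i) * z $ i)" if "finite A" for A
    using that by (induction A rule: finite_induct) (auto simp: e2pi_add theta_term_def)
  then show ?thesis
    by (simp add: e2pi_add[symmetric] inner_vec_def sum.distrib sum_distrib_left sum_divide_distrib power2_eq_square mult_ac add.commute)
qed

lemma D_lattice_image: "D_lattice = (\<lambda>m. (\<chi> i. of_int (m i)) :: real ^ 'n::finite) ` {m. even (\<Sum>i\<in>UNIV. m i)}"
  unfolding D_lattice_def by (auto simp: vec_eq_iff image_iff)

text \<open>The character \<open>(-1)\<^sup>n\<close> becomes a shift of \<open>z\<close> by \<open>1/2\<close>; on the coset with offset \<open>a\<close> this leaves the phase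
  \<open>exp (- \<pi> \<i> a)\<close>, which for \<open>a = 1/2\<close> is the \<open>- \<i>\<close> in \<open>\<theta>\<^sub>1\<close>.\<close>

lemma has_sum_D_coset:
  fixes z :: "complex ^ 'n::finite"
  assumes \<tau>: "Im \<tau> > 0"
  shows "((\<lambda>l. e2pi (of_real (l \<bullet> l) / 2 * \<tau>) * e2pi (\<Sum>i\<in>UNIV. z $ i * of_real (l $ i))) has_sum
    (((\<Prod>i\<in>UNIV. theta_mom a 0 \<tau> (z $ i)) + (\<Prod>i\<in>UNIV. e2pi (- of_real a / 2) * theta_mom a 0 \<tau> (z $ i + 1 / 2))) / 2))
    ((\<lambda>x. x + (\<chi> i. a)) ` D_lattice)"
proof -
  let ?f = "\<lambda>l :: real ^ 'n. e2pi (of_real (l \<bullet> l) / 2 * \<tau>) * e2pi (\<Sum>i\<in>UNIV. z $ i * of_real (l $ i))"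
  let ?v = "\<lambda>m. (\<chi> i. of_int (m i)) + (\<chi> i. a) :: real ^ 'n"
  have inj: "inj_on ?v {m. even (\<Sum>i\<in>UNIV. m i)}"
    by (auto simp: inj_on_def vec_eq_iff fun_eq_iff)
  have im: "(\<lambda>x. x + (\<chi> i. a)) ` D_lattice = ?v ` {m. even (\<Sum>i\<in>UNIV. m i)}"
    unfolding D_lattice_image by (simp add: image_image)
  have f: "(?f \<circ> ?v) = (\<lambda>m. \<Prod>i\<in>UNIV. theta_term 0 \<tau> (z $ i) (of_int (m i) + a))"
    unfolding o_def lattice_theta_term by simp
  have "(\<Sum>\<^sub>\<infinity>n. (- 1) powi n * theta_term 0 \<tau> w (of_int n + a)) = e2pi (- of_real a / 2) * theta_mom a 0 \<tau> (w + 1 / 2)" for w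
  proof -
    have "e2pi (of_real (of_int n + a) / 2) = e2pi (of_real a / 2) * (- 1) powi n" for n
      unfolding e2pi_half_int[symmetric] e2pi_add[symmetric] by (rule arg_cong[where f = e2pi]) (simp add: add_divide_distrib add.commute)
    moreover have "e2pi (- of_real a / 2) * e2pi (of_real a / 2) = 1"
      unfolding e2pi_add[symmetric] by simp
    ultimately have "(- 1) powi n * theta_term 0 \<tau> w (of_int n + a) = e2pi (- of_real a / 2) * theta_term 0 \<tau> (w + 1 / 2) (of_int n + a)" for n
      unfolding theta_term_half_shift by (simp add: mult.assoc[symmetric])
    then show ?thesis by (simp add: theta_mom_def infsum_cmult_right')
  qed
  then show ?thesis
    unfolding im has_sum_reindex[OF inj] f
    using has_sum_even_part[of "\<lambda>i n. theta_term 0 \<tau> (z $ i) (of_int n + a)", OF theta_term_abs_summable[OF \<tau>]]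
    by (simp add: theta_mom_def[symmetric])
qed

lemma lattice_theta_D_plus:
  fixes z :: "complex ^ 'n::finite"
  assumes \<tau>: "Im \<tau> > 0" and ev: "even CARD('n)"
  shows "lattice_theta D_plus_lattice \<tau> z = 1 / 2 * ((\<Prod>i\<in>UNIV. theta3 \<tau> (z $ i)) + (\<Prod>i\<in>UNIV. theta4 \<tau> (z $ i))
     + (\<Prod>i\<in>UNIV. theta2 \<tau> (z $ i)) + (\<Prod>i\<in>UNIV. jtheta \<tau> (z $ i)))"
proof -
  have disj: "D_lattice \<inter> (\<lambda>x. x + ((\<chi> i. 1 / 2) :: real ^ 'n)) ` D_lattice = {}"
  proof -
    have nn: "of_int m' + 1 / 2 \<noteq> (of_int m :: real)" for m m'
    proof
      assume "of_int m' + 1 / 2 = (of_int m :: real)"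
      then have "of_int (2 * m) = (of_int (2 * m' + 1) :: real)" by simp
      then have "2 * m = 2 * m' + 1" by (simp only: of_int_eq_iff)
      then show False by presburger
    qed
    then show ?thesis unfolding D_lattice_def by (auto simp: vec_eq_iff)
  qed
  have e: "e2pi (- of_real (1 / 2) / 2) = - \<i>" using e2pi_minus[of "1 / 4"] by simp
  have j: "e2pi (- of_real (1 / 2) / 2) * theta_mom (1 / 2) 0 \<tau> (w + 1 / 2) = jtheta \<tau> w" for w
    unfolding e jtheta_eq_theta_mom ..
  have z0: "(\<lambda>x. x + (\<chi> i. 0)) = (\<lambda>x :: real ^ 'n. x)" by (auto simp: vec_eq_iff fun_eq_iff)
  note 0 = has_sum_D_coset[OF \<tau>, of z 0, unfolded z0]
  note 1 = has_sum_D_coset[OF \<tau>, of z "1 / 2", unfolded j]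
  show ?thesis unfolding lattice_theta_def D_plus_lattice_eq[OF ev]
    using infsumI[OF has_sum_Un_disjoint[OF 0[simplified image_ident] 1 disj]]
    by (simp add: theta2_def theta3_def theta4_def add_divide_distrib)
qed

lemma theta_E8_eq:
  assumes "Im \<tau> > 0"
  shows "theta_E8 \<tau> z = 1 / 2 * ((\<Prod>i\<in>UNIV. theta3 \<tau> (z $ i)) + (\<Prod>i\<in>UNIV. theta4 \<tau> (z $ i))
     + (\<Prod>i\<in>UNIV. theta2 \<tau> (z $ i)) + (\<Prod>i\<in>UNIV. jtheta \<tau> (z $ i)))"
  unfolding theta_E8_def by (rule lattice_theta_D_plus[OF assms]) simp

lemma prod_sum_type: "(\<Prod>i\<in>(UNIV :: ('a::finite + 'b::finite) set). f i) = (\<Prod>i\<in>UNIV. f (Inl i)) * (\<Prod>i\<in>UNIV. f (Inr i))"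
proof -
  have U: "(UNIV :: ('a + 'b) set) = range Inl \<union> range Inr" by (auto intro: sum.exhaust) (metis rangeI sum.exhaust)
  show ?thesis unfolding U by (subst prod.union_disjoint) (auto simp: prod.reindex)
qed

lemma theta_D16_plus_restricted_eq:
  assumes "Im \<tau> > 0"
  shows "theta_D16_plus_restricted \<tau> z = 1 / 2 * ((\<Prod>i\<in>UNIV. theta3 \<tau> (z $ i)) * theta3 \<tau> 0 ^ 8 + (\<Prod>i\<in>UNIV. theta4 \<tau> (z $ i)) * theta4 \<tau> 0 ^ 8
     + (\<Prod>i\<in>UNIV. theta2 \<tau> (z $ i)) * theta2 \<tau> 0 ^ 8)"
proof -
  have "even CARD(8 + 8)" by simp
  show ?thesis unfolding theta_D16_plus_restricted_def lattice_theta_D_plus[OF assms \<open>even CARD(8 + 8)\<close>]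
    by (simp add: prod_sum_type)
qed

section \<open>The modular differential operator on theta products\<close>

text \<open>The products \<open>P\<^sub>j\<close>: the pairs \<open>(a, b) = (1/2, 0)\<close>, \<open>(0, 0)\<close>, \<open>(0, 1/2)\<close> stand for \<open>j = 2, 3, 4\<close>.\<close>

definition theta_prod :: "real \<Rightarrow> complex \<Rightarrow> complex \<Rightarrow> complex ^ 8 \<Rightarrow> complex" where
  "theta_prod a b \<tau> z = (\<Prod>i\<in>UNIV. theta_mom a 0 \<tau> (z $ i + b))"

text \<open>The product with its \<open>i\<close>-th factor replaced by its second derivative in the variable \<open>2 \<pi> \<i> z\<^sub>i\<close>.\<close>

definition theta_prod_d :: "real \<Rightarrow> complex \<Rightarrow> complex \<Rightarrow> complex ^ 8 \<Rightarrow> 8 \<Rightarrow> complex" where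
  "theta_prod_d a b \<tau> z i = theta_mom a 2 \<tau> (z $ i + b) * (\<Prod>l\<in>UNIV - {i}. theta_mom a 0 \<tau> (z $ l + b))"

lemma theta_prod_eqs:
  "theta_prod (1 / 2) 0 \<tau> z = (\<Prod>i\<in>UNIV. theta2 \<tau> (z $ i))"
  "theta_prod 0 0 \<tau> z = (\<Prod>i\<in>UNIV. theta3 \<tau> (z $ i))"
  "theta_prod 0 (1 / 2) \<tau> z = (\<Prod>i\<in>UNIV. theta4 \<tau> (z $ i))"
  by (simp_all add: theta_prod_def theta2_def theta3_def theta4_def)

lemma theta_prod_qderiv:
  assumes "Im \<tau> > 0"
  shows "has_qderiv (\<lambda>t. theta_prod a b t z) ((\<Sum>i\<in>UNIV. theta_prod_d a b \<tau> z i) / 2) \<tau>"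
proof -
  have m: "((\<lambda>t. theta_mom a 0 t w) has_field_derivative 2 * of_real pi * \<i> * (theta_mom a 2 \<tau> w / 2)) (at \<tau>)" for w
    using has_qderiv_theta_mom[OF assms, of a 0 w] unfolding has_qderiv_def by (simp add: numeral_2_eq_2)
  have "((\<lambda>t. \<Prod>i\<in>UNIV. theta_mom a 0 t (z $ i + b)) has_field_derivative
     (\<Sum>i\<in>UNIV. (2 * of_real pi * \<i> * (theta_mom a 2 \<tau> (z $ i + b) / 2)) * (\<Prod>l\<in>UNIV - {i}. theta_mom a 0 \<tau> (z $ l + b)))) (at \<tau>)"
    by (rule has_field_derivative_prod) (rule m)
  moreover have "(\<Sum>i\<in>UNIV. (2 * of_real pi * \<i> * (theta_mom a 2 \<tau> (z $ i + b) / 2)) * (\<Prod>l\<in>UNIV - {i}. theta_mom a 0 \<tau> (z $ l + b)))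
     = 2 * of_real pi * \<i> * ((\<Sum>i\<in>UNIV. theta_prod_d a b \<tau> z i) / 2)"
    by (simp add: theta_prod_d_def sum_distrib_left sum_divide_distrib mult.assoc)
  ultimately show ?thesis by (simp only: has_qderiv_def theta_prod_def)
qed

lemma theta_prod_update:
  "theta_prod a b \<tau> (\<chi> j. if j = i then w else z $ j) =
    theta_mom a 0 \<tau> (w + b) * (\<Prod>l\<in>UNIV - {i}. theta_mom a 0 \<tau> (z $ l + b))"
proof -
  define F where "F l = theta_mom a 0 \<tau> ((\<chi> j. if j = i then w else z $ j) $ l + b)" for l
  have 1: "theta_prod a b \<tau> (\<chi> j. if j = i then w else z $ j) = prod F UNIV"
    unfolding theta_prod_def F_def ..
  have 2: "prod F UNIV = F i * prod F (UNIV - {i})"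
    by (rule prod.remove[OF finite UNIV_I])
  have 3: "prod F (UNIV - {i}) = (\<Prod>l\<in>UNIV - {i}. theta_mom a 0 \<tau> (z $ l + b))"
    by (intro prod.cong refl) (simp add: F_def)
  have 4: "F i = theta_mom a 0 \<tau> (w + b)" unfolding F_def by simp
  show ?thesis unfolding 1 2 3 4 ..
qed

lemma theta_mom_shift_deriv:
  assumes "Im \<tau> > 0"
  shows "((\<lambda>w. theta_mom a k \<tau> (w + b)) has_field_derivative 2 * of_real pi * \<i> * theta_mom a (Suc k) \<tau> (w + b)) (at w)"
proof -
  have "((\<lambda>w. w + b) has_field_derivative 1) (at w)" by (auto intro!: derivative_eq_intros)
  from theta_mom_deriv_z_chain[OF assms this] show ?thesis by simp
qed

text \<open>The sums of \<open>theta_prod_d\<close> coming from \<open>\<partial>/\<partial>\<tau>\<close> and from the Laplacian cancel; what is left is the Serre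
  derivative in weight \<open>k - 4\<close>, because \<open>(2 k - 8) G\<^sub>2 = - (k - 4)/12 E\<^sub>2\<close>.\<close>

lemma heat_op_theta_combination:
  assumes \<tau>: "Im \<tau> > 0"
    and \<phi>: "\<And>t z. Im t > 0 \<Longrightarrow> \<phi> t z = f t * theta_prod (1 / 2) 0 t z + g t * theta_prod 0 0 t z + h t * theta_prod 0 (1 / 2) t z"
    and d: "has_qderiv f df \<tau>" "has_qderiv g dg \<tau>" "has_qderiv h dh \<tau>"
  shows "heat_op k \<phi> \<tau> z =
      (df - of_int (k - 4) / 12 * eis_E2 \<tau> * f \<tau>) * theta_prod (1 / 2) 0 \<tau> z +
      (dg - of_int (k - 4) / 12 * eis_E2 \<tau> * g \<tau>) * theta_prod 0 0 \<tau> z +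
      (dh - of_int (k - 4) / 12 * eis_E2 \<tau> * h \<tau>) * theta_prod 0 (1 / 2) \<tau> z"
proof -
  let ?c = "2 * of_real pi * \<i> :: complex"
  let ?S = "\<lambda>a b. \<Sum>i\<in>UNIV. theta_prod_d a b \<tau> z i"
  let ?P = "\<lambda>a b. theta_prod a b \<tau> z"
  define Q where "Q = (df * ?P (1 / 2) 0 + f \<tau> * (?S (1 / 2) 0 / 2)) + (dg * ?P 0 0 + g \<tau> * (?S 0 0 / 2)) + (dh * ?P 0 (1 / 2) + h \<tau> * (?S 0 (1 / 2) / 2))"
  have "has_qderiv (\<lambda>t. f t * theta_prod (1 / 2) 0 t z + g t * theta_prod 0 0 t z + h t * theta_prod 0 (1 / 2) t z) Q \<tau>"
    unfolding Q_def by (intro has_qderiv_add has_qderiv_mult theta_prod_qderiv d \<tau>)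
  then have "has_qderiv (\<lambda>t. \<phi> t z) Q \<tau>"
    by (rule has_qderiv_transform[OF _ \<tau>]) (simp add: \<phi>)
  then have 1: "deriv (\<lambda>t. \<phi> t z) \<tau> = ?c * Q"
    unfolding has_qderiv_def by (rule DERIV_imp_deriv)
  have 2: "(deriv ^^ 2) (\<lambda>w. \<phi> \<tau> (\<chi> j. if j = i then w else z $ j)) (z $ i) =
     ?c\<^sup>2 * (f \<tau> * theta_prod_d (1 / 2) 0 \<tau> z i + g \<tau> * theta_prod_d 0 0 \<tau> z i + h \<tau> * theta_prod_d 0 (1 / 2) \<tau> z i)" for i
  proof -
    define R where "R a b = (\<Prod>l\<in>UNIV - {i}. theta_mom a 0 \<tau> (z $ l + b))" for a b
    define H where "H k w = ?c ^ k * (f \<tau> * (theta_mom (1 / 2) k \<tau> (w + 0) * R (1 / 2) 0) + g \<tau> * (theta_mom 0 k \<tau> (w + 0) * R 0 0)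
        + h \<tau> * (theta_mom 0 k \<tau> (w + 1 / 2) * R 0 (1 / 2)))" for k w
    have "(H k has_field_derivative H (Suc k) w) (at w)" for k w
      unfolding H_def[abs_def]
      by (rule derivative_eq_intros theta_mom_shift_deriv \<tau> refl)+ (simp add: algebra_simps)
    then have "deriv (H k) = H (Suc k)" for k
      by (intro ext DERIV_imp_deriv)
    then have "(deriv ^^ 2) (H 0) (z $ i) = H 2 (z $ i)" by (simp add: numeral_2_eq_2)
    moreover have "(\<lambda>w. \<phi> \<tau> (\<chi> j. if j = i then w else z $ j)) = H 0"
      by (rule ext) (simp only: \<phi>[OF \<tau>] theta_prod_update H_def R_def power_0 mult_1)
    moreover have "H 2 (z $ i) = ?c\<^sup>2 * (f \<tau> * theta_prod_d (1 / 2) 0 \<tau> z i + g \<tau> * theta_prod_d 0 0 \<tau> z i + h \<tau> * theta_prod_d 0 (1 / 2) \<tau> z i)"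
      by (simp only: H_def theta_prod_d_def R_def)
    ultimately show ?thesis by simp
  qed
  have c2: "1 / (8 * of_real pi ^ 2) * (?c\<^sup>2 * x) = - x / 2" for x
    by (simp add: power_mult_distrib)
  have s: "(\<Sum>i\<in>UNIV. ?c\<^sup>2 * (f \<tau> * theta_prod_d (1 / 2) 0 \<tau> z i + g \<tau> * theta_prod_d 0 0 \<tau> z i + h \<tau> * theta_prod_d 0 (1 / 2) \<tau> z i)) =
    ?c\<^sup>2 * (f \<tau> * ?S (1 / 2) 0 + g \<tau> * ?S 0 0 + h \<tau> * ?S 0 (1 / 2))"
    by (simp only: sum_distrib_left[symmetric] sum.distrib)
  have G2: "of_int (2 * k - 8) * eis_G2 \<tau> = - (of_int (k - 4) / 12 * eis_E2 \<tau>)"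
    by (simp add: eis_E2_def field_simps)
  have "1 / ?c * (?c * Q) = Q" by simp
  then show ?thesis
    unfolding heat_op_def 1 2 s c2 G2 unfolding \<phi>[OF \<tau>] Q_def
    by (simp add: field_simps)
qed

lemma theta_mom_tau_plus1:
  "theta_mom 0 0 (\<tau> + 1) z = theta_mom 0 0 \<tau> (z + 1 / 2)"
  "theta_mom (1 / 2) 0 (\<tau> + 1) z = e2pi (1 / 8) * theta_mom (1 / 2) 0 \<tau> z"
proof -
  have "theta_term 0 (\<tau> + 1) z (of_int n + 0) = theta_term 0 \<tau> (z + 1 / 2) (of_int n + 0)" for n
  proof -
    have "even (n\<^sup>2 - n)" by simp
    then obtain k where k: "n\<^sup>2 - n = 2 * k" by (elim evenE)
    then have "(of_int (n\<^sup>2 - n) :: complex) = of_int (2 * k)" by (rule arg_cong)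
    then have "(of_int n)\<^sup>2 = of_int n + 2 * (of_int k :: complex)" by (simp add: algebra_simps)
    then have "e2pi (of_real ((of_int n + 0)\<^sup>2) / 2 * (\<tau> + 1) + of_real (of_int n + 0) * z) =
      e2pi (of_real ((of_int n + 0)\<^sup>2) / 2 * \<tau> + of_real (of_int n + 0) * (z + 1 / 2)) * e2pi (of_int k)"
      unfolding e2pi_add[symmetric] by (intro arg_cong[where f = e2pi]) (simp add: field_simps)
    then show ?thesis by (simp add: theta_term_def)
  qed
  then show "theta_mom 0 0 (\<tau> + 1) z = theta_mom 0 0 \<tau> (z + 1 / 2)" by (simp add: theta_mom_def)
  have "theta_term 0 (\<tau> + 1) z (of_int n + 1 / 2) = e2pi (1 / 8) * theta_term 0 \<tau> z (of_int n + 1 / 2)" for n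
  proof -
    have "even (n\<^sup>2 + n)" by simp
    then obtain k where k: "n\<^sup>2 + n = 2 * k" by (elim evenE)
    then have "(of_int (n\<^sup>2 + n) :: complex) = of_int (2 * k)" by (rule arg_cong)
    then have "(of_int n)\<^sup>2 = 2 * (of_int k :: complex) - of_int n" by (simp add: algebra_simps)
    moreover have "of_real ((of_int n + 1 / 2)\<^sup>2) = ((of_int n)\<^sup>2 + of_int n + 1 / 4 :: complex)"
      by (simp add: power2_eq_square algebra_simps)
    ultimately have "of_real ((of_int n + 1 / 2)\<^sup>2) / 2 = (of_int k + 1 / 8 :: complex)"
      by (simp add: add_divide_distrib)
    then have "e2pi (of_real ((of_int n + 1 / 2)\<^sup>2) / 2 * (\<tau> + 1) + of_real (of_int n + 1 / 2) * z) =
      e2pi (1 / 8) * e2pi (of_real ((of_int n + 1 / 2)\<^sup>2) / 2 * \<tau> + of_real (of_int n + 1 / 2) * z) * e2pi (of_int k)"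
      unfolding e2pi_add[symmetric] by (intro arg_cong[where f = e2pi]) (simp only: distrib_left mult_1_right add_ac)
    then show ?thesis by (simp add: theta_term_def)
  qed
  then show "theta_mom (1 / 2) 0 (\<tau> + 1) z = e2pi (1 / 8) * theta_mom (1 / 2) 0 \<tau> z"
    by (simp add: theta_mom_def infsum_cmult_right')
qed

lemma theta_tau_plus1:
  "theta2 (\<tau> + 1) z = e2pi (1 / 8) * theta2 \<tau> z" "theta3 (\<tau> + 1) z = theta4 \<tau> z"
  "theta4 (\<tau> + 1) z = theta3 \<tau> z" "jtheta (\<tau> + 1) z = e2pi (1 / 8) * jtheta \<tau> z"
  using theta_mom_plus1[of 0 0 \<tau> z]
  by (simp_all add: theta2_def theta3_def theta4_def jtheta_eq_theta_mom theta_mom_tau_plus1 add.commute[of 1 z])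

text \<open>The eighth power of the duplication formula for \<open>\<theta>\<^sub>1\<close> at \<open>\<tau>/2\<close>; its constant \<open>\<theta>\<^sub>2(\<tau>/2)\<^sup>8\<close> is \<open>16 x w\<close>.\<close>

lemma theta_D8_half:
  assumes \<tau>: "Im \<tau> > 0"
  shows "theta_D8 (\<tau> / 2) z * (theta2 \<tau> 0 ^ 4 * theta3 \<tau> 0 ^ 4) = 16 * (theta_D8 \<tau> z * theta_prod 0 (1 / 2) \<tau> z)"
proof -
  have t2: "Im (\<tau> / 2) > 0" using \<tau> by simp
  have t: "theta2 (\<tau> / 2) 0 ^ 8 = 16 * (theta2 \<tau> 0 ^ 4 * theta3 \<tau> 0 ^ 4)"
  proof -
    have "theta2 (\<tau> / 2) 0 ^ 8 = ((theta2 (\<tau> / 2) 0)\<^sup>2) ^ 4" by (simp flip: power_mult)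
    then show ?thesis unfolding theta2_null_sq[OF t2] by (simp add: power_mult_distrib)
  qed
  have "jtheta (\<tau> / 2) w * theta2 (\<tau> / 2) 0 = 2 * (jtheta \<tau> w * theta4 \<tau> w)" for w
    using jtheta_theta4_double[OF t2, of "w / 2"] by simp
  then have "(\<Prod>i\<in>UNIV. jtheta (\<tau> / 2) (z $ i) * theta2 (\<tau> / 2) 0) = (\<Prod>i\<in>(UNIV :: 8 set). 2 * (jtheta \<tau> (z $ i) * theta4 \<tau> (z $ i)))"
    by simp
  then have "theta_D8 (\<tau> / 2) z * theta2 (\<tau> / 2) 0 ^ 8 = 2 ^ 8 * (theta_D8 \<tau> z * theta_prod 0 (1 / 2) \<tau> z)"
    unfolding prod.distrib by (simp add: theta_D8_def theta_prod_eqs)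
  then show ?thesis unfolding t by simp
qed

lemma theta_D8_double:
  assumes \<tau>: "Im \<tau> > 0"
  shows "theta_D8 (2 * \<tau>) (2 *s z) * (theta3 \<tau> 0 ^ 4 * theta4 \<tau> 0 ^ 4) = theta_D8 \<tau> z * theta_prod (1 / 2) 0 \<tau> z"
proof -
  have t: "theta4 (2 * \<tau>) 0 ^ 8 = theta3 \<tau> 0 ^ 4 * theta4 \<tau> 0 ^ 4"
  proof -
    have "theta4 (2 * \<tau>) 0 ^ 8 = (theta4 (2 * \<tau>) (2 * 0) * theta4 (2 * \<tau>) 0) ^ 4"
      by (simp add: power2_eq_square[symmetric] flip: power_mult)
    then show ?thesis unfolding theta3_theta4_double[OF \<tau>, symmetric] by (simp add: power_mult_distrib)
  qed
  have "(\<Prod>i\<in>(UNIV :: 8 set). jtheta (2 * \<tau>) (2 * z $ i) * theta4 (2 * \<tau>) 0) = (\<Prod>i\<in>(UNIV :: 8 set). jtheta \<tau> (z $ i) * theta2 \<tau> (z $ i))"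
    by (simp only: jtheta_theta2_double[OF \<tau>])
  then show ?thesis unfolding prod.distrib by (simp add: theta_D8_def theta_prod_eqs t)
qed

text \<open>The previous formula at \<open>\<tau> + 1\<close>, where \<open>\<theta>\<^sub>3\<close> and \<open>\<theta>\<^sub>4\<close> are exchanged and \<open>\<theta>\<^sub>2\<^sup>4\<close> changes sign.\<close>

lemma theta_D8_half_shift:
  assumes \<tau>: "Im \<tau> > 0"
  shows "theta_D8 ((\<tau> + 1) / 2) z * (theta2 \<tau> 0 ^ 4 * theta4 \<tau> 0 ^ 4) = - 16 * (theta_D8 \<tau> z * theta_prod 0 0 \<tau> z)"
proof -
  have e: "e2pi (1 / 8) ^ 8 = 1" "e2pi (1 / 8) ^ 4 = - 1" by (simp_all add: e2pi_power)
  have "theta_D8 (\<tau> + 1) z = theta_D8 \<tau> z"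
    by (simp add: theta_D8_def theta_tau_plus1 prod.distrib e)
  moreover have "theta_prod 0 (1 / 2) (\<tau> + 1) z = theta_prod 0 0 \<tau> z"
    by (simp add: theta_prod_eqs theta_tau_plus1)
  ultimately have "- (theta_D8 ((\<tau> + 1) / 2) z * (theta2 \<tau> 0 ^ 4 * theta4 \<tau> 0 ^ 4)) = 16 * (theta_D8 \<tau> z * theta_prod 0 0 \<tau> z)"
    using theta_D8_half[of "\<tau> + 1" z] \<tau> by (simp add: theta_tau_plus1 power_mult_distrib e)
  then show ?thesis by (metis minus_minus mult_minus_left)
qed

lemma continuous_theta_prod:
  assumes "Im \<tau> > 0"
  shows "isCont (theta_prod a b \<tau>) z"
proof -
  have "isCont (theta_mom a 0 \<tau>) w" for w
    using theta_mom_deriv_z[OF assms] DERIV_isCont by blast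
  moreover have "isCont (\<lambda>z :: complex ^ 8. z $ i + b) z" for i
    by (intro isCont_add bounded_linear.isCont[OF bounded_linear_vec_nth] continuous_const continuous_ident)
  ultimately have "isCont (\<lambda>z :: complex ^ 8. theta_mom a 0 \<tau> (z $ i + b)) z" for i
    using isCont_o2 by blast
  then show ?thesis
    unfolding theta_prod_def isCont_def by (intro tendsto_prod)
qed

lemma jtheta_nonzero_nearby:
  assumes \<tau>: "Im \<tau> > 0"
  shows "eventually (\<lambda>s. jtheta \<tau> (w + s) \<noteq> 0) (at 0)"
proof -
  have holo: "jtheta \<tau> holomorphic_on UNIV"
  proof -
    have "(jtheta \<tau> has_field_derivative - \<i> * (2 * of_real pi * \<i> * theta_mom (1 / 2) (Suc 0) \<tau> (u + 1 / 2))) (at u)" for u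
      unfolding jtheta_eq_theta_mom[abs_def] by (intro DERIV_cmult theta_mom_shift_deriv \<tau>)
    then show ?thesis by (auto simp: holomorphic_on_open)
  qed
  obtain \<beta> where \<beta>: "jtheta \<tau> \<beta> \<noteq> 0"
  proof (rule ccontr)
    assume "\<not> thesis"
    then have z: "jtheta \<tau> = (\<lambda>_. 0)" using that by blast
    have "(jtheta \<tau> has_field_derivative 0) (at 0)" unfolding z by simp
    then have "2 * of_real pi * \<i> * jtheta_mom 1 \<tau> = 0"
      using jtheta_has_deriv_0[OF \<tau>] DERIV_unique by blast
    then show False using jtheta_mom_nonzero[OF \<tau>] by simp
  qed
  have "eventually (\<lambda>u. jtheta \<tau> u \<noteq> 0 \<and> u \<in> UNIV) (at w)"
    by (rule non_zero_neighbour_alt[OF holo _ _ _ _ \<beta>]) auto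
  then have "eventually (\<lambda>u. jtheta \<tau> u \<noteq> 0) (at w)" by simp
  then show ?thesis unfolding at_to_0[of w] eventually_filtermap by (simp add: add.commute)
qed

text \<open>Moving along the diagonal direction \<open>(s, \<dots>, s)\<close> leaves the zero divisor at once, since the zeros of \<open>\<theta>\<^sub>1\<close> are
  isolated.\<close>

lemma theta_D8_nonzero_limpt:
  assumes \<tau>: "Im \<tau> > 0"
  shows "z islimpt {w. theta_D8 \<tau> w \<noteq> 0}"
  unfolding islimpt_approachable
proof (intro allI impI)
  fix e :: real assume e: "e > 0"
  define p where "p s = (\<chi> i. z $ i + s)" for s :: complex
  have "(p \<longlongrightarrow> (\<chi> i. z $ i + 0)) (at 0)"
    unfolding p_def by (intro tendsto_intros)
  then have "(p \<longlongrightarrow> z) (at 0)" by (simp add: vec_lambda_eta)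
  then have 1: "eventually (\<lambda>s. dist (p s) z < e) (at 0)" using e by (rule tendstoD)
  have 2: "eventually (\<lambda>s. \<forall>i\<in>UNIV. jtheta \<tau> (z $ i + s) \<noteq> 0) (at 0)"
    by (rule eventually_ball_finite) (use jtheta_nonzero_nearby[OF \<tau>] in auto)
  have 3: "eventually (\<lambda>s::complex. s \<noteq> 0) (at 0)"
    by (simp add: eventually_at_filter)
  from 1 2 3 have "eventually (\<lambda>s. dist (p s) z < e \<and> theta_D8 \<tau> (p s) \<noteq> 0 \<and> p s \<noteq> z) (at 0)"
    by eventually_elim (auto simp: theta_D8_def p_def vec_eq_iff)
  then obtain s where "dist (p s) z < e \<and> theta_D8 \<tau> (p s) \<noteq> 0 \<and> p s \<noteq> z"
    using eventually_happens' at_neq_bot by blast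
  then show "\<exists>x'\<in>{w. theta_D8 \<tau> w \<noteq> 0}. x' \<noteq> z \<and> dist x' z < e" by blast
qed

text \<open>Off the zero divisor \<open>\<theta>\<^sub>1\<close> cancels from every term of the quotient; the resulting expression is continuous
  everywhere, so it is also the limit on the divisor.\<close>

lemma phi_0_eq:
  assumes \<tau>: "Im \<tau> > 0"
  defines "x \<equiv> theta2 \<tau> 0 ^ 4" and "y \<equiv> theta4 \<tau> 0 ^ 4"
  shows "phi_0 \<tau> z = - 8 / (y * (x + y)) * theta_prod (1 / 2) 0 \<tau> z + 8 / (x * y) * theta_prod 0 0 \<tau> z
    + - 8 / (x * (x + y)) * theta_prod 0 (1 / 2) \<tau> z" (is "_ = ?R z")
proof -
  let ?S = "{w. theta_D8 \<tau> w \<noteq> 0}"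
  have w: "theta3 \<tau> 0 ^ 4 = x + y" unfolding x_def y_def by (rule theta_null_quartic[OF \<tau>])
  have nz: "x \<noteq> 0" "y \<noteq> 0" "x + y \<noteq> 0"
    using theta_null_nonzero[OF \<tau>] by (auto simp: x_def y_def simp flip: w[unfolded x_def y_def])
  have R: "- (theta_D8_T2 \<tau> u / theta_D8 \<tau> u) = ?R u" if "u \<in> ?S" for u
  proof -
    define T where "T = theta_D8 \<tau> u"
    have T: "T \<noteq> 0" using that by (simp add: T_def)
    define a b c where "a = theta_prod (1 / 2) 0 \<tau> u / (y * (x + y))" and "b = theta_prod 0 (1 / 2) \<tau> u / (x * (x + y))"
      and "c = theta_prod 0 0 \<tau> u / (x * y)"
    have ab: "theta_prod (1 / 2) 0 \<tau> u = (y * (x + y)) * a" "theta_prod 0 (1 / 2) \<tau> u = (x * (x + y)) * b"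
      "theta_prod 0 0 \<tau> u = (x * y) * c"
      using nz by (simp_all add: a_def b_def c_def)
    have "theta_D8 (2 * \<tau>) (2 *s u) * (y * (x + y)) = T * a * (y * (x + y))"
      using theta_D8_double[OF \<tau>, of u] unfolding w y_def[symmetric] T_def[symmetric] ab by (simp add: mult_ac)
    then have 1: "theta_D8 (2 * \<tau>) (2 *s u) = T * a" using nz by simp
    have "theta_D8 (\<tau> / 2) u * (x * (x + y)) = 16 * (T * b) * (x * (x + y))"
      using theta_D8_half[OF \<tau>, of u] unfolding w x_def[symmetric] T_def[symmetric] ab by (simp add: mult_ac)
    then have 2: "theta_D8 (\<tau> / 2) u = 16 * (T * b)" using nz by simp
    have "theta_D8 ((\<tau> + 1) / 2) u * (x * y) = - 16 * (T * c) * (x * y)"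
      using theta_D8_half_shift[OF \<tau>, of u] unfolding x_def[symmetric] y_def[symmetric] T_def[symmetric] ab by (simp add: mult_ac)
    then have 3: "theta_D8 ((\<tau> + 1) / 2) u = - 16 * (T * c)"
      by (subst (asm) mult_right_cancel) (use nz in auto)
    have "theta_D8_T2 \<tau> u / T = 8 * a + 8 * b - 8 * c"
      unfolding theta_D8_T2_def 1 2 3 using T by (simp add: field_simps)
    moreover have "?R u = - (8 * a + 8 * b - 8 * c)" by (simp add: a_def b_def c_def)
    ultimately show ?thesis by (simp add: T_def)
  qed
  have "isCont ?R z"
    by (intro isCont_add isCont_mult continuous_const continuous_theta_prod \<tau>)
  then have "(?R \<longlongrightarrow> ?R z) (at z within ?S)"
    unfolding isCont_def by (rule tendsto_within_subset) (rule subset_UNIV)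
  moreover have "eventually (\<lambda>u. ?R u = - (theta_D8_T2 \<tau> u / theta_D8 \<tau> u)) (at z within ?S)"
    unfolding eventually_at_filter by (intro always_eventually allI impI R[symmetric])
  ultimately have "((\<lambda>u. - (theta_D8_T2 \<tau> u / theta_D8 \<tau> u)) \<longlongrightarrow> ?R z) (at z within ?S)"
    by (rule Lim_transform_eventually)
  moreover have "at z within ?S \<noteq> bot"
    using theta_D8_nonzero_limpt[OF \<tau>] by (simp add: trivial_limit_within)
  ultimately show ?thesis unfolding phi_0_def by (intro tendsto_Lim)
qed

lemma mod_Delta_eq:
  assumes "Im \<tau> > 0"
  shows "mod_Delta \<tau> = (theta2 \<tau> 0 ^ 4 * theta3 \<tau> 0 ^ 4 * theta4 \<tau> 0 ^ 4)\<^sup>2 / 256"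
proof -
  have 1: "dedekind_eta \<tau> ^ 3 = theta2 \<tau> 0 * theta3 \<tau> 0 * theta4 \<tau> 0 / 2"
    using jtheta_derivative_formula[OF assms] jtheta_mom_eis_sum(1)[OF assms] by simp
  have "mod_Delta \<tau> = (dedekind_eta \<tau> ^ 3) ^ 8" by (simp add: mod_Delta_def flip: power_mult)
  then show ?thesis unfolding 1 by (simp add: power_divide power_mult_distrib flip: power_mult)
qed

text \<open>Here \<open>E\<^sub>4 - \<theta>\<^sub>j\<^sup>8\<close> is \<open>y w\<close>, \<open>- x y\<close>, \<open>x w\<close> for \<open>j = 2, 3, 4\<close>.\<close>

lemma phi_m4_eq:
  assumes \<tau>: "Im \<tau> > 0"
  defines "x \<equiv> theta2 \<tau> 0 ^ 4" and "y \<equiv> theta4 \<tau> 0 ^ 4"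
  shows "phi_m4 \<tau> z = 256 / (x * x * y * (x + y)) * theta_prod (1 / 2) 0 \<tau> z
    + - 256 / (x * y * (x + y) * (x + y)) * theta_prod 0 0 \<tau> z
    + 256 / (x * y * y * (x + y)) * theta_prod 0 (1 / 2) \<tau> z"
proof -
  define P1 P2 P3 P4 where "P1 = (\<Prod>i\<in>UNIV. jtheta \<tau> (z $ i))" and "P2 = theta_prod (1 / 2) 0 \<tau> z"
    and "P3 = theta_prod 0 0 \<tau> z" and "P4 = theta_prod 0 (1 / 2) \<tau> z"
  have w: "theta3 \<tau> 0 ^ 4 = x + y" unfolding x_def y_def by (rule theta_null_quartic[OF \<tau>])
  have nz: "x \<noteq> 0" "y \<noteq> 0" "x + y \<noteq> 0"
    using theta_null_nonzero[OF \<tau>] by (auto simp: x_def y_def simp flip: w[unfolded x_def y_def])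
  have p8: "theta2 \<tau> 0 ^ 8 = x * x" "theta4 \<tau> 0 ^ 8 = y * y" "theta3 \<tau> 0 ^ 8 = (x + y) * (x + y)"
    unfolding w[symmetric] by (simp_all add: x_def y_def flip: power_add)
  have E4: "eis_E4 \<tau> = x * x + x * y + y * y"
    unfolding eis_E4_theta[OF \<tau>] p8 by (simp add: x_def y_def)
  have D: "mod_Delta \<tau> = (x * (x + y) * y)\<^sup>2 / 256"
    unfolding mod_Delta_eq[OF \<tau>] w by (simp add: x_def y_def)
  have e8: "theta_E8 \<tau> z = 1 / 2 * (P3 + P4 + P2 + P1)"
    unfolding theta_E8_eq[OF \<tau>] P1_def P2_def P3_def P4_def theta_prod_eqs ..
  have d16: "theta_D16_plus_restricted \<tau> z = 1 / 2 * (P3 * ((x + y) * (x + y)) + P4 * (y * y) + P2 * (x * x))"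
    unfolding theta_D16_plus_restricted_eq[OF \<tau>] P2_def P3_def P4_def theta_prod_eqs p8 ..
  have om: "omega_m8 \<tau> z = inverse (mod_Delta \<tau>) * P1"
    by (simp add: omega_m8_def mod_Delta_def P1_def)
  have lin: "K * (p * P2 - r * P3 + s * P4) = K * p * P2 - K * r * P3 + K * s * P4" for K p r s
    by (simp add: algebra_simps)
  have "phi_m4 \<tau> z = inverse (mod_Delta \<tau>) * (y * (x + y) * P2 - x * y * P3 + x * (x + y) * P4)"
  proof -
    have "2 * i * ((x * x + x * y + y * y) * (1 / 2 * (P3 + P4 + P2 + P1)) -
        1 / 2 * (P3 * ((x + y) * (x + y)) + P4 * (y * y) + P2 * (x * x))) - (x * x + x * y + y * y) * (i * P1) =
      i * (y * (x + y) * P2 - x * y * P3 + x * (x + y) * P4)" for i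
      by (simp add: field_simps)
    then show ?thesis unfolding phi_m4_def e8 d16 om E4 .
  qed
  also have "inverse (mod_Delta \<tau>) = 256 / (x * (x + y) * y)\<^sup>2" unfolding D by simp
  also have "256 / (x * (x + y) * y)\<^sup>2 * (y * (x + y) * P2 - x * y * P3 + x * (x + y) * P4) =
     256 / (x * (x + y) * y)\<^sup>2 * (y * (x + y)) * P2 - 256 / (x * (x + y) * y)\<^sup>2 * (x * y) * P3 + 256 / (x * (x + y) * y)\<^sup>2 * (x * (x + y)) * P4"
    by (rule lin)
  also have "256 / (x * (x + y) * y)\<^sup>2 * (y * (x + y)) = 256 / (x * x * y * (x + y))"
  proof -
    have "(x * (x + y) * y)\<^sup>2 = (x * x * y * (x + y)) * (y * (x + y))" by (simp only: power2_eq_square mult_ac)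
    then show ?thesis using nz by simp
  qed
  also have "256 / (x * (x + y) * y)\<^sup>2 * (x * y) = 256 / (x * y * (x + y) * (x + y))"
  proof -
    have "(x * (x + y) * y)\<^sup>2 = (x * y * (x + y) * (x + y)) * (x * y)" by (simp only: power2_eq_square mult_ac)
    then show ?thesis using nz by simp
  qed
  also have "256 / (x * (x + y) * y)\<^sup>2 * (x * (x + y)) = 256 / (x * y * y * (x + y))"
  proof -
    have "(x * (x + y) * y)\<^sup>2 = (x * y * y * (x + y)) * (x * (x + y))" by (simp only: power2_eq_square mult_ac)
    then show ?thesis using nz by simp
  qed
  finally show ?thesis by (simp add: P2_def P3_def P4_def)
qed

lemma theta_constants_nonzero:
  assumes \<tau>: "Im \<tau> > 0"
  shows "theta2 \<tau> 0 ^ 4 \<noteq> 0" "theta4 \<tau> 0 ^ 4 \<noteq> 0" "theta2 \<tau> 0 ^ 4 + theta4 \<tau> 0 ^ 4 \<noteq> 0"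
  unfolding theta_null_quartic[OF \<tau>, symmetric] using theta_null_nonzero[OF \<tau>] by simp_all

lemma theta_constants_qderiv:
  assumes \<tau>: "Im \<tau> > 0"
  defines "x \<equiv> theta2 \<tau> 0 ^ 4" and "y \<equiv> theta4 \<tau> 0 ^ 4" and "E \<equiv> eis_E2 \<tau>"
  shows "has_qderiv (\<lambda>t. theta2 t 0 ^ 4) (x * (E + x + 2 * y) / 6) \<tau>"
    and "has_qderiv (\<lambda>t. theta4 t 0 ^ 4) (y * (E - 2 * x - y) / 6) \<tau>"
    and "has_qderiv (\<lambda>t. theta2 t 0 ^ 4 + theta4 t 0 ^ 4) ((x + y) * (E + x - y) / 6) \<tau>"
proof -
  have w: "theta3 \<tau> 0 ^ 4 = x + y" unfolding x_def y_def by (rule theta_null_quartic[OF \<tau>])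
  note ds = theta_null_fourth_qderiv[OF \<tau>, unfolded w, folded x_def y_def E_def]
  show 1: "has_qderiv (\<lambda>t. theta2 t 0 ^ 4) (x * (E + x + 2 * y) / 6) \<tau>"
    using ds(1) by (simp add: algebra_simps)
  show 2: "has_qderiv (\<lambda>t. theta4 t 0 ^ 4) (y * (E - 2 * x - y) / 6) \<tau>"
    using ds(3) by (simp add: algebra_simps)
  have "x * (E + x + 2 * y) / 6 + y * (E - 2 * x - y) / 6 = (x + y) * (E + x - y) / 6"
    by (simp add: field_simps)
  with has_qderiv_add[OF 1 2]
  show "has_qderiv (\<lambda>t. theta2 t 0 ^ 4 + theta4 t 0 ^ 4) ((x + y) * (E + x - y) / 6) \<tau>" by simp
qed

text \<open>Products and reciprocals are differentiated in logarithmic form, so that the derivative of a monomial in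
  \<open>x, y, x + y\<close> is that monomial times a linear form.\<close>

lemma has_qderiv_logderiv:
  assumes "has_qderiv f (f \<tau> * a) \<tau>" "has_qderiv g (g \<tau> * b) \<tau>"
  shows "has_qderiv (\<lambda>t. f t * g t) ((f \<tau> * g \<tau>) * (a + b)) \<tau>"
  using has_qderiv_mult[OF assms] by (simp add: algebra_simps)

lemma has_qderiv_logderiv_divide:
  assumes "has_qderiv g (g \<tau> * b) \<tau>" "g \<tau> \<noteq> 0"
  shows "has_qderiv (\<lambda>t. c / g t) (c / g \<tau> * (- b)) \<tau>"
  using has_qderiv_divide[OF has_qderiv_const assms(1) assms(2), of c] assms(2)
  by (simp add: power2_eq_square)

text \<open>In weight \<open>-4\<close> the term \<open>2/3 E\<^sub>2\<close> of the Serre derivative removes the \<open>E\<^sub>2\<close> coming from the four factors of each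
  denominator.\<close>

lemma phi_m2_eq:
  assumes \<tau>: "Im \<tau> > 0"
  defines "x \<equiv> theta2 \<tau> 0 ^ 4" and "y \<equiv> theta4 \<tau> 0 ^ 4"
  shows "phi_m2 \<tau> z = - 128 * (x + 2 * y) / (x * x * y * (x + y)) * theta_prod (1 / 2) 0 \<tau> z
    + 128 * (x - y) / (x * y * (x + y) * (x + y)) * theta_prod 0 0 \<tau> z
    + 128 * (2 * x + y) / (x * y * y * (x + y)) * theta_prod 0 (1 / 2) \<tau> z"
proof -
  let ?x = "\<lambda>t. theta2 t 0 ^ 4" and ?y = "\<lambda>t. theta4 t 0 ^ 4"
  define E where "E = eis_E2 \<tau>"
  note nz = theta_constants_nonzero[OF \<tau>]
  define a b c where "a = (E + x + 2 * y) / 6" and "b = (E - 2 * x - y) / 6" and "c = (E + x - y) / 6"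
  have d: "has_qderiv ?x (?x \<tau> * a) \<tau>" "has_qderiv ?y (?y \<tau> * b) \<tau>" "has_qderiv (\<lambda>t. ?x t + ?y t) ((?x \<tau> + ?y \<tau>) * c) \<tau>"
    using theta_constants_qderiv[OF \<tau>] by (simp_all add: a_def b_def c_def x_def y_def E_def)
  have df: "has_qderiv (\<lambda>t. 256 / (?x t * ?x t * ?y t * (?x t + ?y t))) (256 / (?x \<tau> * ?x \<tau> * ?y \<tau> * (?x \<tau> + ?y \<tau>)) * - (a + a + b + c)) \<tau>"
    using nz by (intro has_qderiv_logderiv_divide has_qderiv_logderiv d) simp
  have dg: "has_qderiv (\<lambda>t. - 256 / (?x t * ?y t * (?x t + ?y t) * (?x t + ?y t))) (- 256 / (?x \<tau> * ?y \<tau> * (?x \<tau> + ?y \<tau>) * (?x \<tau> + ?y \<tau>)) * - (a + b + c + c)) \<tau>"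
    using nz by (intro has_qderiv_logderiv_divide has_qderiv_logderiv d) simp
  have dh: "has_qderiv (\<lambda>t. 256 / (?x t * ?y t * ?y t * (?x t + ?y t))) (256 / (?x \<tau> * ?y \<tau> * ?y \<tau> * (?x \<tau> + ?y \<tau>)) * - (a + b + b + c)) \<tau>"
    using nz by (intro has_qderiv_logderiv_divide has_qderiv_logderiv d) simp
  have k: "of_int (- 4 - 4) / 12 * E = - (2 / 3 * E)" by simp
  define F G H where "F = 256 / (x * x * y * (x + y))" and "G = - 256 / (x * y * (x + y) * (x + y))" and "H = 256 / (x * y * y * (x + y))"
  define P Q R where "P = theta_prod (1 / 2) 0 \<tau> z" and "Q = theta_prod 0 0 \<tau> z" and "R = theta_prod 0 (1 / 2) \<tau> z"
  have 1: "heat_op (- 4) phi_m4 \<tau> z = (F * - (a + a + b + c) - - (2 / 3 * E) * F) * P +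
      (G * - (a + b + c + c) - - (2 / 3 * E) * G) * Q + (H * - (a + b + b + c) - - (2 / 3 * E) * H) * R"
    by (rule trans[OF heat_op_theta_combination[OF \<tau> _ df dg dh]], erule phi_m4_eq,
      simp only: k E_def[symmetric] x_def[symmetric] y_def[symmetric] F_def[symmetric] G_def[symmetric] H_def[symmetric]
        P_def[symmetric] Q_def[symmetric] R_def[symmetric])
  have e: "3 * (f * s - - (2 / 3 * E) * f) = f * (3 * s + 2 * E)" for f s by (simp add: algebra_simps)
  have abc: "3 * - (a + a + b + c) + 2 * E = - (x + 2 * y) / 2" "3 * - (a + b + c + c) + 2 * E = - (x - y) / 2"
    "3 * - (a + b + b + c) + 2 * E = (2 * x + y) / 2"
    by (simp_all add: a_def b_def c_def field_simps)
  have "phi_m2 \<tau> z = F * (- (x + 2 * y) / 2) * P + G * (- (x - y) / 2) * Q + H * ((2 * x + y) / 2) * R"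
    unfolding phi_m2_def 1 distrib_left[of 3] mult.assoc[of 3, symmetric] e abc ..
  moreover have "256 / m * (- u / 2) = - 128 * u / m" "- 256 / m * (- u / 2) = 128 * u / m" "256 / m * (u / 2) = 128 * u / m"
    for m u :: complex by simp_all
  ultimately show ?thesis
    unfolding F_def G_def H_def P_def Q_def R_def by (simp only:)
qed

theorem mainTheorem2:
  fixes \<tau> :: complex and z :: "complex ^ 8"
  assumes "Im \<tau> > 0"
  shows "3 * heat_op (- 4) phi_m4 \<tau> z = phi_m2 \<tau> z
    \<and> 2 * heat_op (- 2) phi_m2 \<tau> z - eis_E4 \<tau> * phi_m4 \<tau> z = 32 * phi_0 \<tau> z
    \<and> eis_E6 \<tau> * phi_m4 \<tau> z + eis_E4 \<tau> * phi_m2 \<tau> z = 288 * heat_op 0 phi_0 \<tau> z"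
proof (intro conjI)
  show "3 * heat_op (- 4) phi_m4 \<tau> z = phi_m2 \<tau> z" by (simp add: phi_m2_def)
  let ?x = "\<lambda>t. theta2 t 0 ^ 4" and ?y = "\<lambda>t. theta4 t 0 ^ 4"
  define x y E P Q R where "x = ?x \<tau>" and "y = ?y \<tau>" and "E = eis_E2 \<tau>"
    and "P = theta_prod (1 / 2) 0 \<tau> z" and "Q = theta_prod 0 0 \<tau> z" and "R = theta_prod 0 (1 / 2) \<tau> z"
  note nz = theta_constants_nonzero[OF assms]
  have nz': "x \<noteq> 0" "y \<noteq> 0" "x + y \<noteq> 0" using nz by (simp_all add: x_def y_def)
  define a b c where "a = (E + x + 2 * y) / 6" and "b = (E - 2 * x - y) / 6" and "c = (E + x - y) / 6"
  have d: "has_qderiv ?x (?x \<tau> * a) \<tau>" "has_qderiv ?y (?y \<tau> * b) \<tau>" "has_qderiv (\<lambda>t. ?x t + ?y t) ((?x \<tau> + ?y \<tau>) * c) \<tau>"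
    using theta_constants_qderiv[OF assms] by (simp_all add: a_def b_def c_def x_def y_def E_def)
  note folds = x_def[symmetric] y_def[symmetric] E_def[symmetric] P_def[symmetric] Q_def[symmetric] R_def[symmetric]
  have E4: "eis_E4 \<tau> = x\<^sup>2 + x * y + y\<^sup>2"
    unfolding eis_E4_theta[OF assms] x_def y_def by (simp flip: power_mult)
  have E6: "eis_E6 \<tau> = (2 * x + y) * (x + 2 * y) * (y - x) / 2"
    unfolding eis_E6_theta[OF assms] x_def y_def ..
  show "2 * heat_op (- 2) phi_m2 \<tau> z - eis_E4 \<tau> * phi_m4 \<tau> z = 32 * phi_0 \<tau> z"
  proof -
    have u: "has_qderiv (\<lambda>t. - 128 * (?x t + 2 * ?y t)) (- 128 * (x * a + 2 * (y * b))) \<tau>"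
      "has_qderiv (\<lambda>t. 128 * (?x t - ?y t)) (128 * (x * a - y * b)) \<tau>"
      "has_qderiv (\<lambda>t. 128 * (2 * ?x t + ?y t)) (128 * (2 * (x * a) + y * b)) \<tau>"
      unfolding x_def y_def by (intro has_qderiv_cmult has_qderiv_add has_qderiv_diff d)+
    have v: "has_qderiv (\<lambda>t. 1 / (?x t * ?x t * ?y t * (?x t + ?y t))) (1 / (?x \<tau> * ?x \<tau> * ?y \<tau> * (?x \<tau> + ?y \<tau>)) * - (a + a + b + c)) \<tau>"
      "has_qderiv (\<lambda>t. 1 / (?x t * ?y t * (?x t + ?y t) * (?x t + ?y t))) (1 / (?x \<tau> * ?y \<tau> * (?x \<tau> + ?y \<tau>) * (?x \<tau> + ?y \<tau>)) * - (a + b + c + c)) \<tau>"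
      "has_qderiv (\<lambda>t. 1 / (?x t * ?y t * ?y t * (?x t + ?y t))) (1 / (?x \<tau> * ?y \<tau> * ?y \<tau> * (?x \<tau> + ?y \<tau>)) * - (a + b + b + c)) \<tau>"
      using nz by (intro has_qderiv_logderiv_divide has_qderiv_logderiv d; simp)+
    have rep: "phi_m2 t z = - 128 * (?x t + 2 * ?y t) * (1 / (?x t * ?x t * ?y t * (?x t + ?y t))) * theta_prod (1 / 2) 0 t z
      + 128 * (?x t - ?y t) * (1 / (?x t * ?y t * (?x t + ?y t) * (?x t + ?y t))) * theta_prod 0 0 t z
      + 128 * (2 * ?x t + ?y t) * (1 / (?x t * ?y t * ?y t * (?x t + ?y t))) * theta_prod 0 (1 / 2) t z" if "Im t > 0" for t z
      unfolding phi_m2_eq[OF that] by (simp only: divide_inverse mult_1_left mult.assoc)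
    define F G H where "F = 1 / (x * x * y * (x + y))" and "G = 1 / (x * y * (x + y) * (x + y))" and "H = 1 / (x * y * y * (x + y))"
    have k: "of_int (- 2 - 4) / 12 * E = - (E / 2)" by simp
    have 1: "heat_op (- 2) phi_m2 \<tau> z =
        (- 128 * (x * a + 2 * (y * b)) * F + - 128 * (x + 2 * y) * (F * - (a + a + b + c)) - - (E / 2) * (- 128 * (x + 2 * y) * F)) * P +
        (128 * (x * a - y * b) * G + 128 * (x - y) * (G * - (a + b + c + c)) - - (E / 2) * (128 * (x - y) * G)) * Q +
        (128 * (2 * (x * a) + y * b) * H + 128 * (2 * x + y) * (H * - (a + b + b + c)) - - (E / 2) * (128 * (2 * x + y) * H)) * R"
      by (rule trans[OF heat_op_theta_combination[OF assms _ has_qderiv_mult[OF u(1) v(1)] has_qderiv_mult[OF u(2) v(2)] has_qderiv_mult[OF u(3) v(3)]]],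
        erule rep, simp only: k folds F_def[symmetric] G_def[symmetric] H_def[symmetric])
    have 2: "phi_m4 \<tau> z = 256 * F * P - 256 * G * Q + 256 * H * R"
      unfolding phi_m4_eq[OF assms] folds F_def G_def H_def by (simp add: divide_inverse)
    have 3: "phi_0 \<tau> z = - 8 * (x * x * F) * P + 8 * ((x + y) * (x + y) * G) * Q - 8 * (y * y * H) * R"
      unfolding phi_0_eq[OF assms] folds F_def G_def H_def using nz' by simp
    show ?thesis
      unfolding 1 2 3 E4 a_def b_def c_def by (simp add: field_simps power2_eq_square)
  qed
  show "eis_E6 \<tau> * phi_m4 \<tau> z + eis_E4 \<tau> * phi_m2 \<tau> z = 288 * heat_op 0 phi_0 \<tau> z"
  proof -
    have v: "has_qderiv (\<lambda>t. - 8 / (?y t * (?x t + ?y t))) (- 8 / (?y \<tau> * (?x \<tau> + ?y \<tau>)) * - (b + c)) \<tau>"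
      "has_qderiv (\<lambda>t. 8 / (?x t * ?y t)) (8 / (?x \<tau> * ?y \<tau>) * - (a + b)) \<tau>"
      "has_qderiv (\<lambda>t. - 8 / (?x t * (?x t + ?y t))) (- 8 / (?x \<tau> * (?x \<tau> + ?y \<tau>)) * - (a + c)) \<tau>"
      using nz by (intro has_qderiv_logderiv_divide has_qderiv_logderiv d; simp)+
    define F G H where "F = 1 / (x * x * y * (x + y))" and "G = 1 / (x * y * (x + y) * (x + y))" and "H = 1 / (x * y * y * (x + y))"
    have FGH: "- 8 / (y * (x + y)) = - 8 * (x * x * F)" "8 / (x * y) = 8 * ((x + y) * (x + y) * G)" "- 8 / (x * (x + y)) = - 8 * (y * y * H)"
      using nz' by (simp_all add: F_def G_def H_def)
    have k: "of_int (0 - 4) / 12 * E = - (E / 3)" by simp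
    have 1: "heat_op 0 phi_0 \<tau> z =
        (- 8 * (x * x * F) * - (b + c) - - (E / 3) * (- 8 * (x * x * F))) * P +
        (8 * ((x + y) * (x + y) * G) * - (a + b) - - (E / 3) * (8 * ((x + y) * (x + y) * G))) * Q +
        (- 8 * (y * y * H) * - (a + c) - - (E / 3) * (- 8 * (y * y * H))) * R"
      by (rule trans[OF heat_op_theta_combination[OF assms _ v]], erule phi_0_eq, simp only: k folds FGH)
    have 2: "phi_m4 \<tau> z = 256 * F * P - 256 * G * Q + 256 * H * R"
      unfolding phi_m4_eq[OF assms] folds F_def G_def H_def by (simp add: divide_inverse)
    have 3: "phi_m2 \<tau> z = - 128 * (x + 2 * y) * F * P + 128 * (x - y) * G * Q + 128 * (2 * x + y) * H * R"
      unfolding phi_m2_eq[OF assms] folds F_def G_def H_def by simp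
    show ?thesis
      unfolding 1 2 3 E4 E6 a_def b_def c_def by (simp add: field_simps power2_eq_square)
  qed
qed

end
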